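(* Let $N\geq 3$ be an integer and let $\mu$ be a real number such that $0<\mu<N$ if $N=3$ or $N=4$, and $0<\mu\leq 4$ if $N\geq 5$. Put $2^{*}=\frac{2N}{N-2}$ and $2^{*}_{\mu}=\frac{2N-\mu}{N-2}$. Let $(u,v)\in L^{2^{*}}_{loc}(\mathbb{R}^{N})\times L^{\frac{2N}{\mu}}_{loc}(\mathbb{R}^{N})$ be a pair of positive solutions of the system $$ u(x)=\int_{\mathbb{R}^{N}}\frac{v(y)\,u(y)^{2^{*}_{\mu}-1}}{|x-y|^{N-2}}\,dy,\qquad v(x)=\int_{\mathbb{R}^{N}}\frac{u(y)^{2^{*}_{\mu}}}{|x-y|^{\mu}}\,dy,\qquad x\in\mathbb{R}^N . $$ Then $u$ and $v$ are radially symmetric (about some point of $\mathbb{R}^N$). Moreover, there exist a point $x_0\in\mathbb{R}^N$ and constants $c>0$, $t>0$ such that $$ u(x)=c\left(\frac{t}{t^{2}+|x-x_{0}|^{2}}\right)^{\frac{N-2}{2}} . $$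
   Context: A pair of positive solutions means a pair of positive functions $u,v$ on $\mathbb{R}^N$ satisfying both integral equations. *)

theory Defs
  imports "HOL-Analysis.Analysis"
begin

definition Lp_loc :: "real \<Rightarrow> ('a::euclidean_space \<Rightarrow> real) \<Rightarrow> bool" where
  "Lp_loc p f \<longleftrightarrow> f \<in> borel_measurable lebesgue \<and>
     (\<forall>K. compact K \<longrightarrow> set_integrable lebesgue K (\<lambda>x. \<bar>f x\<bar> powr p))"

definition radially_symmetric_about :: "'a::euclidean_space \<Rightarrow> ('a \<Rightarrow> real) \<Rightarrow> bool" where
  "radially_symmetric_about p f \<longleftrightarrow> (\<forall>x y. norm (x - p) = norm (y - p) \<longrightarrow> f x = f y)"

definition two_star :: "nat \<Rightarrow> real" where
  "two_star N = 2 * real N / (real N - 2)"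

definition two_star_mu :: "nat \<Rightarrow> real \<Rightarrow> real" where
  "two_star_mu N \<mu> = (2 * real N - \<mu>) / (real N - 2)"

text \<open>The equations are required at every point. Each \<^const>\<open>has_bochner_integral\<close> asserts that the
  integrand is integrable, i.e. the integral converges, and that its integral is the given value.
  On the null set \<open>y = x\<close> the kernels take the value \<open>0\<close> because \<open>a / 0 = 0\<close>.\<close>
definition positive_solution_pair ::
    "real \<Rightarrow> (real ^ 'n::finite \<Rightarrow> real) \<Rightarrow> (real ^ 'n \<Rightarrow> real) \<Rightarrow> bool" where
  "positive_solution_pair \<mu> u v \<longleftrightarrow>
     (\<forall>x. 0 < u x) \<and> (\<forall>x. 0 < v x) \<and>
     (\<forall>x. has_bochner_integral lebesgue
        (\<lambda>y. v y * u y powr (two_star_mu CARD('n) \<mu> - 1) / norm (x - y) powr (real CARD('n) - 2))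
        (u x)) \<and>
     (\<forall>x. has_bochner_integral lebesgue
        (\<lambda>y. u y powr two_star_mu CARD('n) \<mu> / norm (x - y) powr \<mu>)
        (v x))"

end

(* The method of moving spheres, applied to the integral equations directly and without any
   regularity theory. For a centre c and radius l let u_l, v_l be the Kelvin transforms of u, v;
   they solve the same system. If the set in the ball B_l(c) where u > u_l or v > v_l carries little
   of the L^2*- and L^(2N/mu)-mass of (u, v), the diagonal Hardy-Littlewood-Sobolev inequality,
   applied to the positive parts of u - u_l and v - v_l, forces it to be empty. This starts the
   process at small l and continues it until u = u_l, v = v_l; all limits are taken by Fatou's
   lemma, since a Riesz potential of a nonnegative function is lower semicontinuous.

   So at each centre c either u <= u_l in B_l(c) for all l, or u = u_l and v = v_l for some l. The
   first alternative at one centre makes |x|^(N-2) u(x) tend to infinity, which excludes the second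
   alternative at every centre near which u is bounded. By Baire such centres are dense, so the
   first alternative then holds at all centres, u is constant and the integral for v diverges.
   Thus (u, v) is symmetric under an inversion of some radius l(c) about every c, which makes u
   locally bounded, hence continuous, and l a constant multiple of u^(-1/(N-2)). If x0 minimises l,
   comparing l with l(x0) gives l(y)^2 >= l(x)^2 + 2 (x - x0) . (y - x) for all x, y, so that
   l(x)^2 - |x - x0|^2 is constant. *)
theory Submission
  imports Defs
begin

section \<open>Inversion in spheres and the change of variables\<close>

text \<open>Integrability is assumed only locally, which is why the comparison is made inside balls:
  the set where it fails is bounded, so its mass is finite and dominated convergence applies. A
  comparison near infinity would need global norms. Two facts about the exponents carry the
  argument. With p + 1 = (2N - \<mu>)/(N - 2), the identity (N - 2) p + \<mu> = N + 2 turns the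
  Kelvin transform of each source into the source of the Kelvin transforms. It also makes the
  exponents in the integral estimate sum to 1, so that the coefficients enter exactly through the
  two integrals known to be locally finite. The bound \<mu> <= 4 says p >= 1, so that u^p can be
  linearised with the coefficient u^(p-1). The linearisation is arranged so that only u and v appear
  as coefficients: the mass of their Kelvin transforms inside a ball is the mass of u and v outside
  it, which is not controlled. Because the equations hold at every point, an inequality of sources
  almost everywhere becomes an inequality of potentials everywhere.\<close>

lemma AE_neq_lborel: "AE y in lborel. (y :: 'a::euclidean_space) \<noteq> c"
  by (rule AE_I[where N="{c}"]) auto

lemma AE_notin_sphere: "AE y in lborel. (y :: 'a::euclidean_space) \<notin> sphere c r"
  by (rule AE_I[where N="sphere c r"])
    (use negligible_sphere[of c r] in \<open>auto simp: negligible_iff_null_sets null_sets_completion_iff null_sets_def\<close>)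

text \<open>The centre is the origin; a sphere about \<open>c\<close> is treated through
  \<open>x - c\<close> or by translating the functions. At the centre, division by zero gives
  \<open>inversion l 0 = 0\<close>.\<close>

definition inversion :: "real \<Rightarrow> 'a::real_inner \<Rightarrow> 'a" where
  "inversion l x = (l\<^sup>2 / (norm x)\<^sup>2) *\<^sub>R x"

lemma norm_inversion: "norm (inversion l x) = l\<^sup>2 / norm x"
  by (simp add: inversion_def power2_eq_square)

lemma inversion_inversion:
  assumes "l \<noteq> 0" "x \<noteq> 0"
  shows "inversion l (inversion l x) = x"
  using assms by (simp add: inversion_def power2_eq_square field_simps)

lemma inversion_eq_0_iff [simp]: "l \<noteq> 0 \<Longrightarrow> inversion l x = 0 \<longleftrightarrow> x = 0"
  by (simp add: inversion_def)

lemma inversion_measurable [measurable]: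
  "inversion l \<in> borel_measurable (borel :: 'a::euclidean_space measure)"
  unfolding inversion_def by measurable

text \<open>The bracket is the reflection of \<open>h\<close> in the hyperplane orthogonal to
  \<open>x\<close>, so the derivative is a similarity of ratio (l/|x|)^2.\<close>

definition inversion_deriv :: "real \<Rightarrow> 'a::real_inner \<Rightarrow> 'a \<Rightarrow> 'a" where
  "inversion_deriv l x h = (l\<^sup>2 / (norm x)\<^sup>2) *\<^sub>R (h - (2 * (x \<bullet> h) / (norm x)\<^sup>2) *\<^sub>R x)"

lemma has_derivative_inversion:
  fixes x :: "'a::real_inner"
  assumes "x \<noteq> 0"
  shows "(inversion l has_derivative inversion_deriv l x) (at x within S)"
proof -
  have "((\<lambda>x. (l\<^sup>2 / (x \<bullet> x)) *\<^sub>R x) has_derivative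
     (\<lambda>h. (l\<^sup>2 / (x \<bullet> x)) *\<^sub>R h + ((- (l\<^sup>2) * (x \<bullet> h + h \<bullet> x)) / ((x \<bullet> x) * (x \<bullet> x))) *\<^sub>R x)) (at x within S)"
    using assms by (auto intro!: derivative_eq_intros)
  also have "(\<lambda>x. (l\<^sup>2 / (x \<bullet> x)) *\<^sub>R x) = inversion l"
    by (auto simp: inversion_def power2_norm_eq_inner)
  also have "(\<lambda>h. (l\<^sup>2 / (x \<bullet> x)) *\<^sub>R h + ((- (l\<^sup>2) * (x \<bullet> h + h \<bullet> x)) / ((x \<bullet> x) * (x \<bullet> x))) *\<^sub>R x)
      = inversion_deriv l x"
    by (auto simp: inversion_deriv_def power2_norm_eq_inner inner_commute algebra_simps)
  finally show ?thesis .
qed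

text \<open>The points \<open>y\<close> and \<open>inversion l y\<close> are collinear with the
  origin, so both derivatives involve the same reflection, and their ratios (l/|y|)^2 and (|y|/l)^2
  are reciprocal.\<close>

lemma inversion_deriv_inversion:
  fixes y :: "'a::real_inner"
  assumes "l \<noteq> 0" "y \<noteq> 0"
  shows "inversion_deriv l y \<circ> inversion_deriv l (inversion l y) = id"
proof
  fix h
  define n where "n = y \<bullet> y"
  have n: "n \<noteq> 0" using assms by (simp add: n_def)
  have *: "inversion_deriv l (inversion l y) h = (n / l\<^sup>2) *\<^sub>R (h - (2 * (y \<bullet> h) / n) *\<^sub>R y)"
    using assms n unfolding inversion_deriv_def power2_norm_eq_inner inversion_def
    by (simp add: n_def[symmetric] field_simps power2_eq_square)
  show "(inversion_deriv l y \<circ> inversion_deriv l (inversion l y)) h = id h"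
    unfolding o_def * using assms n
    by (simp add: inversion_deriv_def power2_norm_eq_inner n_def[symmetric] inner_diff_right algebra_simps)
qed

text \<open>The similarity ratio (l/|x|)^2 enters once per dimension; the reflection
  \<open>R\<close> is orthogonal and contributes a determinant of modulus 1.\<close>

lemma abs_det_inversion_deriv:
  fixes x :: "real^'n::finite"
  assumes "x \<noteq> 0"
  shows "\<bar>det (matrix (inversion_deriv l x))\<bar> = (l / norm x) ^ (2 * CARD('n))"
proof -
  define R where "R = (\<lambda>h. h - (2 * (x \<bullet> h) / (norm x)\<^sup>2) *\<^sub>R x)"
  have R: "orthogonal_transformation R"
    unfolding orthogonal_transformation_def
  proof
    show "linear R"
      by (rule linearI) (auto simp: R_def algebra_simps inner_add_right add_divide_distrib)
    show "\<forall>v w. R v \<bullet> R w = v \<bullet> w"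
      using assms by (simp add: R_def power2_norm_eq_inner algebra_simps inner_diff_left inner_diff_right inner_commute)
  qed
  have eq: "inversion_deriv l x = (*\<^sub>R) (l\<^sup>2 / (norm x)\<^sup>2) \<circ> R"
    by (auto simp: inversion_deriv_def R_def)
  have "matrix (inversion_deriv l x) = matrix ((*\<^sub>R) (l\<^sup>2 / (norm x)\<^sup>2) :: real^'n \<Rightarrow> _) ** matrix R"
    unfolding eq using R by (intro matrix_compose) (auto simp: orthogonal_transformation_def intro: linear_scaleR)
  then have "\<bar>det (matrix (inversion_deriv l x))\<bar> = \<bar>(l\<^sup>2 / (norm x)\<^sup>2) ^ CARD('n)\<bar> * \<bar>det (matrix R)\<bar>"
    by (simp add: det_mul abs_mult)
  then show ?thesis
    using R by (simp add: orthogonal_transformation_det power_mult power_divide)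
qed

lemma nn_integral_inversion_wellorder:
  fixes f :: "real^'n::{finite,wellorder} \<Rightarrow> real"
  assumes [measurable]: "f \<in> borel_measurable borel" and f: "\<And>x. 0 \<le> f x" and l: "l > 0"
  shows "(\<integral>\<^sup>+ y. f (inversion l y) * (l / norm y) ^ (2 * CARD('n)) \<partial>lborel) = (\<integral>\<^sup>+ y. f y \<partial>lborel)"
proof -
  let ?S = "UNIV - {0 :: real^'n::_}"
  let ?g = "\<lambda>y. f (inversion l y) * (l / norm y) ^ (2 * CARD('n))"
  have [measurable]: "?g \<in> borel_measurable borel" by measurable
  have g: "0 \<le> ?g y" for y using f l by auto
  have cov: "(?g has_integral b) UNIV \<longleftrightarrow> (f has_integral b) UNIV" for b
  proof -
    have "((\<lambda>x. \<bar>det (matrix (inversion_deriv l x))\<bar> * f (inversion l x)) has_integral b) ?S \<longleftrightarrow> (f has_integral b) ?S"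
      by (rule cov_invertible_nonneg_eq[where h="inversion l" and h'="inversion_deriv l"])
        (use l f in \<open>auto simp: inversion_inversion has_derivative_inversion inversion_deriv_inversion\<close>)
    moreover have "((\<lambda>x. \<bar>det (matrix (inversion_deriv l x))\<bar> * f (inversion l x)) has_integral b) ?S \<longleftrightarrow> (?g has_integral b) ?S"
      by (rule has_integral_cong) (auto simp: abs_det_inversion_deriv)
    moreover have "(F has_integral b) ?S \<longleftrightarrow> (F has_integral b) UNIV" for F :: "real^'n::_ \<Rightarrow> real"
    proof (rule has_integral_spike_set_eq)
      show "negligible {x \<in> ?S - UNIV. F x \<noteq> 0}" by simp
      show "negligible {x \<in> UNIV - ?S. F x \<noteq> 0}" by (rule negligible_subset[of "{0}"]) auto
    qed
    ultimately show ?thesis by blast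
  qed
  have fin: "(\<integral>\<^sup>+ y. F y \<partial>lborel) = ennreal b \<and> 0 \<le> b \<longleftrightarrow> (F has_integral b) UNIV"
    if "F \<in> borel_measurable borel" "\<And>x. 0 \<le> F x" for F :: "real^'n::_ \<Rightarrow> real" and b
    using has_integral_iff_nn_integral_lebesgue[of F b] that
    by (auto simp: nn_integral_completion measurable_completion)
  \<comment> \<open>The two integrals admit the same finite values, so one is infinite exactly when
    the other is; this extends a statement about finite integrals to all of
    \<open>ennreal\<close>.\<close>
  have gb: "(\<integral>\<^sup>+ y. ?g y \<partial>lborel) = ennreal b \<and> 0 \<le> b \<longleftrightarrow> (\<integral>\<^sup>+ y. f y \<partial>lborel) = ennreal b \<and> 0 \<le> b" for b
    using fin[of ?g b, OF _ g] fin[of f b, OF _ f] cov[of b] by simp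
  show ?thesis
  proof (cases "\<integral>\<^sup>+ y. f y \<partial>lborel" rule: ennreal_cases)
    case (real r)
    then show ?thesis using gb[of r] by simp
  next
    case top
    show ?thesis
    proof (cases "\<integral>\<^sup>+ y. ?g y \<partial>lborel" rule: ennreal_cases)
      case (real r)
      then show ?thesis using gb[of r] by simp
    qed (use top in simp)
  qed
qed

text \<open>The change-of-variables theorem is only available for index types of class \<^class>\<open>wellorder\<close>;
  a well-ordered copy of a finite index type transfers it to arbitrary finite ones.\<close>

typedef 'a wellordered = "UNIV :: 'a set" ..

instance wellordered :: (finite) finite
proof
  have "(UNIV :: 'a wellordered set) = Abs_wellordered ` UNIV"
    by (metis (full_types) Rep_wellordered_inverse UNIV_eq_I rangeI)
  then show "finite (UNIV :: 'a wellordered set)"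
    by (metis finite finite_imageI)
qed

definition enum_index :: "'a::finite \<Rightarrow> nat" where
  "enum_index = (SOME f. inj f)"

lemma inj_enum_index: "inj (enum_index :: 'a::finite \<Rightarrow> nat)"
proof -
  have "\<exists>f :: 'a \<Rightarrow> nat. inj f"
    using finite_imp_inj_to_nat_seg[of "UNIV::'a set"] by blast
  then show ?thesis unfolding enum_index_def by (rule someI_ex)
qed

instantiation wellordered :: (finite) wellorder
begin

definition less_eq_wellordered :: "'a wellordered \<Rightarrow> 'a wellordered \<Rightarrow> bool" where
  "less_eq_wellordered x y \<longleftrightarrow> enum_index (Rep_wellordered x) \<le> enum_index (Rep_wellordered y)"

definition less_wellordered :: "'a wellordered \<Rightarrow> 'a wellordered \<Rightarrow> bool" where
  "less_wellordered x y \<longleftrightarrow> enum_index (Rep_wellordered x) < enum_index (Rep_wellordered y)"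

instance
proof
  fix x y z :: "'a wellordered"
  show "x = y" if "x \<le> y" "y \<le> x"
    using that inj_enum_index[where 'a='a]
    by (metis Rep_wellordered_inject antisym injD less_eq_wellordered_def)
  show "P x" if "\<And>x. (\<And>y. y < x \<Longrightarrow> P y) \<Longrightarrow> P x" for P
    by (rule measure_induct_rule[of "\<lambda>x. enum_index (Rep_wellordered x)", OF that])
      (simp add: less_wellordered_def)
qed (auto simp: less_eq_wellordered_def less_wellordered_def)

end

definition reindex :: "real^'n::finite \<Rightarrow> real^'n wellordered" where
  "reindex x = (\<chi> i. x $ Rep_wellordered i)"

lemma bij_Rep_wellordered: "bij Rep_wellordered"
  by (metis Abs_wellordered_inverse Rep_wellordered_inverse UNIV_I bijI')

lemma norm_reindex [simp]: "norm (reindex x) = norm x"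
  unfolding norm_eq_sqrt_inner inner_vec_def reindex_def
  using sum.reindex_bij_betw[OF bij_Rep_wellordered, of "\<lambda>i. x $ i * x $ i"] by simp

lemma CARD_wellordered [simp]: "CARD('n wellordered) = CARD('n)"
  using bij_betw_same_card[OF bij_Rep_wellordered] by auto

lemma reindex_scaleR: "reindex (c *\<^sub>R x) = c *\<^sub>R reindex x"
  by (simp add: reindex_def vec_eq_iff)

lemma reindex_inversion: "reindex (inversion l x) = inversion l (reindex x)"
proof -
  have 1: "inversion l (reindex x) = (l\<^sup>2 / (norm x)\<^sup>2) *\<^sub>R reindex x"
    by (subst inversion_def) (subst norm_reindex, rule refl)
  have 2: "reindex (inversion l x) = (l\<^sup>2 / (norm x)\<^sup>2) *\<^sub>R reindex x"
    by (subst inversion_def) (rule reindex_scaleR)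
  show ?thesis using 1 2 by (rule trans[OF _ sym, rotated])
qed

lemma reindex_measurable [measurable]: "reindex \<in> borel_measurable borel"
  by (intro borel_measurable_continuous_onI)
    (auto simp: reindex_def[abs_def] intro!: continuous_intros)

text \<open>Renaming coordinates maps boxes to boxes with the same side lengths, and Lebesgue
  measure is determined by its values on boxes.\<close>

lemma lborel_reindex: "distr lborel borel reindex = (lborel :: (real^'n::finite wellordered) measure)"
proof (rule lborel_eqI[symmetric])
  fix l u :: "real^'n wellordered"
  assume lu: "\<And>b. b \<in> Basis \<Longrightarrow> l \<bullet> b \<le> u \<bullet> b"
  define unindex where "unindex = (\<lambda>z :: real^'n wellordered. (\<chi> i. z $ Abs_wellordered i) :: real^'n)"
  have unindex: "unindex z $ i = z $ Abs_wellordered i" for z i by (simp add: unindex_def)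
  have le: "l $ i \<le> u $ i" for i
    using lu[of "axis i 1"] by (auto simp: Basis_vec_def inner_axis)
  \<comment> \<open>Volumes are written as products over the index type: the two bases lie in
    different spaces, and only their indices can be matched by a bijection.\<close>
  have bas: "(\<Prod>b\<in>Basis. (u - l) \<bullet> b) = (\<Prod>i\<in>UNIV. u $ i - l $ i)" for u l :: "real^'k::finite"
  proof -
    have "Basis = (\<lambda>i. axis i 1 :: real^'k) ` UNIV" by (auto simp: Basis_vec_def)
    moreover have "inj (\<lambda>i. axis i 1 :: real^'k)" by (auto simp: inj_on_def axis_eq_axis)
    ultimately have "(\<Prod>b\<in>Basis. (u - l) \<bullet> b) = (\<Prod>i\<in>UNIV. (u - l) \<bullet> (axis i 1 :: real^'k))"
      by (metis (no_types, lifting) comp_apply prod.cong prod.reindex)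
    then show ?thesis
      by (simp add: inner_axis)
  qed
  have vim: "reindex -` box l u = box (unindex l) (unindex u)"
  proof -
    have "(\<forall>i. P i (Rep_wellordered i)) \<longleftrightarrow> (\<forall>j. P (Abs_wellordered j) j)" for P :: "'n wellordered \<Rightarrow> 'n \<Rightarrow> bool"
      by (metis Abs_wellordered_inverse Rep_wellordered_inverse UNIV_I)
    from this[of "\<lambda>i j. l $ i < _ $ j \<and> _ $ j < u $ i"] show ?thesis
      by (auto simp: set_eq_iff mem_box_cart unindex reindex_def)
  qed
  have "emeasure (distr lborel borel reindex) (box l u) = emeasure lborel (box (unindex l) (unindex u))"
    by (simp add: emeasure_distr vim)
  also have "\<dots> = (\<Prod>b\<in>Basis. (unindex u - unindex l) \<bullet> b)"
    by (rule emeasure_lborel_box) (auto simp: Basis_vec_def inner_axis unindex le)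
  also have "(\<Prod>b\<in>Basis. (unindex u - unindex l) \<bullet> b) = (\<Prod>b\<in>Basis. (u - l) \<bullet> b)"
    unfolding bas using prod.reindex_bij_betw[OF bij_Rep_wellordered, of "\<lambda>i. unindex u $ i - unindex l $ i"]
    by (simp add: unindex Rep_wellordered_inverse)
  finally show "emeasure (distr lborel borel reindex) (box l u) = (\<Prod>b\<in>Basis. (u - l) \<bullet> b)" .
qed simp

lemma nn_integral_inversion:
  fixes f :: "real^'n::finite \<Rightarrow> real"
  assumes [measurable]: "f \<in> borel_measurable borel" and f: "\<And>x. 0 \<le> f x" and l: "l > 0"
  shows "(\<integral>\<^sup>+ y. f (inversion l y) * (l / norm y) ^ (2 * CARD('n)) \<partial>lborel) = (\<integral>\<^sup>+ y. f y \<partial>lborel)"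
proof -
  define unindex where "unindex = (\<lambda>z :: real^'n wellordered. (\<chi> i. z $ Abs_wellordered i) :: real^'n)"
  have unindex [simp]: "unindex (reindex x) = x" for x
    by (simp add: unindex_def reindex_def vec_eq_iff Abs_wellordered_inverse)
  have [measurable]: "unindex \<in> borel_measurable borel"
    by (intro borel_measurable_continuous_onI) (auto simp: unindex_def intro!: continuous_intros)
  have tr: "(\<integral>\<^sup>+ y. F y \<partial>lborel) = (\<integral>\<^sup>+ y. F (reindex y) \<partial>lborel)"
    if [measurable]: "F \<in> borel_measurable borel" for F :: "real^'n wellordered \<Rightarrow> ennreal"
    by (subst lborel_reindex[symmetric]) (simp add: nn_integral_distr)
  have "(\<integral>\<^sup>+ y. f (unindex (inversion l y)) * (l / norm y) ^ (2 * CARD('n wellordered)) \<partial>lborel)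
      = (\<integral>\<^sup>+ y. f (unindex y) \<partial>lborel)"
    by (rule nn_integral_inversion_wellorder[of "\<lambda>y. f (unindex y)"]) (use f l in auto)
  then show ?thesis
    by (simp add: tr reindex_inversion[symmetric])
qed

section \<open>The diagonal Hardy-Littlewood-Sobolev inequality\<close>

lemma nn_integral_lborel_translate:
  fixes f :: "'a::euclidean_space \<Rightarrow> ennreal"
  assumes [measurable]: "f \<in> borel_measurable borel"
  shows "(\<integral>\<^sup>+ y. f (c + y) \<partial>lborel) = (\<integral>\<^sup>+ y. f y \<partial>lborel)"
  by (subst (2) lborel_distr_plus[of c, symmetric]) (simp add: nn_integral_distr)

lemma dyadic_bracket:
  fixes d e :: real
  assumes "0 < d" "d < e"
  shows "\<exists>k::nat. e / 2 ^ Suc k \<le> d \<and> d < e / 2 ^ k"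
proof -
  obtain n :: nat where "e / d < 2 ^ n"
    using real_arch_pow[of 2 "e / d"] by auto
  then have ex: "\<exists>n. e / 2 ^ n \<le> d"
    using assms by (intro exI[of _ n]) (simp add: field_simps)
  define m where "m = (LEAST n. e / 2 ^ n \<le> d)"
  have m: "e / 2 ^ m \<le> d" unfolding m_def by (rule LeastI_ex[OF ex])
  have "m \<noteq> 0" using m assms by (intro notI) simp
  then obtain k where k: "m = Suc k" using not0_implies_Suc by blast
  have "\<not> e / 2 ^ k \<le> d"
    using not_less_Least[of k "\<lambda>n. e / 2 ^ n \<le> d"] k by (simp add: m_def[symmetric])
  then show ?thesis using m k by auto
qed

text \<open>On the dyadic shell d/2^(k+1) <= |x - y| < d/2^k the kernel is at most (d/2^(k+1))^(-s).
  Enlarging the shell to a full ball leaves a geometric series of ratio \<open>q\<close>, which is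
  less than 1 because s < N.\<close>

lemma riesz_kernel_near:
  assumes s: "0 < s" "s < real CARD('n::finite)"
  shows "\<exists>C>0. \<forall>d>0. \<forall>x::real^'n.
    (\<integral>\<^sup>+ y. ennreal (norm (x - y) powr - s) * indicator (ball x d) y \<partial>lborel)
      \<le> ennreal (C * d powr (real CARD('n) - s))"
proof -
  let ?N = "real CARD('n)"
  define V where "V = unit_ball_vol ?N"
  have V: "V > 0" by (simp add: V_def)
  define q where "q = (2::real) powr - (?N - s)"
  have q: "0 < q" "q < 1"
    using s by (auto simp: q_def powr_less_one)
  define C where "C = V * 2 powr s * (1 / (1 - q))"
  have C: "C > 0" using V q by (auto simp: C_def)
  have "(\<integral>\<^sup>+ y. ennreal (norm (x - y) powr - s) * indicator (ball x d) y \<partial>lborel)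
      \<le> ennreal (C * d powr (?N - s))" if d: "d > 0" for d and x :: "real^'n"
  proof -
    define g where "g = (\<lambda>(k::nat) y. ennreal ((d / 2 ^ Suc k) powr - s) * indicator (ball x (d / 2 ^ k)) y)"
    have [measurable]: "g k \<in> borel_measurable borel" for k
      unfolding g_def by (intro borel_measurable_times_ennreal borel_measurable_const borel_measurable_indicator) auto
    have "(\<integral>\<^sup>+ y. ennreal (norm (x - y) powr - s) * indicator (ball x d) y \<partial>lborel) \<le>
        (\<integral>\<^sup>+ y. (\<Sum>k. g k y) \<partial>lborel)"
    proof (rule nn_integral_mono)
      fix y
      show "ennreal (norm (x - y) powr - s) * indicator (ball x d) y \<le> (\<Sum>k. g k y)"
      proof (cases "y \<in> ball x d \<and> y \<noteq> x")
        case True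
        then obtain k where k: "d / 2 ^ Suc k \<le> norm (x - y)" "norm (x - y) < d / 2 ^ k"
          using dyadic_bracket[of "norm (x - y)" d] by (auto simp: dist_norm)
        have "norm (x - y) powr - s \<le> (d / 2 ^ Suc k) powr - s"
          using k(1) d s by (intro powr_mono2') auto
        then have "ennreal (norm (x - y) powr - s) * indicator (ball x d) y \<le> g k y"
          using True k(2) by (auto simp: g_def dist_norm intro!: ennreal_leI)
        also have "\<dots> \<le> (\<Sum>k. g k y)"
          using sum_le_suminf[of "\<lambda>k. g k y" "{k}"] by (simp add: summableI)
        finally show ?thesis .
      qed auto
    qed
    also have "\<dots> = (\<Sum>k. \<integral>\<^sup>+ y. g k y \<partial>lborel)"
      by (rule nn_integral_suminf) simp
    also have "\<dots> = (\<Sum>k. ennreal (V * 2 powr s * d powr (?N - s) * q ^ k))"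
    proof (intro suminf_cong)
      fix k
      have "(\<integral>\<^sup>+ y. g k y \<partial>lborel) = ennreal ((d / 2 ^ Suc k) powr - s) * emeasure lborel (ball x (d / 2 ^ k))"
        unfolding g_def by (simp add: nn_integral_cmult_indicator)
      also have "\<dots> = ennreal ((d / 2 ^ Suc k) powr - s * (V * (d / 2 ^ k) powr ?N))"
        using d V by (simp add: emeasure_ball V_def ennreal_mult[symmetric] powr_realpow)
      also have "(d / 2 ^ Suc k) powr - s * (V * (d / 2 ^ k) powr ?N) = V * 2 powr s * d powr (?N - s) * q ^ k"
      proof -
        define e where "e = d / 2 ^ k"
        have e: "e > 0" "d / 2 ^ Suc k = e / 2" using d by (auto simp: e_def)
        have "(e / 2) powr - s = e powr - s * 2 powr s"
          using e by (simp add: powr_divide powr_minus_divide)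
        moreover have "e powr - s * e powr ?N = e powr (?N - s)"
          by (simp flip: powr_add)
        moreover have "e powr (?N - s) = d powr (?N - s) * q ^ k"
        proof -
          have "(2 ^ k) powr - (?N - s) = q ^ k"
            by (simp add: q_def powr_power powr_powr mult.commute flip: powr_realpow)
          then show ?thesis
            using d by (simp add: e_def powr_divide divide_powr_uminus)
        qed
        ultimately show ?thesis
          unfolding e e_def[symmetric] by (simp add: mult_ac)
      qed
      finally show "(\<integral>\<^sup>+ y. g k y \<partial>lborel) = ennreal (V * 2 powr s * d powr (?N - s) * q ^ k)" .
    qed
    also have "\<dots> = ennreal (\<Sum>k. V * 2 powr s * d powr (?N - s) * q ^ k)"
      using V q by (intro suminf_ennreal2) (auto intro!: summable_mult summable_geometric)
    also have "(\<Sum>k. V * 2 powr s * d powr (?N - s) * q ^ k) = C * d powr (?N - s)"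
      using q by (subst suminf_mult) (auto simp: suminf_geometric C_def)
    finally show ?thesis .
  qed
  with C show ?thesis by blast
qed

text \<open>The weight |y|^(-2N) is the Jacobian of the inversion in the unit sphere, which maps the
  exterior of a ball of radius \<open>d\<close> to a ball of radius 1/d. The exponent 2N arises from
  |x - y|^(-s) raised to the conjugate exponent 2N/s.\<close>

lemma riesz_kernel_far:
  fixes x :: "real^'n::finite"
  assumes d: "d > 0"
  shows "(\<integral>\<^sup>+ y. ennreal (norm (x - y) powr - (2 * real CARD('n))) * indicator (- ball x d) y \<partial>lborel)
      = ennreal (unit_ball_vol (real CARD('n)) * d powr - real CARD('n))"
proof -
  let ?N = "real CARD('n)"
  let ?h = "\<lambda>y::real^'n. ennreal (norm y powr - (2 * ?N)) * indicator (- ball 0 d) y"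
  have [measurable]: "?h \<in> borel_measurable borel" by measurable
  have "(\<integral>\<^sup>+ y. ennreal (norm (x - y) powr - (2 * ?N)) * indicator (- ball x d) y \<partial>lborel)
      = (\<integral>\<^sup>+ y. ?h (- x + y) \<partial>lborel)"
    by (intro nn_integral_cong) (auto simp: indicator_def dist_norm norm_minus_commute)
  also have "\<dots> = (\<integral>\<^sup>+ y. ?h y \<partial>lborel)"
    by (rule nn_integral_lborel_translate) measurable
  also have "\<dots> = (\<integral>\<^sup>+ y. ennreal (indicator (cball 0 (1 / d)) (inversion 1 y) * (1 / norm (y::real^'n)) ^ (2 * CARD('n))) \<partial>lborel)"
  proof -
   have "?h y = ennreal (indicator (cball 0 (1 / d)) (inversion 1 y) * (1 / norm y) ^ (2 * CARD('n)))"
     if y: "y \<noteq> 0" for y :: "real^'n"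
   proof -
    have "norm y powr - (2 * ?N) = (1 / norm y) ^ (2 * CARD('n))"
      using y powr_realpow[of "norm y" "2 * CARD('n)"] by (simp add: powr_minus field_simps)
    moreover have "y \<in> - ball 0 d \<longleftrightarrow> inversion 1 y \<in> cball 0 (1 / d)"
      using y d by (auto simp: norm_inversion field_simps)
    ultimately show ?thesis
      by (auto simp: indicator_def)
   qed
   then show ?thesis
     by (intro nn_integral_cong_AE) (use AE_neq_lborel[of 0] in auto)
  qed
  also have "\<dots> = (\<integral>\<^sup>+ y. ennreal (indicator (cball 0 (1 / d)) (y::real^'n)) \<partial>lborel)"
    by (rule nn_integral_inversion) (auto intro!: borel_measurable_indicator)
  also have "\<dots> = emeasure lborel (cball 0 (1 / d) :: (real^'n) set)"
    by (simp add: ennreal_indicator)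
  also have "\<dots> = ennreal (unit_ball_vol ?N * d powr - ?N)"
    using d by (simp add: emeasure_cball powr_minus power_one_over powr_realpow field_simps)
  finally show ?thesis .
qed

text \<open>The integral is split at \<open>\<bar>x - y\<bar> = d\<close>, with \<open>d\<close> chosen to balance the near part, where \<open>h \<le> a\<close> is used,
  against the far part, which is estimated by Young's inequality with weight \<open>t\<close>.\<close>
lemma hls_inner_bound:
  assumes s: "0 < s" "s < real CARD('n::finite)"
  defines "r \<equiv> 2 * real CARD('n) / (2 * real CARD('n) - s)"
  shows "\<exists>K>0. \<forall>h :: real^'n \<Rightarrow> real. h \<in> borel_measurable borel \<longrightarrow> (\<forall>y. 0 \<le> h y) \<longrightarrow>
      (\<integral>\<^sup>+ y. ennreal (h y powr r) \<partial>lborel) \<le> 1 \<longrightarrow>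
      (\<forall>x. \<forall>a\<ge>0. (\<integral>\<^sup>+ y. ennreal ((if h y \<le> a then h y else 0) * norm (x - y) powr - s) \<partial>lborel)
          \<le> ennreal (K * a powr (r - 1)))"
proof -
  let ?N = "real CARD('n)"
  obtain C where C: "C > 0" "\<And>d x. d > 0 \<Longrightarrow>
    (\<integral>\<^sup>+ y. ennreal (norm ((x::real^'n) - y) powr - s) * indicator (ball x d) y \<partial>lborel)
      \<le> ennreal (C * d powr (?N - s))"
    using riesz_kernel_near[OF s] by blast
  define V where "V = unit_ball_vol ?N"
  have V: "V > 0" by (simp add: V_def)
  have N: "?N > 0" using s by linarith
  have r1: "r > 1" using s by (simp add: r_def field_simps)
  define r' where "r' = 2 * ?N / s"
  have r': "r' > 1" using s N by (simp add: r'_def field_simps)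
  have rr': "1 / r + 1 / r' = 1" using s N by (simp add: r_def r'_def field_simps)
  have "(\<integral>\<^sup>+ y. ennreal ((if h y \<le> a then h y else 0) * norm (x - y) powr - s) \<partial>lborel)
          \<le> ennreal ((C + 1 + V) * a powr (r - 1))"
    if [measurable]: "h \<in> borel_measurable borel" and h: "\<And>y. 0 \<le> h y"
      and h1: "(\<integral>\<^sup>+ y. ennreal (h y powr r) \<partial>lborel) \<le> 1" and a0: "a \<ge> 0"
    for h :: "real^'n \<Rightarrow> real" and x a
  proof (cases "a = 0")
    case True
    then have "(if h y \<le> a then h y else 0) * norm (x - y) powr - s = 0" for y
      using h[of y] by auto
    then have "(\<integral>\<^sup>+ y. ennreal ((if h y \<le> a then h y else 0) * norm (x - y) powr - s) \<partial>lborel) = 0"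
      by (simp only:) simp
    then show ?thesis by simp
  next
    case False
    with a0 have a: "a > 0" by simp
    \<comment> \<open>With these \<open>d\<close> and \<open>t\<close> the near term a d^(N-s) and
      the two Young terms t^r and t^(-r') d^(-N) all become the power a^(r-1) of the
      conclusion.\<close>
    define d where "d = a powr - (r / ?N)"
    define t where "t = a powr (1 / r')"
    have d: "d > 0" and t: "t > 0" using a by (auto simp: d_def t_def)
    have tr: "t powr r = a powr (r - 1)"
    proof -
      have "r / r' = r - 1" using rr' r1 r' by (simp add: field_simps)
      then show ?thesis by (simp add: t_def powr_powr)
    qed
    have tr': "t powr - r' * d powr - ?N = a powr (r - 1)"
    proof -
      have "t powr - r' * d powr - ?N = a powr (-1) * a powr r"
        using r' N by (simp add: t_def d_def powr_powr)
      then show ?thesis using a by (simp add: powr_diff)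
    qed
    have da: "a * d powr (?N - s) = a powr (r - 1)"
    proof -
      have "1 + - (r / ?N) * (?N - s) = r - 1"
        using s N by (simp add: r_def field_simps)
      then have "a powr 1 * a powr (- (r / ?N) * (?N - s)) = a powr (r - 1)"
        by (simp only: powr_add[symmetric])
      then show ?thesis using a by (simp add: d_def powr_powr)
    qed
    have bound: "ennreal ((if h y \<le> a then h y else 0) * norm (x - y) powr - s) \<le>
       ennreal a * (ennreal (norm (x - y) powr - s) * indicator (ball x d) y) +
       (ennreal (t powr r) * ennreal (h y powr r) +
        ennreal (t powr - r') * (ennreal (norm (x - y) powr - (2 * ?N)) * indicator (- ball x d) y))" for y
    proof (cases "y \<in> ball x d")
      case True
      have "ennreal ((if h y \<le> a then h y else 0) * norm (x - y) powr - s) \<le> ennreal (a * norm (x - y) powr - s)"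
        using a by (intro ennreal_leI mult_right_mono) auto
      also have "\<dots> = ennreal a * ennreal (norm (x - y) powr - s)"
        using a by (simp add: ennreal_mult)
      finally show ?thesis using True by (simp add: add_increasing2)
    next
      case False
      have "(if h y \<le> a then h y else 0) * norm (x - y) powr - s \<le> h y * norm (x - y) powr - s"
        using h[of y] by (intro mult_right_mono) auto
      also have "\<dots> = (t * h y) * (norm (x - y) powr - s / t)"
        using t by simp
      also have "\<dots> \<le> (t * h y) powr r / r + (norm (x - y) powr - s / t) powr r' / r'"
        using t h[of y] by (intro Youngs_inequality r1 r' rr') auto
      also have "\<dots> \<le> (t * h y) powr r / 1 + (norm (x - y) powr - s / t) powr r' / 1"
        using r1 r' by (intro add_mono divide_left_mono) auto
      also have "\<dots> = t powr r * h y powr r + t powr - r' * norm (x - y) powr - (2 * ?N)"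
        using t h[of y] s by (simp add: powr_mult powr_divide powr_powr powr_minus r'_def field_simps)
      finally have "ennreal ((if h y \<le> a then h y else 0) * norm (x - y) powr - s)
          \<le> ennreal (t powr r * h y powr r + t powr - r' * norm (x - y) powr - (2 * ?N))"
        by (rule ennreal_leI)
      then show ?thesis using False by (simp add: ennreal_mult)
    qed
    have "(\<integral>\<^sup>+ y. ennreal ((if h y \<le> a then h y else 0) * norm (x - y) powr - s) \<partial>lborel) \<le>
       (\<integral>\<^sup>+ y. ennreal a * (ennreal (norm (x - y) powr - s) * indicator (ball x d) y) +
       (ennreal (t powr r) * ennreal (h y powr r) +
        ennreal (t powr - r') * (ennreal (norm (x - y) powr - (2 * ?N)) * indicator (- ball x d) y)) \<partial>lborel)"
      by (intro nn_integral_mono bound)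
    also have "\<dots> = ennreal a * (\<integral>\<^sup>+ y. ennreal (norm (x - y) powr - s) * indicator (ball x d) y \<partial>lborel) +
        (ennreal (t powr r) * (\<integral>\<^sup>+ y. ennreal (h y powr r) \<partial>lborel) +
         ennreal (t powr - r') * (\<integral>\<^sup>+ y. ennreal (norm (x - y) powr - (2 * ?N)) * indicator (- ball x d) y \<partial>lborel))"
    proof -
      have [measurable]: "ball x d \<in> sets borel" "- ball x d \<in> sets borel" by auto
      show ?thesis
        by (subst nn_integral_add nn_integral_cmult, measurable)+
    qed
    also have "\<dots> \<le> ennreal a * ennreal (C * d powr (?N - s)) +
        (ennreal (t powr r) * 1 + ennreal (t powr - r') * ennreal (V * d powr - ?N))"
      using C(2)[OF d] h1 by (intro add_mono mult_left_mono) (auto simp: riesz_kernel_far[OF d] V_def)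
    also have "\<dots> = ennreal (C * (a * d powr (?N - s)) + (t powr r + V * (t powr - r' * d powr - ?N)))"
      using a C(1) V by (simp add: ennreal_mult[symmetric] ennreal_plus[symmetric] mult_ac del: ennreal_plus)
    also have "\<dots> = ennreal ((C + 1 + V) * a powr (r - 1))"
      unfolding da tr tr' by (simp add: algebra_simps)
    finally show ?thesis .
  qed
  moreover have "C + 1 + V > 0" using C V by simp
  ultimately show ?thesis by blast
qed

text \<open>The double integral is split according to which of f(x) and h(y) is larger. Where h(y)
  <= f(x), the inner integral is at most K f(x)^(r-1), and f f^(r-1) = f^r is integrable; the other
  part is the same after exchanging the variables. The equality of the two exponents is what makes
  this work without interpolation.\<close>

theorem hardy_littlewood_sobolev_diagonal:
  assumes s: "0 < s" "s < real CARD('n::finite)"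
  defines "r \<equiv> 2 * real CARD('n) / (2 * real CARD('n) - s)"
  shows "\<exists>K>0. \<forall>f h :: real^'n \<Rightarrow> real. f \<in> borel_measurable borel \<longrightarrow> h \<in> borel_measurable borel \<longrightarrow>
      (\<forall>y. 0 \<le> f y) \<longrightarrow> (\<forall>y. 0 \<le> h y) \<longrightarrow>
      (\<integral>\<^sup>+ y. ennreal (f y powr r) \<partial>lborel) \<le> 1 \<longrightarrow> (\<integral>\<^sup>+ y. ennreal (h y powr r) \<partial>lborel) \<le> 1 \<longrightarrow>
      (\<integral>\<^sup>+ x. \<integral>\<^sup>+ y. ennreal (f x * h y * norm (x - y) powr - s) \<partial>lborel \<partial>lborel) \<le> ennreal K"
proof -
  have r1: "r > 1" using s by (simp add: r_def field_simps)
  obtain K where K: "K > 0" "\<And>h :: real^'n \<Rightarrow> real. \<And>x a. h \<in> borel_measurable borel \<Longrightarrow> (\<And>y. 0 \<le> h y) \<Longrightarrow>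
      (\<integral>\<^sup>+ y. ennreal (h y powr r) \<partial>lborel) \<le> 1 \<Longrightarrow> a \<ge> 0 \<Longrightarrow>
      (\<integral>\<^sup>+ y. ennreal ((if h y \<le> a then h y else 0) * norm (x - y) powr - s) \<partial>lborel)
          \<le> ennreal (K * a powr (r - 1))"
    using hls_inner_bound[OF s] unfolding r_def by blast
  have half: "(\<integral>\<^sup>+ x. \<integral>\<^sup>+ y. ennreal (f x * (if h y \<le> f x then h y else 0) * norm (x - y) powr - s) \<partial>lborel \<partial>lborel) \<le> ennreal K"
    if [measurable]: "f \<in> borel_measurable borel" "h \<in> borel_measurable borel"
      and f: "\<And>y. 0 \<le> f y" and h: "\<And>y. 0 \<le> h y"
      and f1: "(\<integral>\<^sup>+ y. ennreal (f y powr r) \<partial>lborel) \<le> 1" and h1: "(\<integral>\<^sup>+ y. ennreal (h y powr r) \<partial>lborel) \<le> 1"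
    for f h :: "real^'n \<Rightarrow> real"
  proof -
    have "(\<integral>\<^sup>+ x. \<integral>\<^sup>+ y. ennreal (f x * (if h y \<le> f x then h y else 0) * norm (x - y) powr - s) \<partial>lborel \<partial>lborel)
      \<le> (\<integral>\<^sup>+ x. ennreal K * ennreal (f x powr r) \<partial>lborel)"
    proof (rule nn_integral_mono)
      fix x
      have "(\<integral>\<^sup>+ y. ennreal (f x * (if h y \<le> f x then h y else 0) * norm (x - y) powr - s) \<partial>lborel)
         = (\<integral>\<^sup>+ y. ennreal (f x) * ennreal ((if h y \<le> f x then h y else 0) * norm (x - y) powr - s) \<partial>lborel)"
        using f h by (intro nn_integral_cong) (simp add: ennreal_mult[symmetric] mult.assoc)
      also have "\<dots> = ennreal (f x) * (\<integral>\<^sup>+ y. ennreal ((if h y \<le> f x then h y else 0) * norm (x - y) powr - s) \<partial>lborel)"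
        by (rule nn_integral_cmult) measurable
      also have "\<dots> \<le> ennreal (f x) * ennreal (K * f x powr (r - 1))"
        using f h h1 by (intro mult_left_mono K) auto
      also have "\<dots> = ennreal K * ennreal (f x powr r)"
      proof -
        have "f x * (K * f x powr (r - 1)) = K * f x powr r"
          using f[of x] r1 by (cases "f x = 0") (auto simp: powr_diff)
        then show ?thesis using f[of x] K(1) by (simp add: ennreal_mult[symmetric])
      qed
      finally show "(\<integral>\<^sup>+ y. ennreal (f x * (if h y \<le> f x then h y else 0) * norm (x - y) powr - s) \<partial>lborel)
        \<le> ennreal K * ennreal (f x powr r)" .
    qed
    also have "\<dots> = ennreal K * (\<integral>\<^sup>+ x. ennreal (f x powr r) \<partial>lborel)"
      by (rule nn_integral_cmult) measurable
    also have "\<dots> \<le> ennreal K * 1" using f1 by (intro mult_left_mono) auto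
    finally show ?thesis by simp
  qed
  have "(\<integral>\<^sup>+ x. \<integral>\<^sup>+ y. ennreal (f x * h y * norm (x - y) powr - s) \<partial>lborel \<partial>lborel) \<le> ennreal (2 * K)"
    if [measurable]: "f \<in> borel_measurable borel" "h \<in> borel_measurable borel"
      and f: "\<And>y. 0 \<le> f y" and h: "\<And>y. 0 \<le> h y"
      and f1: "(\<integral>\<^sup>+ y. ennreal (f y powr r) \<partial>lborel) \<le> 1" and h1: "(\<integral>\<^sup>+ y. ennreal (h y powr r) \<partial>lborel) \<le> 1"
    for f h :: "real^'n \<Rightarrow> real"
  proof -
    let ?A = "\<lambda>f h x y. ennreal (f x * (if h y \<le> f x then h y else 0) * norm (x - y :: real^'n) powr - s)"
    have "(\<integral>\<^sup>+ x. \<integral>\<^sup>+ y. ennreal (f x * h y * norm (x - y) powr - s) \<partial>lborel \<partial>lborel)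
      \<le> (\<integral>\<^sup>+ x. \<integral>\<^sup>+ y. ?A f h x y + ?A h f y x \<partial>lborel \<partial>lborel)"
      using f h by (intro nn_integral_mono) (auto simp: mult_ac norm_minus_commute)
    also have "\<dots> = (\<integral>\<^sup>+ x. \<integral>\<^sup>+ y. ?A f h x y \<partial>lborel \<partial>lborel) + (\<integral>\<^sup>+ x. \<integral>\<^sup>+ y. ?A h f y x \<partial>lborel \<partial>lborel)"
      by (simp add: nn_integral_add)
    also have "(\<integral>\<^sup>+ x. \<integral>\<^sup>+ y. ?A h f y x \<partial>lborel \<partial>lborel) = (\<integral>\<^sup>+ y. \<integral>\<^sup>+ x. ?A h f y x \<partial>lborel \<partial>lborel)"
      by (rule lborel_pair.Fubini') measurable
    also have "(\<integral>\<^sup>+ x. \<integral>\<^sup>+ y. ?A f h x y \<partial>lborel \<partial>lborel) + (\<integral>\<^sup>+ y. \<integral>\<^sup>+ x. ?A h f y x \<partial>lborel \<partial>lborel) \<le> ennreal K + ennreal K"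
      using f h f1 h1 by (intro add_mono half) auto
    also have "\<dots> = ennreal (2 * K)" using K(1) by (simp flip: ennreal_plus)
    finally show ?thesis .
  qed
  moreover have "2 * K > 0" using K by simp
  ultimately show ?thesis by blast
qed

section \<open>Riesz potentials and the Kelvin transform\<close>

text \<open>The kernels converge for every \<open>y\<close> other than \<open>x\<close>, so Fatou's
  lemma applies. The statement uses \<open>lebesgue\<close> because it is what first shows the
  solutions to be Borel measurable.\<close>

lemma lower_semicontinuous_riesz:
  fixes w :: "'a::euclidean_space \<Rightarrow> real"
  assumes [measurable]: "g \<in> borel_measurable lebesgue"
    and w: "\<And>x. 0 \<le> w x"
    and eq: "\<And>x. ennreal (w x) = (\<integral>\<^sup>+ y. ennreal (g y * norm (x - y) powr - s) \<partial>lebesgue)"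
  shows "open {x. a < w x}"
proof -
  have "closed {x. w x \<le> a}"
  proof (subst closed_sequential_limits, intro allI impI, elim conjE)
    fix X x assume X: "\<forall>n. X n \<in> {x. w x \<le> a}" and lim: "X \<longlonglongrightarrow> x"
    \<comment> \<open>The level set contains \<open>X 0\<close>, so \<open>a\<close> is nonnegative
      and the final bound can be read back from \<open>ennreal\<close>.\<close>
    have a: "0 \<le> a" using X w[of "X 0"] by (auto intro: order_trans)
    have [measurable]: "(\<lambda>y. norm (z - y) powr - s) \<in> borel_measurable lebesgue" for z :: 'a
      by (rule measurable_completion) simp
    have "AE y in lebesgue. y \<noteq> x"
      using AE_neq_lborel[of x] by (rule AE_completion)
    then have ae: "AE y in lebesgue. ennreal (g y * norm (x - y) powr - s) = liminf (\<lambda>n. ennreal (g y * norm (X n - y) powr - s))"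
    proof eventually_elim
      case (elim y)
      have "(\<lambda>n. ennreal (g y * norm (X n - y) powr - s)) \<longlonglongrightarrow> ennreal (g y * norm (x - y) powr - s)"
        using elim by (intro tendsto_intros lim) auto
      then show ?case by (simp add: lim_imp_Liminf)
    qed
    have "ennreal (w x) = (\<integral>\<^sup>+ y. liminf (\<lambda>n. ennreal (g y * norm (X n - y) powr - s)) \<partial>lebesgue)"
      unfolding eq using ae by (rule nn_integral_cong_AE)
    also have "\<dots> \<le> liminf (\<lambda>n. \<integral>\<^sup>+ y. ennreal (g y * norm (X n - y) powr - s) \<partial>lebesgue)"
      by (rule nn_integral_liminf) measurable
    also have "\<dots> = liminf (\<lambda>n. ennreal (w (X n)))" by (simp add: eq)
    also have "\<dots> \<le> liminf (\<lambda>n. ennreal a)"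
      using X by (intro Liminf_mono) (auto intro!: always_eventually ennreal_leI)
    also have "\<dots> = ennreal a" by (simp add: Liminf_const)
    finally show "x \<in> {x. w x \<le> a}" using a by simp
  qed
  then have "open (- {x. w x \<le> a})" by (simp add: open_Compl)
  then show ?thesis by (simp add: Collect_neg_eq[symmetric] not_le)
qed

lemma lsc_measurable:
  fixes w :: "'a::euclidean_space \<Rightarrow> real"
  assumes "\<And>a. open {x. a < w x}"
  shows "w \<in> borel_measurable borel"
  using assms by (auto simp: borel_measurable_iff_greater)

lemma ball_borel [measurable]: "ball (x::'a::metric_space) r \<in> sets borel" "- ball x r \<in> sets borel"
  by auto

text \<open>The weight \<open>s\<close> is the exponent of the kernel for a potential and 2N - s for
  its source: the Jacobian supplies 2N, and the kernel takes \<open>s\<close> away.\<close>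

definition kelvin :: "real \<Rightarrow> real \<Rightarrow> ('a::real_inner \<Rightarrow> real) \<Rightarrow> 'a \<Rightarrow> real" where
  "kelvin s l g x = (l / norm x) powr s * g (inversion l x)"

lemma kelvin_measurable [measurable (raw)]:
  fixes g :: "'a::euclidean_space \<Rightarrow> real"
  assumes [measurable]: "g \<in> borel_measurable borel"
  shows "kelvin s l g \<in> borel_measurable borel"
  unfolding kelvin_def[abs_def] by measurable

lemma kelvin_nonneg: "(\<And>y. 0 \<le> g y) \<Longrightarrow> 0 \<le> kelvin s l g y"
  by (simp add: kelvin_def)

lemma kelvin_kelvin:
  assumes "l > 0" "x \<noteq> 0"
  shows "kelvin s l (kelvin s l g) x = g x"
proof -
  have "(l / norm x) powr s * (l / (l\<^sup>2 / norm x)) powr s = ((l / norm x) * (l / (l\<^sup>2 / norm x))) powr s"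
    by (simp only: powr_mult)
  also have "(l / norm x) * (l / (l\<^sup>2 / norm x)) = 1"
    using assms by (simp add: power2_eq_square)
  finally show ?thesis
    using assms by (simp add: kelvin_def norm_inversion inversion_inversion mult.assoc[symmetric])
qed

text \<open>At the inverse point the function and its Kelvin transform are (|x|/l)^s times each
  other's values at \<open>x\<close>, so the comparison is reversed. This moves statements between
  the ball and its exterior.\<close>

lemma kelvin_le_iff:
  fixes w :: "'a::real_inner \<Rightarrow> real"
  assumes l: "l > 0" and x: "x \<noteq> 0"
  shows "kelvin s l w x \<le> w x \<longleftrightarrow> w (inversion l x) \<le> kelvin s l w (inversion l x)"
proof -
  have x': "inversion l x \<noteq> 0" using l x by simp
  have "kelvin s l w (inversion l x) = (norm x / l) powr s * w x"
    using l x by (simp add: kelvin_def norm_inversion inversion_inversion power2_eq_square)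
  moreover have "w (inversion l x) = (norm x / l) powr s * kelvin s l w x"
  proof -
    have "(norm x / l) powr s * (l / norm x) powr s = 1"
      using l x by (simp flip: powr_mult)
    then show ?thesis by (simp add: kelvin_def flip: mult.assoc)
  qed
  moreover have "(norm x / l) powr s > 0" using l x by auto
  ultimately show ?thesis by (simp only: mult_le_cancel_left_pos)
qed

lemma tendsto_inversion:
  fixes y :: "'a::real_inner"
  assumes "l \<longlonglongrightarrow> l0" "y \<noteq> 0"
  shows "(\<lambda>n. inversion (l n) y) \<longlonglongrightarrow> inversion l0 y"
  unfolding inversion_def using assms by (intro tendsto_intros) auto

text \<open>Lower semicontinuity preserves only strict lower bounds. A value \<open>b\<close>
  strictly between leaves room to treat \<open>w\<close> by semicontinuity and the weight by
  continuity.\<close>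

lemma eventually_kelvin_greater:
  fixes w :: "'a::real_inner \<Rightarrow> real"
  assumes lsc: "\<And>a. open {x. a < w x}" and w: "\<And>x. 0 < w x"
    and l: "l \<longlonglongrightarrow> l0" "l0 > 0" and y: "y \<noteq> 0" and less: "c < kelvin s l0 w y"
  shows "eventually (\<lambda>n. c < kelvin s (l n) w y) sequentially"
proof -
  let ?m = "(l0 / norm y) powr s"
  have m: "?m > 0" using l y by simp
  have "c / ?m < w (inversion l0 y)" using less m by (simp add: kelvin_def field_simps)
  then obtain b where b: "c / ?m < b" "b < w (inversion l0 y)" using dense by blast
  have "eventually (\<lambda>n. inversion (l n) y \<in> {x. b < w x}) sequentially"
    using tendsto_inversion[OF l(1) y] lsc b by (intro topological_tendstoD) auto
  moreover have "(\<lambda>n. b * (l n / norm y) powr s) \<longlonglongrightarrow> b * ?m"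
    using l y by (intro tendsto_intros) auto
  then have "eventually (\<lambda>n. c < b * (l n / norm y) powr s) sequentially"
    using b m by (intro order_tendstoD) (auto simp: field_simps)
  ultimately show ?thesis
  proof eventually_elim
    case (elim n)
    have "b * (l n / norm y) powr s \<le> kelvin s (l n) w y"
      unfolding kelvin_def using elim by (subst mult.commute, intro mult_left_mono) auto
    then show ?case using elim by simp
  qed
qed

text \<open>The distance from \<open>x\<close> to the inverse point of \<open>y\<close>, rescaled so as to be symmetric
  and to make sense also at \<open>y = 0\<close>.\<close>
definition refl_dist :: "real \<Rightarrow> 'a::real_inner \<Rightarrow> 'a \<Rightarrow> real" where
  "refl_dist l x y = sqrt (l\<^sup>2 - 2 * (x \<bullet> y) + (norm x)\<^sup>2 * (norm y)\<^sup>2 / l\<^sup>2)"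

lemma refl_dist_measurable [measurable]:
  "refl_dist l x \<in> borel_measurable (borel :: 'a::euclidean_space measure)"
  unfolding refl_dist_def[abs_def] by measurable

lemma refl_dist_commute: "refl_dist l x y = refl_dist l y x"
  by (simp add: refl_dist_def inner_commute mult.commute)

lemma norm_diff_inversion:
  assumes "l > 0" "y \<noteq> 0"
  shows "norm (x - inversion l y) = (l / norm y) * refl_dist l x y"
proof -
  have "(norm (x - inversion l y))\<^sup>2 = (l / norm y)\<^sup>2 * (l\<^sup>2 - 2 * (x \<bullet> y) + (norm x)\<^sup>2 * (norm y)\<^sup>2 / l\<^sup>2)"
    using assms unfolding inversion_def power2_norm_eq_inner inner_diff_left inner_diff_right
    by (simp add: power2_norm_eq_inner[symmetric] inner_commute field_simps power2_eq_square)
  then have "norm (x - inversion l y) = sqrt ((l / norm y)\<^sup>2 * (l\<^sup>2 - 2 * (x \<bullet> y) + (norm x)\<^sup>2 * (norm y)\<^sup>2 / l\<^sup>2))"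
    by (metis norm_ge_zero real_sqrt_unique)
  then show ?thesis using assms by (simp add: real_sqrt_mult refl_dist_def)
qed

lemma norm_inversion_diff:
  assumes "l > 0" "x \<noteq> 0"
  shows "norm (inversion l x - y) = (l / norm x) * refl_dist l x y"
  using norm_diff_inversion[OF assms, of y] by (simp add: norm_minus_commute refl_dist_commute)

lemma norm_inversion_diff_inversion:
  assumes "l > 0" "x \<noteq> 0" "y \<noteq> 0"
  shows "norm (inversion l x - inversion l y) = (l / norm x) * (l / norm y) * norm (x - y)"
proof -
  have "(norm (inversion l x - inversion l y))\<^sup>2 = ((l / norm x) * (l / norm y) * norm (x - y))\<^sup>2"
    using assms unfolding power_mult_distrib inversion_def power2_norm_eq_inner inner_diff_left inner_diff_right
    by (simp add: power2_norm_eq_inner[symmetric] inner_commute field_simps power2_eq_square)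
  then show ?thesis using assms by (subst (asm) power2_eq_iff_nonneg) auto
qed

text \<open>The squares of the two sides differ by (l^2 - |x|^2)(l^2 - |y|^2)/l^2. That the kernel
  dominates its reflection in the ball takes the place of the maximum principle.\<close>

lemma norm_diff_less_refl_dist:
  assumes "norm x < l" "norm y < l"
  shows "norm (x - y) < refl_dist l x y"
proof -
  have l: "l > 0" using assms(1) norm_ge_zero[of x] by linarith
  have "(norm x)\<^sup>2 < l\<^sup>2" "(norm y)\<^sup>2 < l\<^sup>2"
    using assms l by (auto intro!: power_strict_mono)
  then have "0 < (l\<^sup>2 - (norm x)\<^sup>2) * (l\<^sup>2 - (norm y)\<^sup>2) / l\<^sup>2"
    using l by simp
  also have "\<dots> = (l\<^sup>2 - 2 * (x \<bullet> y) + (norm x)\<^sup>2 * (norm y)\<^sup>2 / l\<^sup>2) - (norm (x - y))\<^sup>2"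
    using l unfolding power2_norm_eq_inner[of "x - y"] inner_diff_left inner_diff_right
    by (simp add: power2_norm_eq_inner[symmetric] inner_commute field_simps power2_eq_square)
  finally have "(norm (x - y))\<^sup>2 < l\<^sup>2 - 2 * (x \<bullet> y) + (norm x)\<^sup>2 * (norm y)\<^sup>2 / l\<^sup>2" by simp
  then show ?thesis unfolding refl_dist_def by (rule real_less_rsqrt)
qed

text \<open>The sphere is a null set, and the integral over the exterior is carried into the ball by
  the inversion.\<close>

lemma nn_integral_fold_inversion:
  fixes F :: "real^'n::finite \<Rightarrow> real"
  assumes [measurable]: "F \<in> borel_measurable borel" and F: "\<And>y. 0 \<le> F y" and l: "l > 0"
  shows "(\<integral>\<^sup>+ y. ennreal (F y) \<partial>lborel) =
    (\<integral>\<^sup>+ y. ennreal (F y + (l / norm y) powr (2 * real CARD('n)) * F (inversion l y)) * indicator (ball 0 l) y \<partial>lborel)"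
proof -
  define G where "G = (\<lambda>y. F y * indicator {y. l < norm y} y)"
  have [measurable]: "G \<in> borel_measurable borel" unfolding G_def by measurable
  have G: "0 \<le> G y" for y using F by (simp add: G_def indicator_def)
  have "AE y in lborel. (y::real^'n) \<notin> sphere 0 l" by (rule AE_notin_sphere)
  then have "(\<integral>\<^sup>+ y. ennreal (F y) \<partial>lborel) = (\<integral>\<^sup>+ y. ennreal (F y) * indicator (ball 0 l) y + ennreal (G y) \<partial>lborel)"
    by (intro nn_integral_cong_AE) (auto simp: G_def indicator_def elim!: eventually_mono)
  also have "\<dots> = (\<integral>\<^sup>+ y. ennreal (F y) * indicator (ball 0 l) y \<partial>lborel) + (\<integral>\<^sup>+ y. ennreal (G y) \<partial>lborel)"
    by (rule nn_integral_add) measurable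
  also have "(\<integral>\<^sup>+ y. ennreal (G y) \<partial>lborel) = (\<integral>\<^sup>+ y. ennreal (G (inversion l y) * (l / norm y) ^ (2 * CARD('n))) \<partial>lborel)"
    by (rule nn_integral_inversion[symmetric]) (use G l in auto)
  also have "\<dots> = (\<integral>\<^sup>+ y. ennreal ((l / norm y) powr (2 * real CARD('n)) * F (inversion l y)) * indicator (ball 0 l) y \<partial>lborel)"
  proof -
    have "ennreal (G (inversion l y) * (l / norm y) ^ (2 * CARD('n))) =
      ennreal ((l / norm y) powr (2 * real CARD('n)) * F (inversion l y)) * indicator (ball 0 l) y"
      if "y \<noteq> 0" for y :: "real^'n"
    proof -
      have "l < l\<^sup>2 / norm y \<longleftrightarrow> norm y < l"
        using that l by (simp add: power2_eq_square field_simps)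
      moreover have "(l / norm y) powr (2 * real CARD('n)) = (l / norm y) ^ (2 * CARD('n))"
        using powr_realpow[of "l / norm y" "2 * CARD('n)"] that l by simp
      ultimately show ?thesis
        by (auto simp: G_def indicator_def norm_inversion mult.commute)
    qed
    then show ?thesis
      by (intro nn_integral_cong_AE) (use AE_neq_lborel[of "0::real^'n"] in auto)
  qed
  also have "(\<integral>\<^sup>+ y. ennreal (F y) * indicator (ball 0 l) y \<partial>lborel) + \<dots> =
    (\<integral>\<^sup>+ y. ennreal (F y) * indicator (ball 0 l) y +
       ennreal ((l / norm y) powr (2 * real CARD('n)) * F (inversion l y)) * indicator (ball 0 l) y \<partial>lborel)"
    by (rule nn_integral_add[symmetric]) measurable
  also have "\<dots> = (\<integral>\<^sup>+ y. ennreal (F y + (l / norm y) powr (2 * real CARD('n)) * F (inversion l y)) * indicator (ball 0 l) y \<partial>lborel)"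
    using F by (intro nn_integral_cong) (auto simp: indicator_def)
  finally show ?thesis .
qed

section \<open>A potential and its Kelvin transform as integrals over the ball\<close>

locale riesz_potential =
  fixes s :: real and g w :: "real^'n::finite \<Rightarrow> real"
  assumes s: "0 < s"
    and g_measurable [measurable]: "g \<in> borel_measurable borel"
    and g_nonneg: "\<And>y. 0 \<le> g y"
    and w_nonneg: "\<And>y. 0 \<le> w y"
    and w_eq: "\<And>x. ennreal (w x) = (\<integral>\<^sup>+ y. ennreal (g y * norm (x - y) powr - s) \<partial>lborel)"
begin

abbreviation "gk l \<equiv> kelvin (2 * real CARD('n) - s) l g"

lemma gk_nonneg: "0 \<le> gk l y"
  by (intro kelvin_nonneg g_nonneg)

lemma w_fold:
  assumes l: "l > 0"
  shows "ennreal (w x) = (\<integral>\<^sup>+ y. ennreal (g y * norm (x - y) powr - s + gk l y * refl_dist l x y powr - s)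
      * indicator (ball 0 l) y \<partial>lborel)"
proof -
  let ?F = "\<lambda>y. g y * norm (x - y) powr - s"
  have pt: "(l / norm y) powr (2 * real CARD('n)) * ?F (inversion l y) = gk l y * refl_dist l x y powr - s"
    if "y \<noteq> 0" for y
  proof -
    \<comment> \<open>The kernel at the inverse point contributes (l/|y|)^(-s), which reduces the
      Jacobian exponent 2N to the weight 2N - s of the source.\<close>
    have c: "(l / norm y) powr s * (l / norm y) powr - s = 1"
      using that l by (simp flip: powr_add)
    have "(l / norm y) powr (2 * real CARD('n)) = (l / norm y) powr (2 * real CARD('n) - s) * (l / norm y) powr s"
      by (simp flip: powr_add)
    then have "(l / norm y) powr (2 * real CARD('n)) * ?F (inversion l y) =
       ((l / norm y) powr (2 * real CARD('n) - s) * g (inversion l y) * refl_dist l x y powr - s) *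
       ((l / norm y) powr s * (l / norm y) powr - s)"
      by (simp only: norm_diff_inversion[OF l that] powr_mult mult_ac)
    then show ?thesis
      by (simp only: c kelvin_def mult_1_right)
  qed
  have "ennreal (w x) = (\<integral>\<^sup>+ y. ennreal (?F y + (l / norm y) powr (2 * real CARD('n)) * ?F (inversion l y))
      * indicator (ball 0 l) y \<partial>lborel)"
    unfolding w_eq by (rule nn_integral_fold_inversion[OF _ _ l]) (measurable, simp add: g_nonneg)
  also have "\<dots> = (\<integral>\<^sup>+ y. ennreal (g y * norm (x - y) powr - s + gk l y * refl_dist l x y powr - s)
      * indicator (ball 0 l) y \<partial>lborel)"
  proof (intro nn_integral_cong_AE)
    show "AE y in lborel. ennreal (?F y + (l / norm y) powr (2 * real CARD('n)) * ?F (inversion l y)) * indicator (ball 0 l) y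
      = ennreal (g y * norm (x - y) powr - s + gk l y * refl_dist l x y powr - s) * indicator (ball 0 l) y"
      using AE_neq_lborel[of "0::real^'n"] by eventually_elim (subst pt, assumption, rule refl)
  qed
  finally show ?thesis .
qed

text \<open>Compared with \<open>w_fold\<close>, the direct and the reflected kernel have changed
  places. Formally, w minus its Kelvin transform is therefore the integral over the ball of (g - gk)
  times the difference of the kernels.\<close>

lemma kelvin_w_fold:
  assumes l: "l > 0" and x: "x \<noteq> 0"
  shows "ennreal (kelvin s l w x) = (\<integral>\<^sup>+ y. ennreal (g y * refl_dist l x y powr - s + gk l y * norm (x - y) powr - s)
      * indicator (ball 0 l) y \<partial>lborel)"
proof -
  let ?F = "\<lambda>y. (l / norm x) powr s * (g y * norm (inversion l x - y) powr - s)"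
  have c: "(l / norm z) powr s * (l / norm z) powr - s = 1" if "z \<noteq> 0" for z :: "real^'n"
    using that l by (simp flip: powr_add)
  have Fy: "?F y = g y * refl_dist l x y powr - s" for y
  proof -
    have "?F y = (g y * refl_dist l x y powr - s) * ((l / norm x) powr s * (l / norm x) powr - s)"
      by (simp only: norm_inversion_diff[OF l x] powr_mult mult_ac)
    then show ?thesis by (simp only: c[OF x] mult_1_right)
  qed
  have pt: "(l / norm y) powr (2 * real CARD('n)) * ?F (inversion l y) = gk l y * norm (x - y) powr - s"
    if "y \<noteq> 0" for y
  proof -
    have "(l / norm y) powr (2 * real CARD('n)) = (l / norm y) powr (2 * real CARD('n) - s) * (l / norm y) powr s"
      by (simp flip: powr_add)
    then have "(l / norm y) powr (2 * real CARD('n)) * ?F (inversion l y) =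
       ((l / norm y) powr (2 * real CARD('n) - s) * g (inversion l y) * norm (x - y) powr - s) *
       ((l / norm x) powr s * (l / norm x) powr - s) * ((l / norm y) powr s * (l / norm y) powr - s)"
      by (simp only: norm_inversion_diff_inversion[OF l x that] powr_mult mult_ac)
    then show ?thesis
      by (simp only: c[OF x] c[OF that] kelvin_def mult_1_right)
  qed
  have "ennreal (kelvin s l w x) = ennreal ((l / norm x) powr s) * (\<integral>\<^sup>+ y. ennreal (g y * norm (inversion l x - y) powr - s) \<partial>lborel)"
    using w_nonneg by (simp add: kelvin_def ennreal_mult w_eq)
  also have "\<dots> = (\<integral>\<^sup>+ y. ennreal (?F y) \<partial>lborel)"
    using g_nonneg by (subst nn_integral_cmult[symmetric]) (auto simp: ennreal_mult')
  also have "\<dots> = (\<integral>\<^sup>+ y. ennreal (?F y + (l / norm y) powr (2 * real CARD('n)) * ?F (inversion l y))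
      * indicator (ball 0 l) y \<partial>lborel)"
    by (rule nn_integral_fold_inversion[OF _ _ l]) (measurable, simp add: g_nonneg)
  also have "\<dots> = (\<integral>\<^sup>+ y. ennreal (g y * refl_dist l x y powr - s + gk l y * norm (x - y) powr - s)
      * indicator (ball 0 l) y \<partial>lborel)"
  proof (intro nn_integral_cong_AE)
    show "AE y in lborel. ennreal (?F y + (l / norm y) powr (2 * real CARD('n)) * ?F (inversion l y)) * indicator (ball 0 l) y
      = ennreal (g y * refl_dist l x y powr - s + gk l y * norm (x - y) powr - s) * indicator (ball 0 l) y"
      using AE_neq_lborel[of "0::real^'n"] by eventually_elim (subst pt, assumption, subst Fy, rule refl)
  qed
  finally show ?thesis .
qed

lemma kernel_less:
  assumes "norm x < l" "norm y < l" "x \<noteq> y"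
  shows "refl_dist l x y powr - s < norm (x - y) powr - s"
  using norm_diff_less_refl_dist[OF assms(1,2)] assms(3) s by (intro powr_less_mono2_neg) auto

text \<open>The kernel difference lies between 0 and the kernel itself, so (g - gk) times it is at
  most the positive part of g - gk times the kernel. The additive form avoids subtraction in
  \<open>ennreal\<close>.\<close>

lemma w_le_kelvin_plus:
  assumes l: "l > 0" and x: "x \<in> ball 0 l - {0}"
  shows "ennreal (w x) \<le> ennreal (kelvin s l w x) +
    (\<integral>\<^sup>+ y. ennreal (max 0 (g y - gk l y) * norm (x - y) powr - s) * indicator (ball 0 l) y \<partial>lborel)"
proof -
  have pt: "ennreal (g y * norm (x - y) powr - s + gk l y * refl_dist l x y powr - s) * indicator (ball 0 l) y \<le>
    ennreal (g y * refl_dist l x y powr - s + gk l y * norm (x - y) powr - s) * indicator (ball 0 l) y +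
    ennreal (max 0 (g y - gk l y) * norm (x - y) powr - s) * indicator (ball 0 l) y" if "y \<noteq> x" for y
  proof (cases "y \<in> ball 0 l")
    case True
    then have k: "refl_dist l x y powr - s < norm (x - y) powr - s"
      using x that by (intro kernel_less) auto
    have "(g y - gk l y) * (norm (x - y) powr - s - refl_dist l x y powr - s)
        \<le> max 0 (g y - gk l y) * (norm (x - y) powr - s - refl_dist l x y powr - s)"
      using k by (intro mult_right_mono) auto
    also have "\<dots> \<le> max 0 (g y - gk l y) * norm (x - y) powr - s"
      by (intro mult_left_mono) auto
    finally have "g y * norm (x - y) powr - s + gk l y * refl_dist l x y powr - s \<le>
      (g y * refl_dist l x y powr - s + gk l y * norm (x - y) powr - s) + max 0 (g y - gk l y) * norm (x - y) powr - s"
      by (simp add: algebra_simps)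
    then show ?thesis
      using True g_nonneg gk_nonneg by (simp flip: ennreal_plus add: ennreal_leI)
  qed auto
  have "ennreal (w x) \<le> (\<integral>\<^sup>+ y. ennreal (g y * refl_dist l x y powr - s + gk l y * norm (x - y) powr - s) * indicator (ball 0 l) y +
    ennreal (max 0 (g y - gk l y) * norm (x - y) powr - s) * indicator (ball 0 l) y \<partial>lborel)"
    unfolding w_fold[OF l]
  proof (rule nn_integral_mono_AE)
    show "AE y in lborel. ennreal (g y * norm (x - y) powr - s + gk l y * refl_dist l x y powr - s) * indicator (ball 0 l) y \<le>
    ennreal (g y * refl_dist l x y powr - s + gk l y * norm (x - y) powr - s) * indicator (ball 0 l) y +
    ennreal (max 0 (g y - gk l y) * norm (x - y) powr - s) * indicator (ball 0 l) y"
      using AE_neq_lborel[of x] by eventually_elim (rule pt)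
  qed
  also have "\<dots> = ennreal (kelvin s l w x) +
    (\<integral>\<^sup>+ y. ennreal (max 0 (g y - gk l y) * norm (x - y) powr - s) * indicator (ball 0 l) y \<partial>lborel)"
    by (subst nn_integral_add) (measurable, use x l in \<open>simp add: kelvin_w_fold\<close>)
  finally show ?thesis .
qed

lemma w_le_kelvin:
  assumes l: "l > 0" and x: "x \<in> ball 0 l - {0}"
    and le: "AE y in lborel. y \<in> ball 0 l \<longrightarrow> g y \<le> gk l y"
  shows "w x \<le> kelvin s l w x"
proof -
  have "(\<integral>\<^sup>+ y. ennreal (max 0 (g y - gk l y) * norm (x - y) powr - s) * indicator (ball 0 l) y \<partial>lborel) = (\<integral>\<^sup>+ (y::real^'n). 0 \<partial>lborel)"
    using le by (intro nn_integral_cong_AE) (auto simp: indicator_def max_def elim!: eventually_mono)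
  then have "ennreal (w x) \<le> ennreal (kelvin s l w x)"
    using w_le_kelvin_plus[OF l x] by simp
  moreover have "0 \<le> kelvin s l w x" by (intro kelvin_nonneg w_nonneg)
  ultimately show ?thesis by simp
qed

lemma w_eq_kelvin:
  assumes l: "l > 0" and x: "x \<in> ball 0 l - {0}"
    and eq: "AE y in lborel. y \<in> ball 0 l \<longrightarrow> g y = gk l y"
  shows "w x = kelvin s l w x"
proof -
  have "ennreal (w x) = ennreal (kelvin s l w x)"
    unfolding w_fold[OF l] using x kelvin_w_fold[OF l, of x] eq
    by (simp, intro nn_integral_cong_AE) (auto simp: indicator_def add.commute elim!: eventually_mono)
  moreover have "0 \<le> kelvin s l w x" by (intro kelvin_nonneg w_nonneg)
  ultimately show ?thesis using w_nonneg by simp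
qed

text \<open>A strong maximum principle: the kernel difference is positive for all \<open>y\<close>
  other than \<open>x\<close>, so strict inequality of the sources on a set of positive measure is
  felt at every \<open>x\<close>.\<close>

lemma w_less_kelvin:
  assumes l: "l > 0" and x: "x \<in> ball 0 l - {0}"
    and le: "AE y in lborel. y \<in> ball 0 l \<longrightarrow> g y \<le> gk l y"
    and ne: "\<not> (AE y in lborel. y \<in> ball 0 l \<longrightarrow> g y = gk l y)"
  shows "w x < kelvin s l w x"
proof -
  let ?a = "\<lambda>y. ennreal (g y * norm (x - y) powr - s + gk l y * refl_dist l x y powr - s) * indicator (ball 0 l) y"
  let ?b = "\<lambda>y. ennreal (g y * refl_dist l x y powr - s + gk l y * norm (x - y) powr - s) * indicator (ball 0 l) y"
  have cmp: "(?a y \<le> ?b y \<longleftrightarrow> g y \<le> gk l y) \<and> (?b y \<le> ?a y \<longleftrightarrow> gk l y \<le> g y)" if "y \<in> ball 0 l" "y \<noteq> x" for y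
  proof -
    have k: "0 < norm (x - y) powr - s - refl_dist l x y powr - s"
      using kernel_less[of x l y] x that by auto
    let ?a' = "g y * norm (x - y) powr - s + gk l y * refl_dist l x y powr - s"
    let ?b' = "g y * refl_dist l x y powr - s + gk l y * norm (x - y) powr - s"
    have nn: "0 \<le> ?a'" "0 \<le> ?b'"
      by (intro add_nonneg_nonneg mult_nonneg_nonneg g_nonneg gk_nonneg powr_ge_zero)+
    have "?a' - ?b' = (g y - gk l y) * (norm (x - y) powr - s - refl_dist l x y powr - s)"
      by (simp add: algebra_simps)
    then have "(?a' \<le> ?b' \<longleftrightarrow> (g y - gk l y) * (norm (x - y) powr - s - refl_dist l x y powr - s) \<le> 0)"
      "(?b' \<le> ?a' \<longleftrightarrow> 0 \<le> (g y - gk l y) * (norm (x - y) powr - s - refl_dist l x y powr - s))"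
      by linarith+
    moreover have "?a y = ennreal ?a'" "?b y = ennreal ?b'" using that by auto
    ultimately have "(?a y \<le> ?b y \<longleftrightarrow> (g y - gk l y) * (norm (x - y) powr - s - refl_dist l x y powr - s) \<le> 0)"
      "(?b y \<le> ?a y \<longleftrightarrow> 0 \<le> (g y - gk l y) * (norm (x - y) powr - s - refl_dist l x y powr - s))"
      using nn by (simp_all only: ennreal_le_iff)
    then show ?thesis using k by (auto simp: mult_le_0_iff zero_le_mult_iff)
  qed
  have "(\<integral>\<^sup>+ y. ?a y \<partial>lborel) < (\<integral>\<^sup>+ y. ?b y \<partial>lborel)"
  proof (rule nn_integral_less)
    \<comment> \<open>Strict monotonicity needs a finite smaller integral; this one is the real
      number \<open>w x\<close>.\<close>
    show "(\<integral>\<^sup>+ y. ?a y \<partial>lborel) \<noteq> \<infinity>" using w_fold[OF l, of x] by (metis ennreal_neq_top infinity_ennreal_def)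
    show "AE y in lborel. ?a y \<le> ?b y"
      using le AE_neq_lborel[of x] by eventually_elim (use cmp in \<open>auto simp: indicator_def\<close>)
    show "\<not> (AE y in lborel. ?b y \<le> ?a y)"
    proof
      assume "AE y in lborel. ?b y \<le> ?a y"
      then have "AE y in lborel. y \<in> ball 0 l \<longrightarrow> g y = gk l y"
        using le AE_neq_lborel[of x] by eventually_elim (use cmp in force)
      with ne show False by simp
    qed
  qed measurable
  then have "ennreal (w x) < ennreal (kelvin s l w x)"
    using w_fold[OF l] kelvin_w_fold[OF l] x by simp
  then show ?thesis using w_nonneg by (simp add: ennreal_less_iff)
qed

end

section \<open>The linearised system on a small set\<close>

text \<open>The inequality for \<open>f\<close> is multiplied by f^(a-1) and integrated. Since (a-1)
  r = a, the function f^(a-1) is admissible in the diagonal inequality with norm at most 1, and a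
  small norm of \<open>g\<close> makes the right-hand side small.\<close>

lemma hls_subcritical:
  assumes s: "0 < s" "s < real CARD('n::finite)"
  defines "r \<equiv> 2 * real CARD('n) / (2 * real CARD('n) - s)" and "a \<equiv> 2 * real CARD('n) / s"
  shows "\<exists>d>0. \<forall>f g :: real^'n \<Rightarrow> real. f \<in> borel_measurable borel \<longrightarrow> g \<in> borel_measurable borel \<longrightarrow>
      (\<forall>y. 0 \<le> f y) \<longrightarrow> (\<forall>y. 0 \<le> g y) \<longrightarrow>
      (\<integral>\<^sup>+ y. ennreal (f y powr a) \<partial>lborel) \<le> 1 \<longrightarrow> (\<integral>\<^sup>+ y. ennreal (g y powr r) \<partial>lborel) \<le> ennreal d \<longrightarrow>
      (\<forall>x. ennreal (f x) \<le> (\<integral>\<^sup>+ y. ennreal (g y * norm (x - y) powr - s) \<partial>lborel)) \<longrightarrow>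
      (\<integral>\<^sup>+ y. ennreal (f y powr a) \<partial>lborel) < 1"
proof -
  let ?N = "real CARD('n)"
  have r: "r > 1" using s by (simp add: r_def field_simps)
  have a: "a > 1" using s by (simp add: a_def field_simps)
  have ar: "(a - 1) * r = a" using s by (simp add: a_def r_def field_simps)
  obtain K where K: "K > 0" "\<And>f h :: real^'n \<Rightarrow> real. f \<in> borel_measurable borel \<Longrightarrow> h \<in> borel_measurable borel \<Longrightarrow>
      (\<And>y. 0 \<le> f y) \<Longrightarrow> (\<And>y. 0 \<le> h y) \<Longrightarrow>
      (\<integral>\<^sup>+ y. ennreal (f y powr r) \<partial>lborel) \<le> 1 \<Longrightarrow> (\<integral>\<^sup>+ y. ennreal (h y powr r) \<partial>lborel) \<le> 1 \<Longrightarrow>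
      (\<integral>\<^sup>+ x. \<integral>\<^sup>+ y. ennreal (f x * h y * norm (x - y) powr - s) \<partial>lborel \<partial>lborel) \<le> ennreal K"
    using hardy_littlewood_sobolev_diagonal[OF s] unfolding r_def by blast
  \<comment> \<open>Here \<open>c\<close> bounds the norm of \<open>g\<close>, so the double
    integral is at most c K = 1/2; its power \<open>d\<close> is the corresponding bound on the
    integral of g^r.\<close>
  define c where "c = 1 / (2 * K)"
  have c: "c > 0" using K by (simp add: c_def)
  define d where "d = c powr r"
  have d: "d > 0" using c by (simp add: d_def)
  have "(\<integral>\<^sup>+ y. ennreal (f y powr a) \<partial>lborel) < 1"
    if [measurable]: "f \<in> borel_measurable borel" "g \<in> borel_measurable borel"
      and f: "\<And>y. 0 \<le> f y" and g: "\<And>y. 0 \<le> g y"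
      and f1: "(\<integral>\<^sup>+ y. ennreal (f y powr a) \<partial>lborel) \<le> 1"
      and g1: "(\<integral>\<^sup>+ y. ennreal (g y powr r) \<partial>lborel) \<le> ennreal d"
      and le: "\<And>x. ennreal (f x) \<le> (\<integral>\<^sup>+ y. ennreal (g y * norm (x - y) powr - s) \<partial>lborel)"
    for f g :: "real^'n \<Rightarrow> real"
  proof -
    have "(\<integral>\<^sup>+ x. ennreal (f x powr a) \<partial>lborel) \<le>
      (\<integral>\<^sup>+ x. ennreal c * (\<integral>\<^sup>+ y. ennreal (f x powr (a - 1) * (g y / c) * norm (x - y) powr - s) \<partial>lborel) \<partial>lborel)"
    proof (rule nn_integral_mono)
      fix x
      have "f x powr a = f x powr (a - 1) * f x"
        using f[of x] by (cases "f x = 0") (auto simp: powr_diff)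
      then have "ennreal (f x powr a) = ennreal (f x powr (a - 1)) * ennreal (f x)"
        using f[of x] by (simp add: ennreal_mult)
      also have "\<dots> \<le> ennreal (f x powr (a - 1)) * (\<integral>\<^sup>+ y. ennreal (g y * norm (x - y) powr - s) \<partial>lborel)"
        by (intro mult_left_mono le) auto
      also have "\<dots> = (\<integral>\<^sup>+ y. ennreal (f x powr (a - 1)) * ennreal (g y * norm (x - y) powr - s) \<partial>lborel)"
        by (rule nn_integral_cmult[symmetric]) measurable
      also have "\<dots> = (\<integral>\<^sup>+ y. ennreal c * ennreal (f x powr (a - 1) * (g y / c) * norm (x - y) powr - s) \<partial>lborel)"
        using g c by (intro nn_integral_cong) (simp add: ennreal_mult[symmetric] mult_ac)
      also have "\<dots> = ennreal c * (\<integral>\<^sup>+ y. ennreal (f x powr (a - 1) * (g y / c) * norm (x - y) powr - s) \<partial>lborel)"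
        by (rule nn_integral_cmult) measurable
      finally show "ennreal (f x powr a) \<le> \<dots>" .
    qed
    also have "\<dots> = ennreal c * (\<integral>\<^sup>+ x. \<integral>\<^sup>+ y. ennreal (f x powr (a - 1) * (g y / c) * norm (x - y) powr - s) \<partial>lborel \<partial>lborel)"
      by (rule nn_integral_cmult) measurable
    also have "\<dots> \<le> ennreal c * ennreal K"
    proof (intro mult_left_mono K)
      show "(\<integral>\<^sup>+ y. ennreal ((f y powr (a - 1)) powr r) \<partial>lborel) \<le> 1"
        using f1 by (simp add: powr_powr ar)
      have "(\<integral>\<^sup>+ y. ennreal ((g y / c) powr r) \<partial>lborel) = (\<integral>\<^sup>+ y. ennreal (1 / d) * ennreal (g y powr r) \<partial>lborel)"
        using g c by (intro nn_integral_cong) (simp add: ennreal_mult[symmetric] d_def powr_divide)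
      also have "\<dots> = ennreal (1 / d) * (\<integral>\<^sup>+ y. ennreal (g y powr r) \<partial>lborel)"
        by (rule nn_integral_cmult) measurable
      also have "\<dots> \<le> ennreal (1 / d) * ennreal d" by (intro mult_left_mono g1) auto
      also have "\<dots> = 1" using d by (simp add: ennreal_mult[symmetric])
      finally show "(\<integral>\<^sup>+ y. ennreal ((g y / c) powr r) \<partial>lborel) \<le> 1" .
    qed (use g c in \<open>auto simp: field_simps\<close>)
    also have "\<dots> = ennreal (1 / 2)" using K(1) c by (simp add: ennreal_mult[symmetric] c_def)
    also have "\<dots> < ennreal 1" by (rule ennreal_lessI) simp_all
    finally show ?thesis by simp
  qed
  with d show ?thesis by blast
qed

section \<open>Elementary inequalities for real powers\<close>

lemma weighted_product_le:
  fixes x y z :: real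
  assumes "0 \<le> x" "0 \<le> y" "0 \<le> z" "0 \<le> a" "0 \<le> b" "0 \<le> c" "a + b + c = 1"
  shows "x powr a * y powr b * z powr c \<le> x + y + z"
proof -
  define m where "m = max x (max y z)"
  have m: "x \<le> m" "y \<le> m" "z \<le> m" "m \<le> x + y + z" "0 \<le> m" using assms by (auto simp: m_def)
  have "x powr a * y powr b * z powr c \<le> m powr a * m powr b * m powr c"
    using assms m by (intro mult_mono powr_mono2) auto
  also have "\<dots> = m powr (a + b + c)" by (simp add: powr_add)
  also have "\<dots> = m" using m assms by simp
  finally show ?thesis using m by linarith
qed

text \<open>A pointwise substitute for Hoelder's inequality. If \<open>x\<close> and
  \<open>y\<close> have integral at most \<open>e\<close> and \<open>z\<close> has integral at most
  1, the bracket integrates to at most 3 and the gain is the factor e^(1-c).\<close>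

lemma weighted_product_le_small:
  fixes x y z e :: real
  assumes "0 \<le> x" "0 \<le> y" "0 \<le> z" "0 \<le> a" "0 \<le> b" "0 \<le> c" "a + b + c = 1" "e > 0"
  shows "x powr a * y powr b * z powr c \<le> e powr (1 - c) * (x / e + y / e + z)"
proof -
  have "x powr a * y powr b * z powr c = e powr (1 - c) * ((x / e) powr a * (y / e) powr b * z powr c)"
  proof -
    have "e powr (1 - c) = e powr a * e powr b"
      unfolding powr_add[symmetric] using assms(7) by (intro arg_cong2[where f="(powr)"]) auto
    then show ?thesis using assms by (simp add: powr_divide)
  qed
  also have "\<dots> \<le> e powr (1 - c) * (x / e + y / e + z)"
    using assms by (intro mult_left_mono weighted_product_le) auto
  finally show ?thesis .
qed

lemma powr_sum_le:
  fixes x y r :: real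
  assumes "0 \<le> x" "0 \<le> y" "0 \<le> r"
  shows "(x + y) powr r \<le> 2 powr r * (x powr r + y powr r)"
proof -
  have "(x + y) powr r \<le> (2 * max x y) powr r" using assms by (intro powr_mono2) auto
  also have "\<dots> = 2 powr r * (max x y) powr r" by (simp add: powr_mult)
  also have "\<dots> \<le> 2 powr r * (x powr r + y powr r)"
    by (intro mult_left_mono) (auto simp: max_def)
  finally show ?thesis .
qed

text \<open>Convexity of the power: the graph lies above its tangent at \<open>a\<close>. Young's
  inequality with weights 1/p and 1 - 1/p is this statement rearranged.\<close>

lemma powr_diff_le_tangent:
  fixes a b p :: real
  assumes "0 < b" "b \<le> a" "1 \<le> p"
  shows "a powr p - b powr p \<le> p * a powr (p - 1) * (a - b)"
proof -
  have a: "a > 0" using assms by linarith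
  have "(b powr p) powr (1 / p) * (a powr p) powr (1 - 1 / p) \<le> (1 / p) * b powr p + (1 - 1 / p) * a powr p"
    using assms a by (intro Youngs_inequality_0) auto
  moreover have "(b powr p) powr (1 / p) = b" "(a powr p) powr (1 - 1 / p) = a powr (p - 1)"
    using assms a by (auto simp: powr_powr right_diff_distrib)
  ultimately have "p * (b * a powr (p - 1)) \<le> p * ((1 / p) * b powr p + (1 - 1 / p) * a powr p)"
    using assms by (intro mult_left_mono) auto
  also have "\<dots> = b powr p + (p - 1) * a powr p" using assms by (simp add: field_simps)
  finally have "a powr p - b powr p \<le> p * a powr p - p * (b * a powr (p - 1))" by (simp add: algebra_simps)
  also have "p * a powr p = p * (a powr (p - 1) * a)" using a by (simp add: powr_diff)
  finally show ?thesis by (simp add: algebra_simps)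
qed

text \<open>For c <= a the excess is b (a^p - c^p) + (b - d) c^p; otherwise replacing
  \<open>c\<close> by \<open>a\<close> only increases it. Both cases leave coefficients in
  \<open>a\<close> and \<open>b\<close> alone, which will be u and v, and none in their Kelvin
  transforms.\<close>

lemma product_excess_le:
  fixes a b c d p :: real
  assumes "0 < a" "0 < b" "0 < c" "0 < d" "1 \<le> p"
  shows "b * a powr p - d * c powr p \<le> p * (b * a powr (p - 1) * max 0 (a - c)) + a powr p * max 0 (b - d)"
proof (cases "c \<le> a")
  case True
  have "b * (a powr p - c powr p) \<le> b * (p * a powr (p - 1) * (a - c))"
    using assms True by (intro mult_left_mono powr_diff_le_tangent) auto
  moreover have "(b - d) * c powr p \<le> max 0 (b - d) * a powr p"
    using assms True by (intro mult_mono powr_mono2) auto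
  ultimately show ?thesis using True by (simp add: algebra_simps max_def)
next
  case False
  then have le: "a powr p \<le> c powr p" using assms by (intro powr_mono2) auto
  have "b * a powr p - d * c powr p \<le> b * a powr p - d * a powr p"
    using le assms by simp
  also have "\<dots> = a powr p * (b - d)" by (simp add: algebra_simps)
  also have "\<dots> \<le> a powr p * max 0 (b - d)" by (intro mult_left_mono) auto
  finally show ?thesis using False by simp
qed

lemma powr_small:
  fixes c A d :: real
  assumes "0 < c" "0 < A" "0 < d"
  shows "\<exists>e0>0. \<forall>e. 0 < e \<longrightarrow> e \<le> e0 \<longrightarrow> A * e powr c \<le> d"
proof (intro exI[of _ "(d / A) powr (1 / c)"] conjI allI impI)
  fix e assume e: "0 < e" "e \<le> (d / A) powr (1 / c)"
  then have "e powr c \<le> ((d / A) powr (1 / c)) powr c" using assms by (intro powr_mono2) auto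
  then show "A * e powr c \<le> d" using assms by (simp add: powr_powr field_simps)
qed (use assms in auto)

text \<open>In the notation of the paper \<open>q = N - 2\<close>, \<open>p = 2\<^sup>*\<^sub>\<mu> - 1\<close>, \<open>\<alpha> = 2\<^sup>*\<close> and \<open>\<beta> = 2N/\<mu>\<close>.\<close>
locale hartree_system =
  fixes u v :: "real^'n::finite \<Rightarrow> real" and \<mu> p q \<alpha> \<beta> :: real
  assumes card: "3 \<le> CARD('n)" and mu: "0 < \<mu>" "\<mu> < real CARD('n)" "\<mu> \<le> 4"
    and q_eq: "q = real CARD('n) - 2" and p_eq: "p = (real CARD('n) + 2 - \<mu>) / (real CARD('n) - 2)"
    and \<alpha>_eq: "\<alpha> = 2 * real CARD('n) / q" and \<beta>_eq: "\<beta> = 2 * real CARD('n) / \<mu>"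
    and u_pos: "\<And>x. 0 < u x" and v_pos: "\<And>x. 0 < v x"
    and u_lsc: "\<And>a. open {x. a < u x}" and v_lsc: "\<And>a. open {x. a < v x}"
    and u_riesz: "\<And>x. ennreal (u x) = (\<integral>\<^sup>+ y. ennreal ((v y * u y powr p) * norm (x - y) powr - q) \<partial>lborel)"
    and v_riesz: "\<And>x. ennreal (v x) = (\<integral>\<^sup>+ y. ennreal (u y powr (p + 1) * norm (x - y) powr - \<mu>) \<partial>lborel)"
    and u_integrable: "\<And>R. (\<integral>\<^sup>+ y. ennreal (u y powr \<alpha>) * indicator (ball 0 R) y \<partial>lborel) < \<infinity>"
    and v_integrable: "\<And>R. (\<integral>\<^sup>+ y. ennreal (v y powr \<beta>) * indicator (ball 0 R) y \<partial>lborel) < \<infinity>"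
begin

lemma u_measurable [measurable]: "u \<in> borel_measurable borel"
  using u_lsc by (rule lsc_measurable)

lemma v_measurable [measurable]: "v \<in> borel_measurable borel"
  using v_lsc by (rule lsc_measurable)

lemma q_pos: "0 < q" and q_less: "q < real CARD('n)"
  using card q_eq by auto

text \<open>Equivalent to \<mu> <= 4; it makes the tangent inequality available for u^p and the
  exponent p - 1 nonnegative.\<close>

lemma p_ge_1: "1 \<le> p"
  using card mu by (simp add: p_eq field_simps)

text \<open>Criticality of the system: the identity behind both its conformal invariance and the
  balance of exponents in the estimates.\<close>

lemma q_mult_p: "q * p = real CARD('n) + 2 - \<mu>"
  using q_pos by (simp add: p_eq q_eq)

text \<open>Both equations are potentials, of exponents \<open>q\<close> and \<open>\<mu>\<close>,
  so the comparison is proved once and instantiated twice.\<close>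

sublocale U: riesz_potential q "\<lambda>y. v y * u y powr p" u
  by unfold_locales (use q_pos u_pos v_pos u_riesz in \<open>auto simp: less_imp_le\<close>)

sublocale V: riesz_potential \<mu> "\<lambda>y. u y powr (p + 1)" v
  by unfold_locales (use mu u_pos v_pos v_riesz in \<open>auto simp: less_imp_le\<close>)

text \<open>The inequalities are linear in \<open>(f, g)\<close>, so one may normalise the larger of the two norms to \<open>1\<close>;
  smallness of the coefficients on \<open>S\<close> then makes it less than \<open>1\<close>.\<close>
lemma linearised_vanishing:
  "\<exists>e>0. \<forall>S f g. S \<in> sets borel \<longrightarrow> f \<in> borel_measurable borel \<longrightarrow> g \<in> borel_measurable borel \<longrightarrow>
    (\<forall>y. 0 \<le> f y \<and> f y \<le> u y) \<longrightarrow> (\<forall>y. 0 \<le> g y \<and> g y \<le> v y) \<longrightarrow> (\<forall>y. y \<notin> S \<longrightarrow> f y = 0 \<and> g y = 0) \<longrightarrow>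
    (\<integral>\<^sup>+ y. ennreal (u y powr \<alpha>) * indicator S y \<partial>lborel) \<le> ennreal e \<longrightarrow>
    (\<integral>\<^sup>+ y. ennreal (v y powr \<beta>) * indicator S y \<partial>lborel) \<le> ennreal e \<longrightarrow>
    (\<forall>x. ennreal (f x) \<le> (\<integral>\<^sup>+ y. ennreal ((p * (v y * u y powr (p - 1) * f y) + u y powr p * g y) * norm (x - y) powr - q) \<partial>lborel)) \<longrightarrow>
    (\<forall>x. ennreal (g x) \<le> (\<integral>\<^sup>+ y. ennreal (((p + 1) * (u y powr p * f y)) * norm (x - y) powr - \<mu>) \<partial>lborel)) \<longrightarrow>
    (AE y in lborel. f y = 0 \<and> g y = 0)"
proof -
  let ?N = "real CARD('n)"
  define r where "r = 2 * ?N / (2 * ?N - q)"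
  define r' where "r' = 2 * ?N / (2 * ?N - \<mu>)"
  have r0: "r > 0" "r' > 0" using q_less q_pos mu by (auto simp: r_def r'_def)
  have N: "?N > 0" using card by simp
  have \<alpha>0: "\<alpha> > 0" "\<beta> > 0" using N q_pos mu by (auto simp: \<alpha>_eq \<beta>_eq)
  obtain d where d: "d > 0" "\<And>f g :: real^'n \<Rightarrow> real. f \<in> borel_measurable borel \<Longrightarrow> g \<in> borel_measurable borel \<Longrightarrow>
      (\<And>y. 0 \<le> f y) \<Longrightarrow> (\<And>y. 0 \<le> g y) \<Longrightarrow>
      (\<integral>\<^sup>+ y. ennreal (f y powr \<alpha>) \<partial>lborel) \<le> 1 \<Longrightarrow> (\<integral>\<^sup>+ y. ennreal (g y powr r) \<partial>lborel) \<le> ennreal d \<Longrightarrow>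
      (\<And>x. ennreal (f x) \<le> (\<integral>\<^sup>+ y. ennreal (g y * norm (x - y) powr - q) \<partial>lborel)) \<Longrightarrow>
      (\<integral>\<^sup>+ y. ennreal (f y powr \<alpha>) \<partial>lborel) < 1"
    using hls_subcritical[OF q_pos q_less] unfolding r_def \<alpha>_eq by blast
  obtain d' where d': "d' > 0" "\<And>f g :: real^'n \<Rightarrow> real. f \<in> borel_measurable borel \<Longrightarrow> g \<in> borel_measurable borel \<Longrightarrow>
      (\<And>y. 0 \<le> f y) \<Longrightarrow> (\<And>y. 0 \<le> g y) \<Longrightarrow>
      (\<integral>\<^sup>+ y. ennreal (f y powr \<beta>) \<partial>lborel) \<le> 1 \<Longrightarrow> (\<integral>\<^sup>+ y. ennreal (g y powr r') \<partial>lborel) \<le> ennreal d' \<Longrightarrow>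
      (\<And>x. ennreal (f x) \<le> (\<integral>\<^sup>+ y. ennreal (g y * norm (x - y) powr - \<mu>) \<partial>lborel)) \<Longrightarrow>
      (\<integral>\<^sup>+ y. ennreal (f y powr \<beta>) \<partial>lborel) < 1"
    using hls_subcritical[OF mu(1,2)] unfolding r'_def \<beta>_eq by blast

  \<comment> \<open>Exponents for v u^(p-1) f and u^p g in the r-th power and for u^p f in the r'-th
    power. The summand 0 belongs to a dummy factor that gives all three products the same
    shape.\<close>
  have ex1: "r / \<beta> + (p - 1) * r / \<alpha> + r / \<alpha> = 1" "p * r / \<alpha> + 0 + r / \<beta> = 1" "p * r' / \<alpha> + 0 + r' / \<alpha> = 1"
  proof -
    have c: "r / \<beta> = \<mu> * r / (2 * ?N)" "r / \<alpha> = q * r / (2 * ?N)" "r' / \<alpha> = q * r' / (2 * ?N)"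
      "(p - 1) * r / \<alpha> = (q * p - q) * r / (2 * ?N)" "p * r / \<alpha> = (q * p) * r / (2 * ?N)"
       "p * r' / \<alpha> = (q * p) * r' / (2 * ?N)"
      using N by (auto simp: \<alpha>_eq \<beta>_eq algebra_simps)
    have r: "(?N + 2) * r / (2 * ?N) = 1" "(2 * ?N - \<mu>) * r' / (2 * ?N) = 1"
      using q_less mu N by (auto simp: r_def r'_def q_eq)
    have "r / \<beta> + (p - 1) * r / \<alpha> + r / \<alpha> = (\<mu> + q * p) * r / (2 * ?N)"
      unfolding c by (simp add: add_divide_distrib[symmetric] algebra_simps)
    then show "r / \<beta> + (p - 1) * r / \<alpha> + r / \<alpha> = 1"
      using r unfolding q_mult_p by (simp add: add.commute)
    have "p * r / \<alpha> + 0 + r / \<beta> = (q * p + \<mu>) * r / (2 * ?N)"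
      unfolding c by (simp add: add_divide_distrib[symmetric] algebra_simps)
    then show "p * r / \<alpha> + 0 + r / \<beta> = 1"
      using r unfolding q_mult_p by simp
    have "p * r' / \<alpha> + 0 + r' / \<alpha> = (q * p + q) * r' / (2 * ?N)"
      unfolding c by (simp add: add_divide_distrib[symmetric] algebra_simps)
    then show "p * r' / \<alpha> + 0 + r' / \<alpha> = 1"
      using r unfolding q_mult_p by (simp add: q_eq)
  qed
  \<comment> \<open>The exponent of the unknown factor is below 1 because a coefficient has positive
    exponent; hence a positive power of \<open>e\<close> is gained.\<close>
  have c: "1 - r / \<alpha> > 0" "1 - r / \<beta> > 0" "1 - r' / \<alpha> > 0"
  proof -
    have "r / \<beta> > 0" "p * r / \<alpha> > 0" "p * r' / \<alpha> > 0" "(p - 1) * r / \<alpha> \<ge> 0"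
      using r0 \<alpha>0 p_ge_1 q_pos N mu by auto
    then show "1 - r / \<alpha> > 0" "1 - r / \<beta> > 0" "1 - r' / \<alpha> > 0" using ex1 by linarith+
  qed
  \<comment> \<open>The factor 2^r comes from splitting the power of a sum, p^r and (p+1)^r' from
    the linearisation, and 3 from three integrals that are each at most 1.\<close>
  define A1 where "A1 = 2 powr r * p powr r * 3"
  define A2 where "A2 = 2 powr r * 3"
  define A3 where "A3 = (p + 1) powr r' * 3"
  have A: "A1 > 0" "A2 > 0" "A3 > 0" using p_ge_1 by (auto simp: A1_def A2_def A3_def)
  obtain e1 where e1: "e1 > 0" "\<And>e. 0 < e \<Longrightarrow> e \<le> e1 \<Longrightarrow> A1 * e powr (1 - r / \<alpha>) \<le> d / 2"
    using powr_small[OF c(1) A(1), of "d / 2"] d(1) by auto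
  obtain e2 where e2: "e2 > 0" "\<And>e. 0 < e \<Longrightarrow> e \<le> e2 \<Longrightarrow> A2 * e powr (1 - r / \<beta>) \<le> d / 2"
    using powr_small[OF c(2) A(2), of "d / 2"] d(1) by auto
  obtain e3 where e3: "e3 > 0" "\<And>e. 0 < e \<Longrightarrow> e \<le> e3 \<Longrightarrow> A3 * e powr (1 - r' / \<alpha>) \<le> d'"
    using powr_small[OF c(3) A(3), of "d'"] d'(1) by auto
  define e where "e = min e1 (min e2 e3)"
  have e: "e > 0" "e \<le> e1" "e \<le> e2" "e \<le> e3" using e1 e2 e3 by (auto simp: e_def)

  have main: "AE y in lborel. f y = 0 \<and> g y = 0"
    if [measurable]: "S \<in> sets borel" "f \<in> borel_measurable borel" "g \<in> borel_measurable borel"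
      and f: "\<And>y. 0 \<le> f y" "\<And>y. f y \<le> u y" and g: "\<And>y. 0 \<le> g y" "\<And>y. g y \<le> v y"
      and S: "\<And>y. y \<notin> S \<Longrightarrow> f y = 0" "\<And>y. y \<notin> S \<Longrightarrow> g y = 0"
      and uS: "(\<integral>\<^sup>+ y. ennreal (u y powr \<alpha>) * indicator S y \<partial>lborel) \<le> ennreal e"
      and vS: "(\<integral>\<^sup>+ y. ennreal (v y powr \<beta>) * indicator S y \<partial>lborel) \<le> ennreal e"
      and fle: "\<And>x. ennreal (f x) \<le> (\<integral>\<^sup>+ y. ennreal ((p * (v y * u y powr (p - 1) * f y) + u y powr p * g y) * norm (x - y) powr - q) \<partial>lborel)"
      and gle: "\<And>x. ennreal (g x) \<le> (\<integral>\<^sup>+ y. ennreal (((p + 1) * (u y powr p * f y)) * norm (x - y) powr - \<mu>) \<partial>lborel)"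
    for S f g
  proof -
    have "(\<integral>\<^sup>+ y. ennreal (f y powr \<alpha>) \<partial>lborel) \<le> (\<integral>\<^sup>+ y. ennreal (u y powr \<alpha>) * indicator S y \<partial>lborel)"
      using f S \<alpha>0 by (intro nn_integral_mono) (auto simp: indicator_def intro!: ennreal_leI powr_mono2)
    then have "(\<integral>\<^sup>+ y. ennreal (f y powr \<alpha>) \<partial>lborel) < \<infinity>" using le_less_trans[OF order_trans[OF _ uS] ennreal_less_top] by simp
    then obtain I where I: "I \<ge> 0" "(\<integral>\<^sup>+ y. ennreal (f y powr \<alpha>) \<partial>lborel) = ennreal I"
      by (cases "\<integral>\<^sup>+ y. ennreal (f y powr \<alpha>) \<partial>lborel" rule: ennreal_cases) auto
    have "(\<integral>\<^sup>+ y. ennreal (g y powr \<beta>) \<partial>lborel) \<le> (\<integral>\<^sup>+ y. ennreal (v y powr \<beta>) * indicator S y \<partial>lborel)"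
      using g S \<alpha>0 by (intro nn_integral_mono) (auto simp: indicator_def intro!: ennreal_leI powr_mono2)
    then have "(\<integral>\<^sup>+ y. ennreal (g y powr \<beta>) \<partial>lborel) < \<infinity>" using le_less_trans[OF order_trans[OF _ vS] ennreal_less_top] by simp
    then obtain J where J: "J \<ge> 0" "(\<integral>\<^sup>+ y. ennreal (g y powr \<beta>) \<partial>lborel) = ennreal J"
      by (cases "\<integral>\<^sup>+ y. ennreal (g y powr \<beta>) \<partial>lborel" rule: ennreal_cases) auto
    \<comment> \<open>The norms are finite because \<open>f\<close> and \<open>g\<close> are bounded
      by u and v and vanish off \<open>S\<close>; without this the scaling would prove
      nothing.\<close>
    define t where "t = max (I powr (1 / \<alpha>)) (J powr (1 / \<beta>))"
    have "t = 0"
    proof (rule ccontr)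
      assume "t \<noteq> 0"
      moreover have "t \<ge> 0" by (auto simp: t_def le_max_iff_disj)
      ultimately have t: "t > 0" by linarith
      define f' where "f' y = f y / t" for y
      define g' where "g' y = g y / t" for y
      have [measurable]: "f' \<in> borel_measurable borel" "g' \<in> borel_measurable borel"
        by (auto simp: f'_def[abs_def] g'_def[abs_def])
      have f'0: "0 \<le> f' y" and g'0: "0 \<le> g' y" for y using f g t by (auto simp: f'_def g'_def)
      have S': "y \<notin> S \<Longrightarrow> f' y = 0" "y \<notin> S \<Longrightarrow> g' y = 0" for y using S by (auto simp: f'_def g'_def)
      have If': "(\<integral>\<^sup>+ y. ennreal (f' y powr \<alpha>) \<partial>lborel) = ennreal (I / t powr \<alpha>)"
      proof -
        have "(\<integral>\<^sup>+ y. ennreal (f' y powr \<alpha>) \<partial>lborel) = (\<integral>\<^sup>+ y. ennreal (1 / t powr \<alpha>) * ennreal (f y powr \<alpha>) \<partial>lborel)"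
          using f t by (intro nn_integral_cong) (simp add: f'_def powr_divide ennreal_mult[symmetric])
        also have "\<dots> = ennreal (1 / t powr \<alpha>) * ennreal I"
          by (subst nn_integral_cmult) (auto simp: I)
        finally show ?thesis using I(1) by (simp add: ennreal_mult[symmetric])
      qed
      have Jg': "(\<integral>\<^sup>+ y. ennreal (g' y powr \<beta>) \<partial>lborel) = ennreal (J / t powr \<beta>)"
      proof -
        have "(\<integral>\<^sup>+ y. ennreal (g' y powr \<beta>) \<partial>lborel) = (\<integral>\<^sup>+ y. ennreal (1 / t powr \<beta>) * ennreal (g y powr \<beta>) \<partial>lborel)"
          using g t by (intro nn_integral_cong) (simp add: g'_def powr_divide ennreal_mult[symmetric])
        also have "\<dots> = ennreal (1 / t powr \<beta>) * ennreal J"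
          by (subst nn_integral_cmult) (auto simp: J)
        finally show ?thesis using J(1) by (simp add: ennreal_mult[symmetric])
      qed
      have It: "I = (I powr (1 / \<alpha>)) powr \<alpha>" "J = (J powr (1 / \<beta>)) powr \<beta>"
        using I(1) J(1) \<alpha>0 by (auto simp: powr_powr)
      have le1: "I / t powr \<alpha> \<le> 1"
      proof -
        have "I \<le> t powr \<alpha>" using It(1) \<alpha>0
          by (metis max.cobounded1 powr_ge_zero powr_mono2 less_imp_le t_def)
        then show ?thesis using t by simp
      qed
      have le2: "J / t powr \<beta> \<le> 1"
      proof -
        have "J \<le> t powr \<beta>" using It(2) \<alpha>0
          by (metis max.cobounded2 powr_ge_zero powr_mono2 less_imp_le t_def)
        then show ?thesis using t by simp
      qed
      have sc: "ennreal (h x / t) \<le> (\<integral>\<^sup>+ y. ennreal ((k y / t) * norm (x - y) powr - s) \<partial>lborel)"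
        if "ennreal (h x) \<le> (\<integral>\<^sup>+ y. ennreal (k y * norm (x - y) powr - s) \<partial>lborel)"
          "\<And>y. 0 \<le> k y" "\<And>y. 0 \<le> h y" and [measurable]: "k \<in> borel_measurable borel"
        for h k :: "real^'n \<Rightarrow> real" and s x
      proof -
        have "ennreal (h x / t) = ennreal (1 / t) * ennreal (h x)"
          using t that by (simp add: ennreal_mult[symmetric])
        also have "\<dots> \<le> ennreal (1 / t) * (\<integral>\<^sup>+ y. ennreal (k y * norm (x - y) powr - s) \<partial>lborel)"
          by (intro mult_left_mono that) auto
        also have "\<dots> = (\<integral>\<^sup>+ y. ennreal (1 / t) * ennreal (k y * norm (x - y) powr - s) \<partial>lborel)"
          by (rule nn_integral_cmult[symmetric]) measurable
        also have "\<dots> = (\<integral>\<^sup>+ y. ennreal ((k y / t) * norm (x - y) powr - s) \<partial>lborel)"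
          using t that by (intro nn_integral_cong) (simp add: ennreal_mult[symmetric])
        finally show ?thesis .
      qed
      define G where "G y = p * (v y * u y powr (p - 1) * f' y) + u y powr p * g' y" for y
      define H where "H y = (p + 1) * (u y powr p * f' y)" for y
      have [measurable]: "G \<in> borel_measurable borel" "H \<in> borel_measurable borel"
        by (auto simp: G_def[abs_def] H_def[abs_def])
      have v0: "0 \<le> v y" and u0: "0 \<le> u y" for y using u_pos[of y] v_pos[of y] by auto
      have G0: "0 \<le> G y" and H0: "0 \<le> H y" for y
        using u0 v0 f'0 g'0 p_ge_1 by (auto simp: G_def H_def)
      have int3: "(\<integral>\<^sup>+ y. ennreal (u y powr \<alpha> / e + v y powr \<beta> / e + h y) * indicator S y \<partial>lborel) \<le> 3"
        if [measurable]: "h \<in> borel_measurable borel" and h0: "\<And>y. 0 \<le> h y" and h1: "(\<integral>\<^sup>+ y. ennreal (h y) \<partial>lborel) \<le> 1"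
        for h :: "real^'n \<Rightarrow> real"
      proof -
        have "(\<integral>\<^sup>+ y. ennreal (u y powr \<alpha> / e + v y powr \<beta> / e + h y) * indicator S y \<partial>lborel) \<le>
          (\<integral>\<^sup>+ y. ennreal (1 / e) * (ennreal (u y powr \<alpha>) * indicator S y) + (ennreal (1 / e) * (ennreal (v y powr \<beta>) * indicator S y)
            + ennreal (h y)) \<partial>lborel)"
          using h0 e by (intro nn_integral_mono) (auto simp: indicator_def ennreal_mult[symmetric] add.assoc)
        also have "\<dots> = ennreal (1 / e) * (\<integral>\<^sup>+ y. ennreal (u y powr \<alpha>) * indicator S y \<partial>lborel) +
           (ennreal (1 / e) * (\<integral>\<^sup>+ y. ennreal (v y powr \<beta>) * indicator S y \<partial>lborel) + (\<integral>\<^sup>+ y. ennreal (h y) \<partial>lborel))"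
          by (subst nn_integral_add nn_integral_cmult, measurable)+
        also have "\<dots> \<le> ennreal (1 / e) * ennreal e + (ennreal (1 / e) * ennreal e + 1)"
          using uS vS h1 by (intro add_mono mult_left_mono) auto
        also have "ennreal (1 / e) * ennreal e = 1" using e by (simp add: ennreal_mult[symmetric])
        finally show ?thesis by (simp add: add.assoc[symmetric])
      qed
      have int_bound: "(\<integral>\<^sup>+ y. ennreal (c * (u y powr \<alpha> / e + v y powr \<beta> / e + h y)) * indicator S y \<partial>lborel) \<le> ennreal (c * 3)"
        if [measurable]: "h \<in> borel_measurable borel" and h0: "\<And>y. 0 \<le> h y" and h1: "(\<integral>\<^sup>+ y. ennreal (h y) \<partial>lborel) \<le> 1"
          and c: "c \<ge> 0"
        for h :: "real^'n \<Rightarrow> real" and c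
      proof -
        have "(\<integral>\<^sup>+ y. ennreal (c * (u y powr \<alpha> / e + v y powr \<beta> / e + h y)) * indicator S y \<partial>lborel)
          = (\<integral>\<^sup>+ y. ennreal c * (ennreal (u y powr \<alpha> / e + v y powr \<beta> / e + h y) * indicator S y) \<partial>lborel)"
          using c by (intro nn_integral_cong) (auto simp: indicator_def ennreal_mult' )
        also have "\<dots> = ennreal c * (\<integral>\<^sup>+ y. ennreal (u y powr \<alpha> / e + v y powr \<beta> / e + h y) * indicator S y \<partial>lborel)"
          by (rule nn_integral_cmult) measurable
        also have "\<dots> \<le> ennreal c * 3" by (intro mult_left_mono int3 that) auto
        also have "\<dots> = ennreal (c * 3)" using c by (simp add: ennreal_mult)
        finally show ?thesis .
      qed
      have Gint: "(\<integral>\<^sup>+ y. ennreal (G y powr r) \<partial>lborel) \<le> ennreal d"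
      proof -
        let ?B1 = "\<lambda>y. 2 powr r * p powr r * e powr (1 - r / \<alpha>) * (u y powr \<alpha> / e + v y powr \<beta> / e + f' y powr \<alpha>)"
        let ?B2 = "\<lambda>y. 2 powr r * e powr (1 - r / \<beta>) * (u y powr \<alpha> / e + v y powr \<beta> / e + g' y powr \<beta>)"
        have "ennreal (G y powr r) \<le> ennreal (?B1 y) * indicator S y + ennreal (?B2 y) * indicator S y" for y
        proof (cases "y \<in> S")
          case True
          have "(v y * u y powr (p - 1) * f' y) powr r =
             (v y powr \<beta>) powr (r / \<beta>) * (u y powr \<alpha>) powr ((p - 1) * r / \<alpha>) * (f' y powr \<alpha>) powr (r / \<alpha>)"
            using \<alpha>0 by (simp add: powr_mult powr_powr)
          also have "\<dots> \<le> e powr (1 - r / \<alpha>) * (v y powr \<beta> / e + u y powr \<alpha> / e + f' y powr \<alpha>)"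
            using r0 \<alpha>0 p_ge_1 e q_pos mu ex1(1) by (intro weighted_product_le_small) auto
          finally have 1: "(v y * u y powr (p - 1) * f' y) powr r \<le> e powr (1 - r / \<alpha>) * (u y powr \<alpha> / e + v y powr \<beta> / e + f' y powr \<alpha>)"
            by (simp add: add_ac)
          \<comment> \<open>The dummy factor equals 1 only because v is positive:
            \<open>0 powr 0 = 0\<close>.\<close>
          have "(u y powr p * g' y) powr r = (u y powr \<alpha>) powr (p * r / \<alpha>) * (v y powr \<beta>) powr 0 * (g' y powr \<beta>) powr (r / \<beta>)"
            using \<alpha>0 v_pos[of y] by (simp add: powr_mult powr_powr)
          also have "\<dots> \<le> e powr (1 - r / \<beta>) * (u y powr \<alpha> / e + v y powr \<beta> / e + g' y powr \<beta>)"
            using r0 \<alpha>0 p_ge_1 e q_pos mu ex1(2) by (intro weighted_product_le_small) auto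
          finally have 2: "(u y powr p * g' y) powr r \<le> e powr (1 - r / \<beta>) * (u y powr \<alpha> / e + v y powr \<beta> / e + g' y powr \<beta>)" .
          have "G y powr r \<le> 2 powr r * ((p * (v y * u y powr (p - 1) * f' y)) powr r + (u y powr p * g' y) powr r)"
            unfolding G_def using u0 v0 f'0 g'0 p_ge_1 r0 by (intro powr_sum_le) auto
          also have "\<dots> = 2 powr r * p powr r * (v y * u y powr (p - 1) * f' y) powr r + 2 powr r * (u y powr p * g' y) powr r"
            using p_ge_1 by (simp only: powr_mult distrib_left mult.assoc)
          also have "\<dots> \<le> ?B1 y + ?B2 y"
            unfolding mult.assoc[of _ "e powr _"]
            by (intro add_mono mult_left_mono 1 2) auto
          finally have "ennreal (G y powr r) \<le> ennreal (?B1 y + ?B2 y)" by (rule ennreal_leI)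
          then show ?thesis using True e f'0 g'0 by (simp add: ennreal_plus[symmetric] del: ennreal_plus)
        qed (simp add: G_def S')
        then have "(\<integral>\<^sup>+ y. ennreal (G y powr r) \<partial>lborel) \<le>
          (\<integral>\<^sup>+ y. ennreal (?B1 y) * indicator S y + ennreal (?B2 y) * indicator S y \<partial>lborel)"
          by (intro nn_integral_mono)
        also have "\<dots> = (\<integral>\<^sup>+ y. ennreal (?B1 y) * indicator S y \<partial>lborel) + (\<integral>\<^sup>+ y. ennreal (?B2 y) * indicator S y \<partial>lborel)"
          by (rule nn_integral_add) measurable
        also have "\<dots> \<le> ennreal (2 powr r * p powr r * e powr (1 - r / \<alpha>) * 3) + ennreal (2 powr r * e powr (1 - r / \<beta>) * 3)"
          using le1 le2 I J t by (intro add_mono int_bound) (auto simp: If' Jg')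
        also have "\<dots> = ennreal (A1 * e powr (1 - r / \<alpha>)) + ennreal (A2 * e powr (1 - r / \<beta>))"
          by (simp add: A1_def A2_def mult_ac)
        also have "\<dots> \<le> ennreal (d / 2) + ennreal (d / 2)"
          using e by (intro add_mono ennreal_leI e1 e2) auto
        also have "\<dots> = ennreal d" using d(1) by (simp flip: ennreal_plus)
        finally show ?thesis .
      qed
      have Hint: "(\<integral>\<^sup>+ y. ennreal (H y powr r') \<partial>lborel) \<le> ennreal d'"
      proof -
        let ?B1 = "\<lambda>y. (p + 1) powr r' * e powr (1 - r' / \<alpha>) * (u y powr \<alpha> / e + v y powr \<beta> / e + f' y powr \<alpha>)"
        have "ennreal (H y powr r') \<le> ennreal (?B1 y) * indicator S y" for y
        proof (cases "y \<in> S")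
          case True
          have "(u y powr p * f' y) powr r' = (u y powr \<alpha>) powr (p * r' / \<alpha>) * (v y powr \<beta>) powr 0 * (f' y powr \<alpha>) powr (r' / \<alpha>)"
            using \<alpha>0 v_pos[of y] by (simp add: powr_mult powr_powr)
          also have "\<dots> \<le> e powr (1 - r' / \<alpha>) * (u y powr \<alpha> / e + v y powr \<beta> / e + f' y powr \<alpha>)"
            using r0 \<alpha>0 p_ge_1 e q_pos mu ex1(3) by (intro weighted_product_le_small) auto
          finally have "H y powr r' \<le> ?B1 y"
            unfolding H_def powr_mult[of "p + 1"] mult.assoc by (intro mult_left_mono) auto
          then show ?thesis using True by (simp add: ennreal_leI)
        qed (simp add: H_def S')
        then have "(\<integral>\<^sup>+ y. ennreal (H y powr r') \<partial>lborel) \<le> (\<integral>\<^sup>+ y. ennreal (?B1 y) * indicator S y \<partial>lborel)"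
          by (intro nn_integral_mono)
        also have "\<dots> \<le> ennreal ((p + 1) powr r' * e powr (1 - r' / \<alpha>) * 3)"
          using le1 I t by (intro int_bound) (auto simp: If')
        also have "\<dots> = ennreal (A3 * e powr (1 - r' / \<alpha>))" by (simp add: A3_def mult_ac)
        also have "\<dots> \<le> ennreal d'" using e by (intro ennreal_leI e3) auto
        finally show ?thesis .
      qed
      have "ennreal (f' x) \<le> (\<integral>\<^sup>+ y. ennreal (G y * norm (x - y) powr - q) \<partial>lborel)" for x
      proof -
        have "G = (\<lambda>y. (p * (v y * u y powr (p - 1) * f y) + u y powr p * g y) / t)"
          by (auto simp: G_def f'_def g'_def add_divide_distrib)
        then show ?thesis unfolding f'_def
          using sc[where h=f and k="\<lambda>y. p * (v y * u y powr (p - 1) * f y) + u y powr p * g y" and s=q and x=x, OF fle[of x]]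
            u0 v0 f g p_ge_1 by simp
      qed
      then have lt1: "I / t powr \<alpha> < 1"
        using d(2)[of f' G] f'0 G0 le1 Gint I(1) t by (simp add: If' ennreal_less_one_iff)
      have "ennreal (g' x) \<le> (\<integral>\<^sup>+ y. ennreal (H y * norm (x - y) powr - \<mu>) \<partial>lborel)" for x
      proof -
        have "H = (\<lambda>y. ((p + 1) * (u y powr p * f y)) / t)"
          by (auto simp: H_def f'_def)
        then show ?thesis unfolding g'_def
          using sc[where h=g and k="\<lambda>y. (p + 1) * (u y powr p * f y)" and s=\<mu> and x=x, OF gle[of x]]
            u0 v0 f g p_ge_1 by simp
      qed
      then have lt2: "J / t powr \<beta> < 1"
        using d'(2)[of g' H] g'0 H0 le2 Hint J(1) t by (simp add: Jg' ennreal_less_one_iff)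
      \<comment> \<open>Whichever norm attains the maximum is scaled to exactly 1, contrary to the
        strict bounds just obtained.\<close>
      consider "t = I powr (1 / \<alpha>)" | "t = J powr (1 / \<beta>)" unfolding t_def by linarith
      then show False
      proof cases
        case 1
        then have "I = t powr \<alpha>" using It(1) by simp
        then show False using lt1 t by simp
      next
        case 2
        then have "J = t powr \<beta>" using It(2) by simp
        then show False using lt2 t by simp
      qed
    qed
    then have "I powr (1 / \<alpha>) \<le> 0" "J powr (1 / \<beta>) \<le> 0" by (auto simp: t_def max_def split: if_splits)
    then have "I powr (1 / \<alpha>) = 0" "J powr (1 / \<beta>) = 0" by (auto intro: antisym)
    then have "I = 0" "J = 0" by auto
    then have "AE y in lborel. f y powr \<alpha> = 0" "AE y in lborel. g y powr \<beta> = 0"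
      using I(2) J(2) by (auto simp: nn_integral_0_iff_AE)
    then show ?thesis by eventually_elim auto
  qed
  show ?thesis
    by (intro exI[of _ e] conjI allI impI; (rule e(1) | (rule main; blast)))
qed

end

section \<open>Moving spheres\<close>

context hartree_system
begin

section \<open>Conformal invariance of the system and comparison with the Kelvin transforms\<close>

lemma kelvin_u_pos: "l > 0 \<Longrightarrow> y \<noteq> 0 \<Longrightarrow> 0 < kelvin q l u y"
  and kelvin_v_pos: "l > 0 \<Longrightarrow> y \<noteq> 0 \<Longrightarrow> 0 < kelvin \<mu> l v y"
  using u_pos v_pos by (auto simp: kelvin_def)

text \<open>Since 2N - q = \<mu> + q p, the weight splits into one factor for v and p factors for u,
  so the Kelvin transforms solve the same system.\<close>

lemma kelvin_u_source:
  assumes "l > 0"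
  shows "kelvin (2 * real CARD('n) - q) l (\<lambda>y. v y * u y powr p) y = kelvin \<mu> l v y * kelvin q l u y powr p"
proof -
  have "2 * real CARD('n) - q = \<mu> + q * p" using q_mult_p q_eq by linarith
  then show ?thesis
    by (simp add: kelvin_def powr_mult powr_powr powr_add)
qed

lemma kelvin_v_source:
  assumes "l > 0"
  shows "kelvin (2 * real CARD('n) - \<mu>) l (\<lambda>y. u y powr (p + 1)) y = kelvin q l u y powr (p + 1)"
proof -
  have "q * (p + 1) = q * p + q" by (simp add: algebra_simps)
  then have "2 * real CARD('n) - \<mu> = q * (p + 1)" using q_mult_p q_eq by linarith
  then show ?thesis
    by (simp add: kelvin_def powr_mult powr_powr)
qed

text \<open>The origin is excluded because division by zero makes the Kelvin transform vanish there,
  and the comparison would fail for positive functions.\<close>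

definition good :: "real \<Rightarrow> bool" where
  "good l \<longleftrightarrow> (\<forall>y \<in> ball 0 l - {0}. u y \<le> kelvin q l u y \<and> v y \<le> kelvin \<mu> l v y)"

definition bad_set :: "real \<Rightarrow> (real^'n) set" where
  "bad_set l = {y \<in> ball 0 l - {0}. kelvin q l u y < u y \<or> kelvin \<mu> l v y < v y}"

lemma bad_set_measurable [measurable]: "bad_set l \<in> sets borel"
  unfolding bad_set_def by measurable

lemma good_if_bad_set_small:
  "\<exists>e>0. \<forall>l>0. (\<integral>\<^sup>+ y. ennreal (u y powr \<alpha>) * indicator (bad_set l) y \<partial>lborel) \<le> ennreal e \<longrightarrow>
    (\<integral>\<^sup>+ y. ennreal (v y powr \<beta>) * indicator (bad_set l) y \<partial>lborel) \<le> ennreal e \<longrightarrow> good l"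
proof -
  obtain e where e: "e > 0" and van: "\<And>S f g. S \<in> sets borel \<Longrightarrow> f \<in> borel_measurable borel \<Longrightarrow> g \<in> borel_measurable borel \<Longrightarrow>
    (\<forall>y. 0 \<le> f y \<and> f y \<le> u y) \<Longrightarrow> (\<forall>y. 0 \<le> g y \<and> g y \<le> v y) \<Longrightarrow> (\<forall>y. y \<notin> S \<longrightarrow> f y = 0 \<and> g y = 0) \<Longrightarrow>
    (\<integral>\<^sup>+ y. ennreal (u y powr \<alpha>) * indicator S y \<partial>lborel) \<le> ennreal e \<Longrightarrow>
    (\<integral>\<^sup>+ y. ennreal (v y powr \<beta>) * indicator S y \<partial>lborel) \<le> ennreal e \<Longrightarrow>
    (\<forall>x. ennreal (f x) \<le> (\<integral>\<^sup>+ y. ennreal ((p * (v y * u y powr (p - 1) * f y) + u y powr p * g y) * norm (x - y) powr - q) \<partial>lborel)) \<Longrightarrow>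
    (\<forall>x. ennreal (g x) \<le> (\<integral>\<^sup>+ y. ennreal (((p + 1) * (u y powr p * f y)) * norm (x - y) powr - \<mu>) \<partial>lborel)) \<Longrightarrow>
    (AE y in lborel. f y = 0 \<and> g y = 0)"
    using linearised_vanishing by blast
  have "good l" if l: "l > 0"
    and uS: "(\<integral>\<^sup>+ y. ennreal (u y powr \<alpha>) * indicator (bad_set l) y \<partial>lborel) \<le> ennreal e"
    and vS: "(\<integral>\<^sup>+ y. ennreal (v y powr \<beta>) * indicator (bad_set l) y \<partial>lborel) \<le> ennreal e" for l
  proof -
    \<comment> \<open>The indicator removes the exterior of the ball and the origin, where the value
      of the Kelvin transform is a default.\<close>
    define f where "f y = max 0 (u y - kelvin q l u y) * indicator (bad_set l) y" for y
    define g where "g y = max 0 (v y - kelvin \<mu> l v y) * indicator (bad_set l) y" for y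
    have [measurable]: "f \<in> borel_measurable borel" "g \<in> borel_measurable borel"
      unfolding f_def[abs_def] g_def[abs_def] by measurable
    have k0: "0 \<le> kelvin q l u y" "0 \<le> kelvin \<mu> l v y" for y
      using u_pos v_pos by (simp_all add: kelvin_def less_imp_le)
    have f: "0 \<le> f y" "f y \<le> u y" and g: "0 \<le> g y" "g y \<le> v y" for y
      using k0[of y] u_pos[of y] v_pos[of y] by (auto simp: f_def g_def indicator_def)
    have fg: "f y = max 0 (u y - kelvin q l u y)" "g y = max 0 (v y - kelvin \<mu> l v y)" if "y \<in> ball 0 l - {0}" for y
      using that by (auto simp: f_def g_def bad_set_def indicator_def)
    have fle: "ennreal (f x) \<le> (\<integral>\<^sup>+ y. ennreal ((p * (v y * u y powr (p - 1) * f y) + u y powr p * g y) * norm (x - y) powr - q) \<partial>lborel)" for x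
    proof (cases "x \<in> bad_set l \<and> kelvin q l u x < u x")
      case False
      then have "f x = 0" by (auto simp: f_def indicator_def)
      then show ?thesis by simp
    next
      case True
      then have x: "x \<in> ball 0 l - {0}" by (auto simp: bad_set_def)
      let ?k = "kelvin (2 * real CARD('n) - q) l (\<lambda>y. v y * u y powr p)"
      have "ennreal (u x) \<le> ennreal (kelvin q l u x) + (\<integral>\<^sup>+ y. ennreal (max 0 (v y * u y powr p - ?k y) * norm (x - y) powr - q) * indicator (ball 0 l) y \<partial>lborel)"
        by (rule U.w_le_kelvin_plus[OF l x])
      also have "(\<integral>\<^sup>+ y. ennreal (max 0 (v y * u y powr p - ?k y) * norm (x - y) powr - q) * indicator (ball 0 l) y \<partial>lborel)
        \<le> (\<integral>\<^sup>+ y. ennreal ((p * (v y * u y powr (p - 1) * f y) + u y powr p * g y) * norm (x - y) powr - q) \<partial>lborel)"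
      proof (rule nn_integral_mono_AE)
        have "max 0 (v y * u y powr p - ?k y) \<le> p * (v y * u y powr (p - 1) * f y) + u y powr p * g y"
          if y: "y \<in> ball 0 l" "y \<noteq> 0" for y
        proof -
          have "v y * u y powr p - ?k y \<le> p * (v y * u y powr (p - 1) * f y) + u y powr p * g y"
            using fg y l u_pos v_pos kelvin_u_pos kelvin_v_pos
            by (simp add: kelvin_u_source product_excess_le p_ge_1)
          moreover have "0 \<le> p * (v y * u y powr (p - 1) * f y) + u y powr p * g y"
            using f[of y] g[of y] u_pos[of y] v_pos[of y] p_ge_1 by auto
          ultimately show ?thesis by simp
        qed
        then show "AE y in lborel. ennreal (max 0 (v y * u y powr p - ?k y) * norm (x - y) powr - q) * indicator (ball 0 l) y
           \<le> ennreal ((p * (v y * u y powr (p - 1) * f y) + u y powr p * g y) * norm (x - y) powr - q)"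
          using AE_neq_lborel[of "0::real^'n"]
          by (auto simp: indicator_def intro!: ennreal_leI mult_right_mono elim!: eventually_mono)
      qed
      finally have "ennreal (u x) \<le> ennreal (kelvin q l u x) + \<dots>" by (simp add: add_left_mono)
      \<comment> \<open>The Kelvin term is finite, so it cancels in \<open>ennreal\<close> and
        leaves an inequality for the positive part.\<close>
      moreover have "ennreal (u x) = ennreal (kelvin q l u x) + ennreal (f x)"
        using True k0[of x] x by (simp add: fg flip: ennreal_plus)
      ultimately show ?thesis by (simp add: ennreal_add_left_cancel_le)
    qed
    have gle: "ennreal (g x) \<le> (\<integral>\<^sup>+ y. ennreal (((p + 1) * (u y powr p * f y)) * norm (x - y) powr - \<mu>) \<partial>lborel)" for x
    proof (cases "x \<in> bad_set l \<and> kelvin \<mu> l v x < v x")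
      case False
      then have "g x = 0" by (auto simp: g_def indicator_def)
      then show ?thesis by simp
    next
      case True
      then have x: "x \<in> ball 0 l - {0}" by (auto simp: bad_set_def)
      let ?k = "kelvin (2 * real CARD('n) - \<mu>) l (\<lambda>y. u y powr (p + 1))"
      have "ennreal (v x) \<le> ennreal (kelvin \<mu> l v x) + (\<integral>\<^sup>+ y. ennreal (max 0 (u y powr (p + 1) - ?k y) * norm (x - y) powr - \<mu>) * indicator (ball 0 l) y \<partial>lborel)"
        by (rule V.w_le_kelvin_plus[OF l x])
      also have "(\<integral>\<^sup>+ y. ennreal (max 0 (u y powr (p + 1) - ?k y) * norm (x - y) powr - \<mu>) * indicator (ball 0 l) y \<partial>lborel)
        \<le> (\<integral>\<^sup>+ y. ennreal (((p + 1) * (u y powr p * f y)) * norm (x - y) powr - \<mu>) \<partial>lborel)"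
      proof (rule nn_integral_mono_AE)
        have "max 0 (u y powr (p + 1) - ?k y) \<le> (p + 1) * (u y powr p * f y)"
          if y: "y \<in> ball 0 l" "y \<noteq> 0" for y
        proof -
          have k: "0 < kelvin q l u y" using y l by (intro kelvin_u_pos) auto
          have "u y powr (p + 1) - ?k y \<le> (p + 1) * (u y powr p * f y)"
          proof (cases "kelvin q l u y \<le> u y")
            case True
            have "u y powr (p + 1) - kelvin q l u y powr (p + 1) \<le> (p + 1) * u y powr ((p + 1) - 1) * (u y - kelvin q l u y)"
              using k True p_ge_1 by (intro powr_diff_le_tangent) auto
            then show ?thesis using True fg(1)[of y] y by (simp add: kelvin_v_source[OF l] mult.assoc)
          next
            case False
            then have "u y powr (p + 1) \<le> kelvin q l u y powr (p + 1)"
              using u_pos[of y] p_ge_1 by (intro powr_mono2) auto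
            then show ?thesis using False fg(1)[of y] y by (simp add: kelvin_v_source[OF l])
          qed
          moreover have "0 \<le> (p + 1) * (u y powr p * f y)"
            using f[of y] p_ge_1 by auto
          ultimately show ?thesis by simp
        qed
        then show "AE y in lborel. ennreal (max 0 (u y powr (p + 1) - ?k y) * norm (x - y) powr - \<mu>) * indicator (ball 0 l) y
           \<le> ennreal (((p + 1) * (u y powr p * f y)) * norm (x - y) powr - \<mu>)"
          using AE_neq_lborel[of "0::real^'n"]
          by (auto simp: indicator_def intro!: ennreal_leI mult_right_mono elim!: eventually_mono)
      qed
      finally have "ennreal (v x) \<le> ennreal (kelvin \<mu> l v x) + \<dots>" by (simp add: add_left_mono)
      moreover have "ennreal (v x) = ennreal (kelvin \<mu> l v x) + ennreal (g x)"
        using True k0[of x] x by (simp add: fg flip: ennreal_plus)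
      ultimately show ?thesis by (simp add: ennreal_add_left_cancel_le)
    qed
    have ae: "AE y in lborel. f y = 0 \<and> g y = 0"
      by (rule van[of "bad_set l" f g]) (use f g fle gle uS vS in \<open>auto simp: f_def g_def\<close>)
    \<comment> \<open>The comparison now holds almost everywhere, hence for the sources almost
      everywhere; the folded potentials then give it at every point of the punctured ball.\<close>
    have uae: "AE y in lborel. y \<in> ball 0 l \<longrightarrow> v y * u y powr p \<le> kelvin (2 * real CARD('n) - q) l (\<lambda>y. v y * u y powr p) y"
      using ae AE_neq_lborel[of "0::real^'n"]
    proof eventually_elim
      case (elim y)
      show ?case
      proof
        assume y: "y \<in> ball 0 l"
        have "u y \<le> kelvin q l u y" "v y \<le> kelvin \<mu> l v y" using elim fg[of y] y by auto
        then show "v y * u y powr p \<le> kelvin (2 * real CARD('n) - q) l (\<lambda>y. v y * u y powr p) y"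
          unfolding kelvin_u_source[OF l] using u_pos[of y] v_pos[of y] p_ge_1 by (intro mult_mono powr_mono2) auto
      qed
    qed
    have vae: "AE y in lborel. y \<in> ball 0 l \<longrightarrow> u y powr (p + 1) \<le> kelvin (2 * real CARD('n) - \<mu>) l (\<lambda>y. u y powr (p + 1)) y"
      using ae AE_neq_lborel[of "0::real^'n"]
    proof eventually_elim
      case (elim y)
      show ?case
      proof
        assume y: "y \<in> ball 0 l"
        have "u y \<le> kelvin q l u y" using elim fg[of y] y by auto
        then show "u y powr (p + 1) \<le> kelvin (2 * real CARD('n) - \<mu>) l (\<lambda>y. u y powr (p + 1)) y"
          unfolding kelvin_v_source[OF l] using u_pos[of y] p_ge_1 by (intro powr_mono2) auto
      qed
    qed
    show "good l"
      unfolding good_def using U.w_le_kelvin[OF l _ uae] V.w_le_kelvin[OF l _ vae] by blast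
  qed
  with e show ?thesis by blast
qed

text \<open>Dominated convergence. The common ball of radius \<open>R\<close> provides the
  dominating functions, so local integrability is enough.\<close>

lemma small_integrals:
  fixes S :: "nat \<Rightarrow> (real^'n) set"
  assumes S [measurable]: "\<And>n. S n \<in> sets borel" and sub: "\<And>n. S n \<subseteq> ball 0 R"
    and null: "AE y in lborel. eventually (\<lambda>n. y \<notin> S n) sequentially" and e: "e > 0"
  shows "\<exists>n. (\<integral>\<^sup>+ y. ennreal (u y powr \<alpha>) * indicator (S n) y \<partial>lborel) \<le> ennreal e \<and>
    (\<integral>\<^sup>+ y. ennreal (v y powr \<beta>) * indicator (S n) y \<partial>lborel) \<le> ennreal e"
proof -
  have lim: "(\<lambda>n. \<integral>\<^sup>+ y. ennreal (w y) * indicator (S n) y \<partial>lborel) \<longlonglongrightarrow> 0"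
    if [measurable]: "w \<in> borel_measurable borel" and fin: "(\<integral>\<^sup>+ y. ennreal (w y) * indicator (ball 0 R) y \<partial>lborel) < \<infinity>"
    for w :: "real^'n \<Rightarrow> real"
  proof -
    have "(\<lambda>n. \<integral>\<^sup>+ y. ennreal (w y) * indicator (S n) y \<partial>lborel) \<longlonglongrightarrow> (\<integral>\<^sup>+ (y::real^'n). 0 \<partial>lborel)"
    proof (rule nn_integral_dominated_convergence[where w="\<lambda>y. ennreal (w y) * indicator (ball 0 R) y"])
      show "AE y in lborel. ennreal (w y) * indicator (S n) y \<le> ennreal (w y) * indicator (ball 0 R) y" for n
        by (rule AE_I2) (use sub[of n] in \<open>auto simp: indicator_def\<close>)
      show "AE y in lborel. (\<lambda>n. ennreal (w y) * indicator (S n) y) \<longlonglongrightarrow> 0"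
        using null
      proof eventually_elim
        case (elim y)
        show ?case by (rule tendsto_eventually, rule eventually_mono[OF elim]) simp
      qed
    qed (use fin in auto)
    then show ?thesis by simp
  qed
  have "eventually (\<lambda>n. (\<integral>\<^sup>+ y. ennreal (u y powr \<alpha>) * indicator (S n) y \<partial>lborel) < ennreal e) sequentially"
    using e by (intro order_tendstoD(2)[OF lim] u_integrable) auto
  moreover have "eventually (\<lambda>n. (\<integral>\<^sup>+ y. ennreal (v y powr \<beta>) * indicator (S n) y \<partial>lborel) < ennreal e) sequentially"
    using e by (intro order_tendstoD(2)[OF lim] v_integrable) auto
  ultimately have "eventually (\<lambda>n. (\<integral>\<^sup>+ y. ennreal (u y powr \<alpha>) * indicator (S n) y \<partial>lborel) \<le> ennreal e \<and>
    (\<integral>\<^sup>+ y. ennreal (v y powr \<beta>) * indicator (S n) y \<partial>lborel) \<le> ennreal e) sequentially"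
    by eventually_elim auto
  then show ?thesis by (rule eventually_happens'[rotated]) simp
qed

lemma exists_good_if_bad_sets_vanish:
  fixes l :: "nat \<Rightarrow> real"
  assumes "\<And>n. 0 < l n" "\<And>n. l n \<le> R" "AE y in lborel. eventually (\<lambda>n. y \<notin> bad_set (l n)) sequentially"
  shows "\<exists>n. good (l n)"
proof -
  obtain e where e: "e > 0" "\<And>l. l > 0 \<Longrightarrow> (\<integral>\<^sup>+ y. ennreal (u y powr \<alpha>) * indicator (bad_set l) y \<partial>lborel) \<le> ennreal e \<Longrightarrow>
    (\<integral>\<^sup>+ y. ennreal (v y powr \<beta>) * indicator (bad_set l) y \<partial>lborel) \<le> ennreal e \<Longrightarrow> good l"
    using good_if_bad_set_small by blast
  have "bad_set (l n) \<subseteq> ball 0 R" for n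
    using assms(2)[of n] by (auto simp: bad_set_def)
  then obtain n where "(\<integral>\<^sup>+ y. ennreal (u y powr \<alpha>) * indicator (bad_set (l n)) y \<partial>lborel) \<le> ennreal e"
    "(\<integral>\<^sup>+ y. ennreal (v y powr \<beta>) * indicator (bad_set (l n)) y \<partial>lborel) \<le> ennreal e"
    using small_integrals[of "\<lambda>n. bad_set (l n)" R e, OF bad_set_measurable _ assms(3) e(1)] by blast
  then show ?thesis using e(2) assms(1) by blast
qed

text \<open>Bad sets lie in balls shrinking to the origin, so every other point eventually leaves
  them.\<close>

lemma good_small: "\<exists>l0>0. \<forall>l. 0 < l \<longrightarrow> l \<le> l0 \<longrightarrow> good l"
proof (rule ccontr)
  assume "\<not> ?thesis"
  then have "\<exists>l. 0 < l \<and> l \<le> 1 / real (Suc n) \<and> \<not> good l" for n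
    by (meson of_nat_0_less_iff zero_less_Suc zero_less_divide_1_iff)
  then obtain l where l: "\<And>n. 0 < l n" "\<And>n. l n \<le> 1 / real (Suc n)" "\<And>n. \<not> good (l n)" by metis
  have "l \<longlonglongrightarrow> 0"
    by (rule tendsto_sandwich[OF _ _ tendsto_const LIMSEQ_inverse_real_of_nat])
      (use l in \<open>auto simp: divide_inverse less_imp_le intro!: always_eventually\<close>)
  then have "eventually (\<lambda>n. y \<notin> bad_set (l n)) sequentially" if "y \<noteq> 0" for y
  proof -
    assume "l \<longlonglongrightarrow> 0"
    then have "eventually (\<lambda>n. l n < norm y) sequentially" using that by (intro order_tendstoD) auto
    then show ?thesis by eventually_elim (auto simp: bad_set_def)
  qed
  then have "AE y in lborel. eventually (\<lambda>n. y \<notin> bad_set (l n)) sequentially"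
    using AE_neq_lborel[of "0::real^'n"] by (auto elim: eventually_mono)
  moreover have "l n \<le> 1" for n using l(2)[of n] by (rule order_trans) simp
  ultimately show False using exists_good_if_bad_sets_vanish[of l 1] l by blast
qed

text \<open>The source of v depends on u alone. If it agrees almost everywhere with its transform,
  then v agrees everywhere and u almost everywhere, hence u everywhere through its own potential. If
  not, v is strictly smaller everywhere, which makes the source of u strictly smaller and so u as
  well.\<close>

lemma good_dichotomy:
  assumes l: "l > 0" and good: "good l"
  shows "(\<forall>y\<in>ball 0 l - {0}. u y = kelvin q l u y \<and> v y = kelvin \<mu> l v y) \<or>
    (\<forall>y\<in>ball 0 l - {0}. u y < kelvin q l u y \<and> v y < kelvin \<mu> l v y)"
proof -
  let ?f = "\<lambda>y. u y powr (p + 1)" and ?g = "\<lambda>y. v y * u y powr p"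
  have le: "u y \<le> kelvin q l u y" "v y \<le> kelvin \<mu> l v y" if "y \<in> ball 0 l - {0}" for y
    using good that by (auto simp: good_def)
  have vae: "AE y in lborel. y \<in> ball 0 l \<longrightarrow> ?f y \<le> kelvin (2 * real CARD('n) - \<mu>) l ?f y"
    using AE_neq_lborel[of "0::real^'n"]
  proof eventually_elim
    case (elim y)
    then show ?case
      unfolding kelvin_v_source[OF l] using le(1)[of y] u_pos[of y] p_ge_1 by (auto intro!: powr_mono2)
  qed
  have uae: "AE y in lborel. y \<in> ball 0 l \<longrightarrow> ?g y \<le> kelvin (2 * real CARD('n) - q) l ?g y"
    using AE_neq_lborel[of "0::real^'n"]
  proof eventually_elim
    case (elim y)
    then show ?case
      unfolding kelvin_u_source[OF l] using le[of y] u_pos[of y] v_pos[of y] p_ge_1 by (auto intro!: mult_mono powr_mono2)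
  qed
  show ?thesis
  proof (cases "AE y in lborel. y \<in> ball 0 l \<longrightarrow> ?f y = kelvin (2 * real CARD('n) - \<mu>) l ?f y")
    case True
    then have v: "v y = kelvin \<mu> l v y" if "y \<in> ball 0 l - {0}" for y
      using V.w_eq_kelvin[OF l that] by simp
    have "AE y in lborel. y \<in> ball 0 l \<longrightarrow> ?g y = kelvin (2 * real CARD('n) - q) l ?g y"
      using True AE_neq_lborel[of "0::real^'n"]
    proof eventually_elim
      case (elim y)
      show ?case
      proof
        assume y: "y \<in> ball 0 l"
        then have "u y powr (p + 1) = kelvin q l u y powr (p + 1)"
          using elim by (simp add: kelvin_v_source[OF l])
        then have "(u y powr (p + 1)) powr (1 / (p + 1)) = (kelvin q l u y powr (p + 1)) powr (1 / (p + 1))" by simp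
        then have "u y = kelvin q l u y"
          using p_ge_1 u_pos[of y] kelvin_u_pos[OF l, of y] elim by (simp add: powr_powr)
        then show "?g y = kelvin (2 * real CARD('n) - q) l ?g y"
          using v[of y] y elim by (simp add: kelvin_u_source[OF l])
      qed
    qed
    then have "u y = kelvin q l u y" if "y \<in> ball 0 l - {0}" for y
      using U.w_eq_kelvin[OF l that] by simp
    then show ?thesis using v by blast
  next
    case False
    then have v: "v y < kelvin \<mu> l v y" if "y \<in> ball 0 l - {0}" for y
      using V.w_less_kelvin[OF l that vae] by simp
    have gless: "?g y < kelvin (2 * real CARD('n) - q) l ?g y" if "y \<in> ball 0 l - {0}" for y
      unfolding kelvin_u_source[OF l] using v[OF that] le(1)[OF that] u_pos[of y] v_pos[of y] p_ge_1 kelvin_v_pos[OF l, of y] that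
      by (intro mult_less_le_imp_less powr_mono2) auto
    have "\<not> (AE y in lborel. y \<in> ball 0 l \<longrightarrow> ?g y = kelvin (2 * real CARD('n) - q) l ?g y)"
    proof
      assume "AE y in lborel. y \<in> ball 0 l \<longrightarrow> ?g y = kelvin (2 * real CARD('n) - q) l ?g y"
      then have "AE y in lborel. y \<notin> ball (0::real^'n) l"
        using AE_neq_lborel[of "0::real^'n"] by eventually_elim (use gless in force)
      then have "emeasure lborel (ball (0::real^'n) l) = 0"
        by (subst (asm) AE_iff_measurable[of "ball 0 l"]) auto
      then show False using l unit_ball_vol_pos[of "real CARD('n)"] by (simp add: emeasure_ball)
    qed
    then have "u y < kelvin q l u y" if "y \<in> ball 0 l - {0}" for y
      using U.w_less_kelvin[OF l that uae] by simp
    then show ?thesis using v by blast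
  qed
qed

text \<open>At each point of the punctured ball the strict inequality survives a small change of
  radius by semicontinuity, and points beyond the sphere are eventually outside the larger balls.
  Nothing uniform near the sphere is required, since the sphere is null and pointwise disappearance
  of the bad sets suffices.\<close>

lemma good_open:
  assumes l0: "l0 > 0" and strict: "\<forall>y\<in>ball 0 l0 - {0}. u y < kelvin q l0 u y \<and> v y < kelvin \<mu> l0 v y"
  shows "\<exists>e>0. \<forall>l. l0 < l \<longrightarrow> l \<le> l0 + e \<longrightarrow> good l"
proof (rule ccontr)
  assume "\<not> ?thesis"
  then have "\<exists>l. l0 < l \<and> l \<le> l0 + 1 / real (Suc n) \<and> \<not> good l" for n
    by (meson of_nat_0_less_iff zero_less_Suc zero_less_divide_1_iff)
  then obtain l where l: "\<And>n. l0 < l n" "\<And>n. l n \<le> l0 + 1 / real (Suc n)" "\<And>n. \<not> good (l n)" by metis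
  have lim: "l \<longlonglongrightarrow> l0"
    by (rule tendsto_sandwich[OF _ _ tendsto_const LIMSEQ_inverse_real_of_nat_add[of l0]])
      (use l in \<open>auto simp: divide_inverse less_imp_le intro!: always_eventually\<close>)
  have ev: "eventually (\<lambda>n. y \<notin> bad_set (l n)) sequentially" if "y \<noteq> 0" "y \<notin> sphere 0 l0" for y
  proof (cases "norm y < l0")
    case True
    have "eventually (\<lambda>n. u y < kelvin q (l n) u y) sequentially"
      using strict that True by (intro eventually_kelvin_greater[OF u_lsc u_pos lim l0]) auto
    moreover have "eventually (\<lambda>n. v y < kelvin \<mu> (l n) v y) sequentially"
      using strict that True by (intro eventually_kelvin_greater[OF v_lsc v_pos lim l0]) auto
    ultimately show ?thesis by eventually_elim (auto simp: bad_set_def)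
  next
    case False
    then have "eventually (\<lambda>n. l n < norm y) sequentially" using that by (intro order_tendstoD[OF lim]) auto
    then show ?thesis by eventually_elim (auto simp: bad_set_def)
  qed
  have "AE y in lborel. (y::real^'n) \<notin> sphere 0 l0" by (rule AE_notin_sphere)
  then have "AE y in lborel. eventually (\<lambda>n. y \<notin> bad_set (l n)) sequentially"
    using AE_neq_lborel[of "0::real^'n"] by eventually_elim (rule ev)
  moreover have "l n \<le> l0 + 1" for n
  proof -
    have "1 / real (Suc n) \<le> 1" by simp
    with l(2)[of n] show ?thesis by linarith
  qed
  moreover have "0 < l n" for n using l(1)[of n] l0 by linarith
  ultimately show False using exists_good_if_bad_sets_vanish[of l "l0 + 1"] l by blast
qed

text \<open>Inversion exchanges the punctured ball with the exterior, and
  \<open>kelvin_le_iff\<close> reverses both inequalities.\<close>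

lemma good_iff_outside:
  assumes l: "l > 0"
  shows "good l \<longleftrightarrow> (\<forall>x. l < norm x \<longrightarrow> kelvin q l u x \<le> u x \<and> kelvin \<mu> l v x \<le> v x)"
proof
  assume g: "good l"
  show "\<forall>x. l < norm x \<longrightarrow> kelvin q l u x \<le> u x \<and> kelvin \<mu> l v x \<le> v x"
  proof (intro allI impI)
    fix x :: "real^'n" assume x: "l < norm x"
    then have x0: "x \<noteq> 0" using l by auto
    have "inversion l x \<in> ball 0 l - {0}" using x x0 l by (auto simp: norm_inversion power2_eq_square field_simps)
    then show "kelvin q l u x \<le> u x \<and> kelvin \<mu> l v x \<le> v x"
      using g x0 l by (auto simp: kelvin_le_iff good_def)
  qed
next
  assume *: "\<forall>x. l < norm x \<longrightarrow> kelvin q l u x \<le> u x \<and> kelvin \<mu> l v x \<le> v x"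
  show "good l" unfolding good_def
  proof
    fix y :: "real^'n" assume y: "y \<in> ball 0 l - {0}"
    have "l < norm (inversion l y)" "inversion l y \<noteq> 0" using y l by (auto simp: norm_inversion power2_eq_square field_simps)
    then show "u y \<le> kelvin q l u y \<and> v y \<le> kelvin \<mu> l v y"
      using * kelvin_le_iff[OF l, of "inversion l y"] y l by (auto simp: inversion_inversion)
  qed
qed

text \<open>Lower semicontinuity gives the right inequality in the limit only for the form of \<^const>\<open>good\<close>
  outside the ball.\<close>
lemma good_closed:
  assumes "\<And>n. good (l n)" "\<And>n. 0 < l n" and lim: "l \<longlonglongrightarrow> l0" and l0: "l0 > 0"
  shows "good l0"
  unfolding good_iff_outside[OF l0]
proof (intro allI impI)
  fix x :: "real^'n" assume x: "l0 < norm x"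
  then have x0: "x \<noteq> 0" using l0 by auto
  have ev: "eventually (\<lambda>n. l n < norm x) sequentially" using x by (intro order_tendstoD[OF lim])
  have "kelvin q l0 u x \<le> u x"
  proof (rule ccontr)
    assume "\<not> ?thesis"
    then have "eventually (\<lambda>n. u x < kelvin q (l n) u x) sequentially"
      by (intro eventually_kelvin_greater[OF u_lsc u_pos lim l0 x0]) auto
    with ev have "eventually (\<lambda>n. False) sequentially"
      by eventually_elim (use assms good_iff_outside in \<open>force\<close>)
    then show False by simp
  qed
  moreover have "kelvin \<mu> l0 v x \<le> v x"
  proof (rule ccontr)
    assume "\<not> ?thesis"
    then have "eventually (\<lambda>n. v x < kelvin \<mu> (l n) v x) sequentially"
      by (intro eventually_kelvin_greater[OF v_lsc v_pos lim l0 x0]) auto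
    with ev have "eventually (\<lambda>n. False) sequentially"
      by eventually_elim (use assms good_iff_outside in \<open>force\<close>)
    then show False by simp
  qed
  ultimately show "kelvin q l0 u x \<le> u x \<and> kelvin \<mu> l0 v x \<le> v x" ..
qed

theorem moving_spheres:
  "(\<forall>l>0. good l) \<or> (\<exists>l>0. \<forall>y. y \<noteq> 0 \<longrightarrow> u y = kelvin q l u y \<and> v y = kelvin \<mu> l v y)"
proof (rule disjCI)
  assume "\<not> (\<exists>l>0. \<forall>y. y \<noteq> 0 \<longrightarrow> u y = kelvin q l u y \<and> v y = kelvin \<mu> l v y)"
  then have no_eq: "\<And>l. l > 0 \<Longrightarrow> \<exists>y. y \<noteq> 0 \<and> \<not> (u y = kelvin q l u y \<and> v y = kelvin \<mu> l v y)" by blast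
  have strict: "\<forall>y\<in>ball 0 l - {0}. u y < kelvin q l u y \<and> v y < kelvin \<mu> l v y" if l: "l > 0" and g: "good l" for l
  proof (rule ccontr)
    assume "\<not> ?thesis"
    then have eq: "\<And>y. y \<in> ball 0 l - {0} \<Longrightarrow> u y = kelvin q l u y \<and> v y = kelvin \<mu> l v y"
      using good_dichotomy[OF l g] by blast
    have "u y = kelvin q l u y \<and> v y = kelvin \<mu> l v y" if y: "y \<noteq> 0" for y
    proof -
      \<comment> \<open>Equality in the ball spreads to the whole space: the inversion fixes the
        sphere, and exterior points are covered because the Kelvin transform is an
        involution.\<close>
      consider "norm y < l" | "norm y = l" | "l < norm y" by linarith
      then show ?thesis
      proof cases
        case 2
        then have "inversion l y = y" using l by (simp add: inversion_def)
        then show ?thesis using 2 l by (simp add: kelvin_def)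
      next
        case 3
        let ?y = "inversion l y"
        have "?y \<in> ball 0 l - {0}" using 3 y l by (auto simp: norm_inversion power2_eq_square field_simps)
        then have e: "u ?y = kelvin q l u ?y" "v ?y = kelvin \<mu> l v ?y" using eq by blast+
        have "kelvin q l u y = (l / norm y) powr q * kelvin q l u ?y" using e by (simp add: kelvin_def)
        also have "\<dots> = kelvin q l (kelvin q l u) y" by (simp add: kelvin_def)
        finally have 1: "kelvin q l u y = u y" using kelvin_kelvin[OF l y] by simp
        have "kelvin \<mu> l v y = (l / norm y) powr \<mu> * kelvin \<mu> l v ?y" using e by (simp add: kelvin_def)
        also have "\<dots> = kelvin \<mu> l (kelvin \<mu> l v) y" by (simp add: kelvin_def)
        finally have 2: "kelvin \<mu> l v y = v y" using kelvin_kelvin[OF l y] by simp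
        show ?thesis using 1 2 by simp
      qed (use eq y in auto)
    qed
    then show False using no_eq[OF l] by blast
  qed
  show "\<forall>l>0. good l"
  proof (rule ccontr)
    assume "\<not> ?thesis"
    then obtain b where b: "b > 0" "\<not> good b" by blast
    \<comment> \<open>Requiring all smaller radii to be good makes \<open>A\<close> an initial
      segment, so every radius below its supremum is good.\<close>
    define A where "A = {l. 0 < l \<and> (\<forall>l'. 0 < l' \<longrightarrow> l' \<le> l \<longrightarrow> good l')}"
    obtain l0 where l0: "l0 > 0" "\<And>l. 0 < l \<Longrightarrow> l \<le> l0 \<Longrightarrow> good l" using good_small by blast
    have A: "l0 \<in> A" using l0 by (auto simp: A_def)
    have bdd: "bdd_above A" using b by (intro bdd_aboveI[of _ b]) (force simp: A_def)
    define L where "L = Sup A"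
    have L: "l0 \<le> L" unfolding L_def by (rule cSup_upper[OF A bdd])
    have below: "good l" if l: "0 < l" "l < L" for l
    proof -
      obtain a where "a \<in> A" "l < a" using less_cSup_iff[of A l] A bdd l unfolding L_def by blast
      then show ?thesis using l by (auto simp: A_def)
    qed
    have L0: "L > 0" using L l0 by linarith
    have gL: "good L"
    \<comment> \<open>The offset 2 keeps every radius positive; with 1 the first one would be
      0.\<close>
    proof (rule good_closed[where l="\<lambda>n. L - L / (real n + 2)"])
      show pos: "0 < L - L / (real n + 2)" for n
        using L0 by (simp add: divide_less_eq)
      show "good (L - L / (real n + 2))" for n
        using L0 pos[of n] by (intro below) auto
      have "(\<lambda>n. L / (real n + 2)) \<longlonglongrightarrow> 0"
        by (intro tendsto_divide_0[OF tendsto_const] filterlim_at_top_imp_at_infinity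
            filterlim_tendsto_add_at_top[OF tendsto_const filterlim_real_sequentially, of 2, simplified add.commute])
      from tendsto_diff[OF tendsto_const[of L] this]
      show "(\<lambda>n. L - L / (real n + 2)) \<longlonglongrightarrow> L" by simp
    qed fact
    obtain e where e: "e > 0" "\<And>l. L < l \<Longrightarrow> l \<le> L + e \<Longrightarrow> good l"
      using good_open[OF L0 strict[OF L0 gL]] by blast
    have "L + e \<in> A"
      unfolding A_def using L0 e below gL
      by (auto) (metis linorder_less_linear)
    then have "L + e \<le> L" unfolding L_def by (rule cSup_upper[OF _ bdd])
    then show False using e by simp
  qed
qed

end

section \<open>Symmetry about every centre\<close>

text \<open>If \<open>w\<close> were unbounded on every ball in \<open>W\<close>, the open sets
  where \<open>w\<close> exceeds n would be dense there, and a point common to all of them would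
  have an infinite value.\<close>

lemma lsc_locally_bounded_dense:
  fixes w :: "'a::euclidean_space \<Rightarrow> real"
  assumes lsc: "\<And>a. open {x. a < w x}" and W: "open W" "W \<noteq> {}"
  shows "\<exists>x\<in>W. \<exists>r>0. \<exists>M. \<forall>y\<in>ball x r. w y \<le> M"
proof (rule ccontr)
  assume no: "\<not> ?thesis"
  obtain x0 where x0: "x0 \<in> W" using W by blast
  then obtain e where e: "e > 0" "ball x0 e \<subseteq> W" using W openE by blast
  let ?V = "ball x0 e"
  \<comment> \<open>Baire's theorem is applied in the whole space; the added exterior of
    \<open>?V\<close> makes \<open>T n\<close> dense everywhere without affecting points of
    \<open>?V\<close>.\<close>
  define T where "T n = {x. real n < w x} \<union> - closure ?V" for n :: nat
  have open_T: "open (T n)" for n unfolding T_def by (intro open_Un lsc open_Compl closed_closure)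
  have dense: "closure (T n) = UNIV" for n
  proof (rule ccontr)
    assume "closure (T n) \<noteq> UNIV"
    then have ne: "- closure (T n) \<noteq> {}" by auto
    have "- closure (T n) \<subseteq> closure ?V" using closure_subset[of "T n"] by (auto simp: T_def)
    then have "- closure (T n) \<inter> ?V \<noteq> {}"
      using ne open_Int_closure_eq_empty[of "- closure (T n)" ?V] by auto
    then obtain x where x: "x \<in> - closure (T n)" "x \<in> ?V" by blast
    have "open (- closure (T n))" by auto
    then obtain r where r: "r > 0" "ball x r \<subseteq> - closure (T n)" using x openE by blast
    have "w y \<le> real n" if "y \<in> ball x r" for y
      using r that closure_subset[of "T n"] by (force simp: T_def)
    then show False using no r x e by blast
  qed
  have "UNIV \<subseteq> closure (\<Inter>(range T))"
    by (rule Baire) (use open_T dense in auto)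
  then have "x0 \<in> closure (\<Inter>(range T))" by blast
  then obtain x where "x \<in> \<Inter>(range T)" "dist x x0 < e"
    using e(1) unfolding closure_approachable by blast
  then have x: "x \<in> ?V" "\<And>n. x \<in> T n" by (auto simp: dist_commute)
  have "x \<in> closure ?V" using x(1) closure_subset by blast
  then have "real n < w x" for n using x(2)[of n] by (auto simp: T_def)
  then show False using reals_Archimedean2[of "w x"] by (metis less_asym)
qed

text \<open>Two inversions are combined. Boundedness near one centre \<open>c0\<close> gives decay
  of order |x|^(-s) at infinity, and the symmetry about \<open>c\<close> carries a neighbourhood of
  infinity to one of \<open>c\<close>; the two powers cancel and leave the factor (2 l0 /
  l)^s.\<close>

lemma inversion_symmetric_locally_bounded:
  fixes w :: "'a::euclidean_space \<Rightarrow> real"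
  assumes lsc: "\<And>a. open {x. a < w x}" and pos: "\<And>x. 0 < w x" and s: "s > 0"
    and sym: "\<And>c. \<exists>l>0. \<forall>x. x \<noteq> c \<longrightarrow> w x = (l / norm (x - c)) powr s * w (c + inversion l (x - c))"
  shows "\<exists>r>0. \<exists>M. \<forall>x\<in>ball c r. w x \<le> M"
proof -
  obtain c0 r M where c0: "r > 0" "\<And>y. y \<in> ball c0 r \<Longrightarrow> w y \<le> M"
    using lsc_locally_bounded_dense[OF lsc open_UNIV UNIV_not_empty] by blast
  have M: "M > 0" using c0(2)[of c0] pos[of c0] c0(1) by auto
  obtain l0 where l0: "l0 > 0" "\<And>x. x \<noteq> c0 \<Longrightarrow> w x = (l0 / norm (x - c0)) powr s * w (c0 + inversion l0 (x - c0))"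
    using sym by blast
  have far: "w x \<le> (l0 / norm (x - c0)) powr s * M" if "norm (x - c0) > l0\<^sup>2 / r" for x
  proof -
    have pos': "norm (x - c0) > 0" using that c0 by (meson divide_nonneg_pos le_less_trans zero_le_power2)
    then have "norm (inversion l0 (x - c0)) < r" using that c0 by (simp add: norm_inversion field_simps)
    then have "w (c0 + inversion l0 (x - c0)) \<le> M" by (intro c0) (simp add: dist_norm)
    moreover have "x \<noteq> c0" using pos' by auto
    ultimately show ?thesis using l0(2)[of x] by (simp add: mult_left_mono)
  qed
  obtain l where l: "l > 0" "\<And>x. x \<noteq> c \<Longrightarrow> w x = (l / norm (x - c)) powr s * w (c + inversion l (x - c))"
    using sym by blast
  \<comment> \<open>Beyond \<open>R\<close> the distances to \<open>c\<close> and \<open>c0\<close>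
    are comparable up to the factor 2, and the decay estimate about \<open>c0\<close>
    applies.\<close>
  define R where "R = 2 * norm (c - c0) + 2 * (l0\<^sup>2 / r) + 1"
  have R: "R > 0" "R > 2 * norm (c - c0)" "R > 2 * (l0\<^sup>2 / r)"
  proof -
    have "0 \<le> l0\<^sup>2 / r" "0 \<le> norm (c - c0)" using c0 by auto
    then show "R > 0" "R > 2 * norm (c - c0)" "R > 2 * (l0\<^sup>2 / r)" unfolding R_def by linarith+
  qed
  have "w x \<le> max (w c) ((2 * l0 / l) powr s * M)" if x: "x \<in> ball c (l\<^sup>2 / R)" for x
  proof (cases "x = c")
    case False
    let ?n = "norm (x - c)"
    let ?y = "inversion l (x - c)"
    have n: "?n > 0" using False by simp
    have "?n < l\<^sup>2 / R" using x by (simp add: dist_norm norm_minus_commute)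
    then have big: "R < norm ?y" using n R by (simp add: norm_inversion field_simps)
    have "norm ?y \<le> norm (c + ?y - c0) + norm (c - c0)"
      using norm_triangle_ineq4[of "c + ?y - c0" "c - c0"] by (simp add: algebra_simps)
    then have half: "norm ?y / 2 \<le> norm (c + ?y - c0)" using big R by linarith
    then have "l0\<^sup>2 / r < norm (c + ?y - c0)" using big R by linarith
    then have "w (c + ?y) \<le> (l0 / norm (c + ?y - c0)) powr s * M" by (rule far)
    also have "\<dots> \<le> (l0 / (norm ?y / 2)) powr s * M"
    proof -
      have "l0 / norm (c + ?y - c0) \<le> l0 / (norm ?y / 2)"
        using half big R l0 by (intro divide_left_mono mult_pos_pos) auto
      then show ?thesis using l0 s M by (intro mult_right_mono powr_mono2) auto
    qed
    finally have "w x \<le> (l / ?n) powr s * ((l0 / (norm ?y / 2)) powr s * M)"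
      using l(2)[OF False] by (simp add: mult_left_mono)
    also have "\<dots> = ((l / ?n) * (l0 / (norm ?y / 2))) powr s * M"
      by (simp only: powr_mult mult.assoc)
    also have "(l / ?n) * (l0 / (norm ?y / 2)) = 2 * l0 / l"
      using n l by (simp add: norm_inversion field_simps power2_eq_square)
    finally show ?thesis by simp
  qed simp
  moreover have "l\<^sup>2 / R > 0" using R l by simp
  ultimately show ?thesis by blast
qed

section \<open>The two alternatives, centre by centre\<close>

locale hartree_translates =
  fixes u v :: "real^'n::finite \<Rightarrow> real" and \<mu> p q \<alpha> \<beta> :: real
  assumes translate: "\<And>c. hartree_system (\<lambda>x. u (c + x)) (\<lambda>x. v (c + x)) \<mu> p q \<alpha> \<beta>"
begin

sublocale hartree_system u v \<mu> p q \<alpha> \<beta>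
  using translate[of 0] by simp

text \<open>The exterior form of the comparison, for u only: the growth argument at infinity needs
  nothing else, and this form is stable under limits of centres.\<close>

definition dominating :: "real^'n \<Rightarrow> bool" where
  "dominating c \<longleftrightarrow> (\<forall>l>0. \<forall>x. l < norm (x - c) \<longrightarrow> (l / norm (x - c)) powr q * u (c + inversion l (x - c)) \<le> u x)"

definition symmetric_about :: "real^'n \<Rightarrow> real \<Rightarrow> bool" where
  "symmetric_about c l \<longleftrightarrow> (\<forall>x. x \<noteq> c \<longrightarrow> u x = (l / norm (x - c)) powr q * u (c + inversion l (x - c)) \<and>
     v x = (l / norm (x - c)) powr \<mu> * v (c + inversion l (x - c)))"

lemma dominating_or_symmetric: "dominating c \<or> (\<exists>l>0. symmetric_about c l)"
proof -
  interpret T: hartree_system "\<lambda>x. u (c + x)" "\<lambda>x. v (c + x)" \<mu> p q \<alpha> \<beta>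
    by (rule translate)
  from T.moving_spheres show ?thesis
  proof
    assume g: "\<forall>l>0. T.good l"
    have "dominating c" unfolding dominating_def
    proof (intro allI impI)
      fix l x assume l: "0 < l" "l < norm (x - c)"
      then have "kelvin q l (\<lambda>x. u (c + x)) (x - c) \<le> u (c + (x - c))"
        using g T.good_iff_outside[of l] by blast
      then show "(l / norm (x - c)) powr q * u (c + inversion l (x - c)) \<le> u x"
        by (simp add: kelvin_def)
    qed
    then show ?thesis ..
  next
    assume "\<exists>l>0. \<forall>y. y \<noteq> 0 \<longrightarrow> u (c + y) = kelvin q l (\<lambda>x. u (c + x)) y \<and> v (c + y) = kelvin \<mu> l (\<lambda>x. v (c + x)) y"
    then obtain l where l: "l > 0" "\<And>y. y \<noteq> 0 \<Longrightarrow> u (c + y) = kelvin q l (\<lambda>x. u (c + x)) y"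
      "\<And>y. y \<noteq> 0 \<Longrightarrow> v (c + y) = kelvin \<mu> l (\<lambda>x. v (c + x)) y" by blast
    have "symmetric_about c l" unfolding symmetric_about_def
      using l(2)[of "_ - c"] l(3)[of "_ - c"] by (auto simp: kelvin_def)
    then show ?thesis using l(1) by blast
  qed
qed

lemma dominating_excludes_symmetric:
  assumes dom: "dominating c" and r: "r > 0" and bd: "\<And>y. y \<in> ball c1 r \<Longrightarrow> u y \<le> M" and l1: "l1 > 0"
  shows "\<not> symmetric_about c1 l1"
proof
  assume sym: "symmetric_about c1 l1"
  have M: "M > 0" using bd[of c1] u_pos[of c1] r by auto
  define m where "m = u c / 2"
  have m: "m > 0" "m < u c" using u_pos[of c] by (auto simp: m_def)
  obtain d where d: "d > 0" "ball c d \<subseteq> {x. m < u x}"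
    using openE[OF u_lsc[of m], of c] m by auto
  \<comment> \<open>Domination gives (l/R)^q m as a lower bound for u at distance R, symmetry gives
    (2 l1/R)^q M as an upper bound. With l = 2 k they contradict each other once k^q m exceeds l1^q
    M; the 1 makes the excess strict.\<close>
  define k where "k = ((l1 powr q * M + 1) / m) powr (1 / q)"
  have k1: "l1 powr q * M + 1 > 0" using M by (intro add_nonneg_pos) auto
  then have k: "k > 0" using m by (auto simp: k_def)
  have kq: "k powr q * m = l1 powr q * M + 1"
    using m k1 q_pos by (simp add: k_def powr_powr)
  define l where "l = 2 * k"
  have l: "l > 0" using k by (simp add: l_def)
  \<comment> \<open>The summands put \<open>x\<close> outside the sphere of radius \<open>l\<close>,
    place its two inverse points in the balls about \<open>c\<close> and \<open>c1\<close>, and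
    ensure |x - c1| >= R/2.\<close>
  define R where "R = 1 + l + l\<^sup>2 / d + 2 * norm (c - c1) + 2 * l1\<^sup>2 / r"
  have R: "R > l" "R > l\<^sup>2 / d" "R \<ge> 2 * norm (c - c1)" "R > 2 * l1\<^sup>2 / r" "R > 0"
  proof -
    have "0 \<le> l\<^sup>2 / d" "0 \<le> norm (c - c1)" "0 \<le> 2 * l1\<^sup>2 / r" using d r by auto
    then show "R > l" "R > l\<^sup>2 / d" "R \<ge> 2 * norm (c - c1)" "R > 2 * l1\<^sup>2 / r" "R > 0"
      using l unfolding R_def by linarith+
  qed
  obtain b :: "real^'n" where b: "norm b = 1" using vector_choose_size[of 1] by auto
  define x where "x = c + R *\<^sub>R b"
  have nx: "norm (x - c) = R" using R b by (simp add: x_def)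
  have nx1: "R / 2 \<le> norm (x - c1)"
  proof -
    have "norm (x - c) \<le> norm (x - c1) + norm (c - c1)"
      using norm_triangle_ineq4[of "x - c1" "c - c1"] by simp
    then show ?thesis using nx R by linarith
  qed
  have npos: "0 < norm (x - c1)" using nx1 R by linarith
  then have x1: "x \<noteq> c1" by auto
  have "norm (inversion l1 (x - c1)) < r"
  proof -
    have "l1\<^sup>2 / norm (x - c1) \<le> l1\<^sup>2 / (R / 2)"
      using nx1 R npos by (intro divide_left_mono mult_pos_pos) auto
    also have "\<dots> < r" using R r by (simp add: field_simps)
    finally show ?thesis by (simp add: norm_inversion)
  qed
  then have "u (c1 + inversion l1 (x - c1)) \<le> M" by (intro bd) (simp add: dist_norm)
  then have up: "u x \<le> (l1 / norm (x - c1)) powr q * M"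
    using sym x1 unfolding symmetric_about_def by (metis mult_left_mono powr_ge_zero)
  have "norm (inversion l (x - c)) < d"
    using R d by (simp add: norm_inversion nx field_simps)
  then have "c + inversion l (x - c) \<in> ball c d" by (simp add: dist_norm)
  then have "m < u (c + inversion l (x - c))" using d by blast
  then have "(l / norm (x - c)) powr q * m \<le> (l / norm (x - c)) powr q * u (c + inversion l (x - c))"
    by (intro mult_left_mono) auto
  also have "\<dots> \<le> u x" using dom l R nx unfolding dominating_def by auto
  also have "\<dots> \<le> (l1 / norm (x - c1)) powr q * M" by (rule up)
  also have "\<dots> \<le> (l1 / (R / 2)) powr q * M"
    using nx1 R npos l1 M q_pos by (intro mult_right_mono powr_mono2 divide_left_mono mult_pos_pos) auto
  finally have "(l / R) powr q * m \<le> (l1 / (R / 2)) powr q * M" unfolding nx .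
  moreover have "(l / R) powr q = k powr q * (2 / R) powr q" "(l1 / (R / 2)) powr q = l1 powr q * (2 / R) powr q"
    by (simp_all add: l_def flip: powr_mult) (simp_all add: mult.commute)
  ultimately have "(2 / R) powr q * (k powr q * m) \<le> (2 / R) powr q * (l1 powr q * M)"
    by (simp add: mult_ac)
  then have "k powr q * m \<le> l1 powr q * M" using R by simp
  then show False using kq by simp
qed

text \<open>Letting the centre tend to infinity along the line through \<open>y\<close> and \<open>z\<close> gives \<open>u z \<le> u y\<close>.\<close>
lemma not_all_dominating: "\<exists>c. \<not> dominating c"
proof (rule ccontr)
  assume "\<not> ?thesis"
  then have dom: "dominating c" for c by blast
  have le: "u z \<le> u y" if "y \<noteq> z" for y z
  proof -
    let ?t = "\<lambda>n. real (Suc n)"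
    have "(sqrt (?t n / (1 + ?t n))) powr q * u z \<le> u y" for n
    proof -
      define t where "t = ?t n"
      have t: "t > 0" by (simp add: t_def)
      define d where "d = norm (z - y)"
      have d: "d > 0" using that by (simp add: d_def)
      define c where "c = z + t *\<^sub>R (z - y)"
      \<comment> \<open>Here |y - c| = (1 + t) d and |z - c| = t d, and l^2 is their product, so the
        inversion takes \<open>y\<close> to \<open>z\<close>. The ratio l/|y - c| tends to 1 as
        \<open>t\<close> grows.\<close>
      define l where "l = sqrt (t * (1 + t)) * d"
      have yc: "y - c = (- (1 + t)) *\<^sub>R (z - y)" by (simp add: c_def algebra_simps)
      have nyc: "norm (y - c) = (1 + t) * d" unfolding yc using t by (simp add: d_def)
      have l: "l > 0" using t d by (simp add: l_def)
      have lq: "l / norm (y - c) = sqrt (t / (1 + t))"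
      proof -
        have "sqrt (t * (1 + t)) / (1 + t) = sqrt (t / (1 + t))"
        proof -
          have "t / (1 + t) = t * (1 + t) / (1 + t)\<^sup>2"
            using t by (simp add: power2_eq_square)
          then show ?thesis using t by (simp add: real_sqrt_divide)
        qed
        then show ?thesis using d unfolding nyc l_def by simp
      qed
      have "l < norm (y - c)"
      proof -
        have "sqrt (t / (1 + t)) < 1" using t by simp
        moreover have "norm (y - c) > 0" using nyc t d by simp
        ultimately show ?thesis using lq by (metis divide_less_eq_1_pos)
      qed
      moreover have "c + inversion l (y - c) = z"
      proof -
        have "l\<^sup>2 / (norm (y - c))\<^sup>2 * (1 + t) = t"
          unfolding power_divide[symmetric] lq using t by simp
        moreover have "inversion l (y - c) = (- (l\<^sup>2 / (norm (y - c))\<^sup>2 * (1 + t))) *\<^sub>R (z - y)"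
          unfolding inversion_def by (subst (2) yc) (simp only: scaleR_scaleR mult_minus_right)
        ultimately have "inversion l (y - c) = (- t) *\<^sub>R (z - y)" by simp
        then show ?thesis by (simp add: c_def)
      qed
      ultimately show ?thesis
        using dom[of c] l lq unfolding dominating_def t_def by metis
    qed
    moreover have "(\<lambda>n. (sqrt (?t n / (1 + ?t n))) powr q * u z) \<longlonglongrightarrow> (sqrt 1) powr q * u z"
    proof -
      have "(\<lambda>n. real (Suc n) / real (Suc (Suc n))) \<longlonglongrightarrow> 1"
        using LIMSEQ_Suc[OF LIMSEQ_n_over_Suc_n] by simp
      then have "(\<lambda>n. ?t n / (1 + ?t n)) \<longlonglongrightarrow> 1" by simp
      then show ?thesis by (intro tendsto_intros) auto
    qed
    ultimately show ?thesis by (simp add: LIMSEQ_le_const2)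
  qed
  define k where "k = u 0"
  have uk: "u y = k" for y using le[of y 0] le[of 0 y] by (cases "y = 0") (auto simp: k_def)
  have k: "k > 0" using u_pos by (simp add: k_def)
  define V where "V = unit_ball_vol (real CARD('n))"
  have V: "V > 0" by (simp add: V_def)
  \<comment> \<open>For constant u, the part of the integral for v(0) over a ball of radius R is at
    least a multiple of R^(N-\<mu>), which is unbounded since \<mu> < N.\<close>
  have bound: "k powr (p + 1) * V * R powr (real CARD('n) - \<mu>) \<le> v 0" if R: "R > 0" for R
  proof -
    have "ennreal (k powr (p + 1) * V * R powr (real CARD('n) - \<mu>)) = ennreal (k powr (p + 1) * R powr - \<mu>) * emeasure lborel (ball (0::real^'n) R)"
    proof -
      have "R powr (real CARD('n) - \<mu>) = R powr - \<mu> * R ^ CARD('n)"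
        using R by (simp add: powr_diff powr_minus powr_realpow field_simps)
      then show ?thesis using R V by (simp add: emeasure_ball V_def ennreal_mult[symmetric] mult_ac)
    qed
    also have "\<dots> = (\<integral>\<^sup>+ y. ennreal (k powr (p + 1) * R powr - \<mu>) * indicator (ball (0::real^'n) R) y \<partial>lborel)"
      by (simp add: nn_integral_cmult_indicator)
    also have "\<dots> \<le> (\<integral>\<^sup>+ y. ennreal (u y powr (p + 1) * norm (0 - y) powr - \<mu>) \<partial>lborel)"
    proof (rule nn_integral_mono_AE)
      show "AE y in lborel. ennreal (k powr (p + 1) * R powr - \<mu>) * indicator (ball (0::real^'n) R) y
          \<le> ennreal (u y powr (p + 1) * norm (0 - y) powr - \<mu>)"
        using AE_neq_lborel[of "0::real^'n"]
        by eventually_elim (use mu(1) in \<open>auto simp: uk indicator_def intro!: ennreal_leI mult_left_mono powr_mono2'\<close>)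
    qed
    also have "\<dots> = ennreal (v 0)" by (rule v_riesz[symmetric])
    finally show ?thesis using v_pos[of 0] by simp
  qed
  define C where "C = k powr (p + 1) * V"
  have C: "C > 0" using k V by (simp add: C_def)
  define R where "R = ((v 0 + 1) / C) powr (1 / (real CARD('n) - \<mu>))"
  have base: "(v 0 + 1) / C > 0" using C v_pos[of 0] by simp
  then have R: "R > 0" unfolding R_def powr_gt_zero by (metis less_irrefl)
  have "C * R powr (real CARD('n) - \<mu>) = v 0 + 1"
    using C base mu v_pos[of 0] by (simp add: R_def powr_powr)
  then show False
    using bound[OF R] by (simp add: C_def)
qed

text \<open>With \<open>l\<close> and \<open>x\<close> fixed, a violation at \<open>c\<close> is a
  strict lower bound for u at the inverse point. By semicontinuity it persists for nearby centres,
  so the centres that are not dominating form an open set.\<close>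

lemma dominating_closed:
  assumes dense: "\<And>W. open W \<Longrightarrow> W \<noteq> {} \<Longrightarrow> \<exists>c\<in>W. dominating c"
  shows "dominating c"
  unfolding dominating_def
proof (intro allI impI, rule ccontr)
  fix l x assume l: "0 < l" "l < norm (x - c)"
    and "\<not> (l / norm (x - c)) powr q * u (c + inversion l (x - c)) \<le> u x"
  then have less: "u x < (l / norm (x - c)) powr q * u (c + inversion l (x - c))" by simp
  have xc: "x \<noteq> c" using l by auto
  let ?m = "(l / norm (x - c)) powr q"
  have m: "?m > 0" using l xc by auto
  have "u x / ?m < u (c + inversion l (x - c))" using less m by (simp add: field_simps)
  then obtain b where b: "u x / ?m < b" "b < u (c + inversion l (x - c))" using dense_order_class.dense by blast
  have lim: "((\<lambda>c. c) \<longlongrightarrow> c) (nhds c)" by (simp add: filterlim_def)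
  have "((\<lambda>c. c + inversion l (x - c)) \<longlongrightarrow> c + inversion l (x - c)) (nhds c)"
    unfolding inversion_def using xc by (intro tendsto_intros lim) auto
  then have "eventually (\<lambda>c. c + inversion l (x - c) \<in> {z. b < u z}) (nhds c)"
    using u_lsc[of b] b by (intro topological_tendstoD) auto
  moreover have "((\<lambda>c. (l / norm (x - c)) powr q * b) \<longlongrightarrow> ?m * b) (nhds c)"
    using xc l by (intro tendsto_intros lim) auto
  then have "eventually (\<lambda>c. u x < (l / norm (x - c)) powr q * b) (nhds c)"
    using b m by (intro order_tendstoD) (auto simp: field_simps)
  moreover have "((\<lambda>c. norm (x - c)) \<longlongrightarrow> norm (x - c)) (nhds c)"
    by (intro tendsto_intros lim)
  then have "eventually (\<lambda>c. l < norm (x - c)) (nhds c)" using l by (intro order_tendstoD) auto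
  ultimately have "eventually (\<lambda>c. \<not> dominating c) (nhds c)"
  proof eventually_elim
    case (elim c)
    have "(l / norm (x - c)) powr q * b \<le> (l / norm (x - c)) powr q * u (c + inversion l (x - c))"
      using elim by (intro mult_left_mono) auto
    then have "u x < (l / norm (x - c)) powr q * u (c + inversion l (x - c))" using elim by linarith
    then show ?case using elim l unfolding dominating_def by (metis not_le)
  qed
  then obtain W where "open W" "c \<in> W" "\<forall>c\<in>W. \<not> dominating c" by (auto simp: eventually_nhds)
  then show False using dense by blast
qed

lemma symmetric_everywhere: "\<exists>l>0. symmetric_about c l"
proof (rule ccontr)
  assume "\<not> ?thesis"
  then have dom: "dominating c" using dominating_or_symmetric by blast
  have "\<exists>c'\<in>W. dominating c'" if W: "open W" "W \<noteq> {}" for W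
  proof -
    obtain c1 r M where c1: "c1 \<in> W" "r > 0" "\<And>y. y \<in> ball c1 r \<Longrightarrow> u y \<le> M"
      using lsc_locally_bounded_dense[OF u_lsc W] by blast
    then have "dominating c1"
      using dominating_or_symmetric[of c1] dominating_excludes_symmetric[OF dom c1(2,3)] by blast
    then show ?thesis using c1 by blast
  qed
  then have "dominating c'" for c' using dominating_closed by blast
  then show False using not_all_dominating by blast
qed

section \<open>Local boundedness and continuity\<close>

lemma u_locally_bounded: "\<exists>r>0. \<exists>M. \<forall>x\<in>ball c r. u x \<le> M"
  by (rule inversion_symmetric_locally_bounded[OF u_lsc u_pos q_pos]) (use symmetric_everywhere in \<open>force simp: symmetric_about_def\<close>)

lemma v_locally_bounded: "\<exists>r>0. \<exists>M. \<forall>x\<in>ball c r. v x \<le> M"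
  by (rule inversion_symmetric_locally_bounded[OF v_lsc v_pos mu(1)]) (use symmetric_everywhere in \<open>force simp: symmetric_about_def\<close>)

text \<open>The source is bounded near \<open>c\<close>, so the part of the potential from a small
  ball is at most \<open>e\<close> uniformly in the base point; the remaining part converges by
  dominated convergence.\<close>

lemma u_upper_semicontinuous:
  assumes a: "u c < a"
  shows "eventually (\<lambda>x. u x < a) (nhds c)"
proof (rule ccontr)
  assume not_ev: "\<not> ?thesis"
  let ?f = "\<lambda>y. v y * u y powr p"
  define e where "e = (a - u c) / 2"
  have e: "e > 0" "u c + 2 * e = a" using a by (auto simp: e_def field_simps)
  obtain r1 M1 where 1: "r1 > 0" "\<And>x. x \<in> ball c r1 \<Longrightarrow> u x \<le> M1" using u_locally_bounded by blast
  obtain r2 M2 where 2: "r2 > 0" "\<And>x. x \<in> ball c r2 \<Longrightarrow> v x \<le> M2" using v_locally_bounded by blast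
  define M where "M = M2 * M1 powr p"
  have M12: "M1 > 0" "M2 > 0" using 1 2 u_pos[of c] v_pos[of c] by (meson centre_in_ball less_le_trans)+
  have M: "M > 0" using M12 by (simp add: M_def)
  have fM: "?f y \<le> M" if "y \<in> ball c (min r1 r2)" for y
    unfolding M_def using that 1 2 u_pos[of y] p_ge_1 M12 by (intro mult_mono powr_mono2) (auto simp: less_imp_le)
  obtain C where C: "C > 0" "\<And>d x. d > 0 \<Longrightarrow>
    (\<integral>\<^sup>+ y. ennreal (norm ((x::real^'n) - y) powr - q) * indicator (ball x d) y \<partial>lborel)
      \<le> ennreal (C * d powr (real CARD('n) - q))"
    using riesz_kernel_near[OF q_pos q_less] by blast
  obtain e0 where e0: "e0 > 0" "\<And>d. 0 < d \<Longrightarrow> d \<le> e0 \<Longrightarrow> (M * C) * d powr (real CARD('n) - q) \<le> e"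
    using powr_small[of "real CARD('n) - q" "M * C" e] q_less M C e by auto
  \<comment> \<open>The ball of radius \<open>d\<close> about \<open>c\<close> is later enclosed in
    one of radius 2 d about \<open>X n\<close>, where the kernel bound applies; hence the half of
    \<open>e0\<close>.\<close>
  define d where "d = min (e0 / 2) (min r1 r2)"
  have d: "d > 0" "2 * d \<le> e0" "d \<le> min r1 r2" using e0 1 2 by (auto simp: d_def)
  have "\<exists>x. dist x c < min (d / 2) (1 / real (Suc n)) \<and> a \<le> u x" for n
  proof -
    have "min (d / 2) (1 / real (Suc n)) > 0" using d by simp
    then obtain x where "dist x c < min (d / 2) (1 / real (Suc n))" "\<not> u x < a"
      using not_ev unfolding eventually_nhds_metric by blast
    then show ?thesis by (intro exI[of _ x]) auto
  qed
  then have "\<forall>n. \<exists>x. dist x c < min (d / 2) (1 / real (Suc n)) \<and> a \<le> u x" by blast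
  from choice[OF this] obtain X where X: "\<And>n. dist (X n) c < min (d / 2) (1 / real (Suc n))" "\<And>n. a \<le> u (X n)"
    by blast
  have Xlim: "X \<longlonglongrightarrow> c"
  proof (rule metric_tendsto_imp_tendsto[OF LIMSEQ_inverse_real_of_nat])
    show "\<forall>\<^sub>F n in sequentially. dist (X n) c \<le> dist (inverse (real (Suc n))) 0"
    proof (intro always_eventually allI)
      fix n
      have "dist (X n) c \<le> 1 / real (Suc n)" using X(1)[of n] by linarith
      then show "dist (X n) c \<le> dist (inverse (real (Suc n))) 0" by (simp add: divide_inverse)
    qed
  qed
  define I where "I x = (\<integral>\<^sup>+ y. ennreal (?f y * norm (x - y) powr - q) * indicator (- ball c d) y \<partial>lborel)" for x
  have f0: "0 \<le> ?f y" for y using v_pos[of y] by simp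
  have lower: "ennreal (u c + e) \<le> I (X n)" for n
  proof -
    have near: "(\<integral>\<^sup>+ y. ennreal (?f y * norm (X n - y) powr - q) * indicator (ball c d) y \<partial>lborel) \<le> ennreal e"
    proof -
      have "(\<integral>\<^sup>+ y. ennreal (?f y * norm (X n - y) powr - q) * indicator (ball c d) y \<partial>lborel) \<le>
        (\<integral>\<^sup>+ y. ennreal M * (ennreal (norm (X n - y) powr - q) * indicator (ball (X n) (2 * d)) y) \<partial>lborel)"
      proof (rule nn_integral_mono)
        fix y
        show "ennreal (?f y * norm (X n - y) powr - q) * indicator (ball c d) y \<le>
          ennreal M * (ennreal (norm (X n - y) powr - q) * indicator (ball (X n) (2 * d)) y)"
        proof (cases "y \<in> ball c d")
          case True
          have "dist (X n) y < 2 * d"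
            using X(1)[of n] True d(1) dist_triangle[of "X n" y c] by (auto simp: dist_commute)
          moreover have "ennreal (?f y * norm (X n - y) powr - q) \<le> ennreal (M * norm (X n - y) powr - q)"
            using True d by (intro ennreal_leI mult_right_mono fM) auto
          ultimately show ?thesis using True M by (simp add: ennreal_mult)
        qed auto
      qed
      also have "\<dots> = ennreal M * (\<integral>\<^sup>+ y. ennreal (norm (X n - y) powr - q) * indicator (ball (X n) (2 * d)) y \<partial>lborel)"
        by (rule nn_integral_cmult) measurable
      also have "\<dots> \<le> ennreal M * ennreal (C * (2 * d) powr (real CARD('n) - q))"
        using d by (intro mult_left_mono C) auto
      also have "\<dots> = ennreal ((M * C) * (2 * d) powr (real CARD('n) - q))"
        using M C(1) by (simp add: ennreal_mult[symmetric] mult.assoc)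
      also have "\<dots> \<le> ennreal e" using d by (intro ennreal_leI e0) auto
      finally show ?thesis .
    qed
    have "ennreal (u c + e) + ennreal e \<le> ennreal (u (X n))"
      using X(2)[of n] e u_pos[of c] by (simp flip: ennreal_plus add: ennreal_leI)
    also have "ennreal (u (X n)) = (\<integral>\<^sup>+ y. ennreal (?f y * norm (X n - y) powr - q) * indicator (- ball c d) y +
        ennreal (?f y * norm (X n - y) powr - q) * indicator (ball c d) y \<partial>lborel)"
      unfolding u_riesz by (intro nn_integral_cong) (auto simp: indicator_def)
    also have "\<dots> = I (X n) + (\<integral>\<^sup>+ y. ennreal (?f y * norm (X n - y) powr - q) * indicator (ball c d) y \<partial>lborel)"
      unfolding I_def by (rule nn_integral_add) measurable
    also have "\<dots> \<le> I (X n) + ennreal e" by (intro add_left_mono near)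
    finally have "ennreal e + ennreal (u c + e) \<le> ennreal e + I (X n)"
      unfolding add.commute[of "ennreal e"] .
    then show ?thesis unfolding ennreal_add_left_cancel_le by auto
  qed
  have "(\<lambda>n. I (X n)) \<longlonglongrightarrow> I c"
    unfolding I_def
  proof (rule nn_integral_dominated_convergence[where w="\<lambda>y. ennreal (2 powr q) * ennreal (?f y * norm (c - y) powr - q)"])
    show "(\<integral>\<^sup>+ y. ennreal (2 powr q) * ennreal (?f y * norm (c - y) powr - q) \<partial>lborel) < \<infinity>"
      by (subst nn_integral_cmult) (auto simp: u_riesz[symmetric] ennreal_mult_less_top)
    show "AE y in lborel. ennreal (?f y * norm (X n - y) powr - q) * indicator (- ball c d) y
       \<le> ennreal (2 powr q) * ennreal (?f y * norm (c - y) powr - q)" for n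
    proof (rule AE_I2)
      fix y
      show "ennreal (?f y * norm (X n - y) powr - q) * indicator (- ball c d) y
       \<le> ennreal (2 powr q) * ennreal (?f y * norm (c - y) powr - q)"
      proof (cases "y \<in> ball c d")
        case False
        then have y: "d \<le> norm (c - y)" by (simp add: dist_norm)
        \<comment> \<open>The displacement of \<open>X n\<close> is below d/2, hence at most half of
          |c - y|; this is the source of the factor 2^q in the dominating function.\<close>
        have "norm (c - y) / 2 \<le> norm (X n - y)"
          using X(1)[of n] y dist_triangle[of c y "X n"] by (auto simp: dist_norm norm_minus_commute)
        then have "norm (X n - y) powr - q \<le> (norm (c - y) / 2) powr - q"
          using y d q_pos by (intro powr_mono2') auto
        also have "\<dots> = 2 powr q * norm (c - y) powr - q" by (simp add: powr_divide powr_minus_divide)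
        finally have k: "norm (X n - y) powr - q \<le> 2 powr q * norm (c - y) powr - q" .
        have "?f y * norm (X n - y) powr - q \<le> 2 powr q * (?f y * norm (c - y) powr - q)"
          using mult_left_mono[OF k f0[of y]] by (simp only: mult_ac)
        then show ?thesis using False f0[of y] by (simp add: ennreal_mult[symmetric] ennreal_leI)
      qed auto
    qed
    show "AE y in lborel. (\<lambda>n. ennreal (?f y * norm (X n - y) powr - q) * indicator (- ball c d) y)
        \<longlonglongrightarrow> ennreal (?f y * norm (c - y) powr - q) * indicator (- ball c d) y"
      using AE_neq_lborel[of c]
    proof eventually_elim
      case (elim y)
      have "(\<lambda>n. ennreal (?f y * norm (X n - y) powr - q)) \<longlonglongrightarrow> ennreal (?f y * norm (c - y) powr - q)"
        using elim by (intro tendsto_intros Xlim) auto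
      then show ?case by (cases "y \<in> ball c d") auto
    qed
  qed measurable
  then have "ennreal (u c + e) \<le> I c" using lower by (intro LIMSEQ_le_const) auto
  also have "I c \<le> ennreal (u c)"
    unfolding I_def u_riesz by (intro nn_integral_mono) (auto simp: indicator_def)
  finally show False using e u_pos[of c] by simp
qed

lemma continuous_u: "isCont u c"
  unfolding continuous_at
proof (rule tendsto_mono[of _ "nhds c"])
  show "at c \<le> nhds c" by (simp add: at_within_le_nhds)
  show "(u \<longlongrightarrow> u c) (nhds c)"
  proof (rule order_tendstoI)
    fix a assume "a < u c"
    then show "eventually (\<lambda>x. a < u x) (nhds c)"
      using u_lsc[of a] by (auto simp: eventually_nhds)
  qed (rule u_upper_semicontinuous)
qed

end

section \<open>Classification\<close>

lemma quadratic_growth_imp_constant: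
  fixes g :: "'a::real_inner \<Rightarrow> real"
  assumes "\<And>x y. \<bar>g y - g x\<bar> \<le> (norm (y - x))\<^sup>2"
  shows "g x = g y"
proof -
  have "(g has_derivative (\<lambda>h. 0)) (at x)" for x
    unfolding has_derivative_at
  proof
    show "(\<lambda>h. norm (g (x + h) - g x - 0) / norm h) \<midarrow>0\<rightarrow> 0"
    proof (rule tendsto_sandwich[OF _ _ tendsto_const tendsto_norm_zero[OF tendsto_ident_at]])
      show "\<forall>\<^sub>F h in at 0. norm (g (x + h) - g x - 0) / norm h \<le> norm h"
      proof (rule always_eventually, rule allI)
        fix h :: 'a
        show "norm (g (x + h) - g x - 0) / norm h \<le> norm h"
          using assms[of "x + h" x] by (cases "h = 0") (auto simp: divide_le_eq power2_eq_square)
      qed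
    qed (auto intro!: always_eventually)
  qed simp
  then have "\<exists>c. \<forall>x\<in>UNIV. g x = c"
    by (intro has_derivative_zero_constant) (auto simp: convex_UNIV)
  then show ?thesis by auto
qed

section \<open>The inversion radius as a function of the centre\<close>

context hartree_translates
begin

text \<open>An arbitrary choice at each centre. It turns out to be determined by u, see
  \<open>radius_eq_u\<close>, which is also the source of its continuity.\<close>

definition radius :: "real^'n \<Rightarrow> real" where
  "radius c = (SOME l. l > 0 \<and> symmetric_about c l)"

lemma radius_pos: "radius c > 0" and symmetric_radius: "symmetric_about c (radius c)"
proof -
  have "\<exists>l. l > 0 \<and> symmetric_about c l" using symmetric_everywhere[of c] by blast
  then have "radius c > 0 \<and> symmetric_about c (radius c)" unfolding radius_def by (rule someI_ex)
  then show "radius c > 0" "symmetric_about c (radius c)" by blast+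
qed

definition asym :: real where
  "asym = radius 0 powr q * u 0"

lemma asym_pos: "asym > 0"
  using radius_pos[of 0] u_pos[of 0] by (simp add: asym_def)

text \<open>Both sides are the limit of \<open>\<bar>x\<bar>\<^bsup>N-2\<^esup> u(x)\<close> at infinity, read off from the symmetry about
  \<open>c\<close> and about the origin.\<close>
lemma radius_powr_u: "radius c powr q * u c = asym"
proof -
  obtain b :: "real^'n" where b: "norm b = 1" using vector_choose_size[of 1] by auto
  define X where "X n = real n *\<^sub>R b" for n :: nat
  have nX: "norm (X n) = real n" for n using b by (simp add: X_def)
  have ntop: "filterlim (\<lambda>n. norm (X n - c)) at_top sequentially" for c
  proof (rule filterlim_at_top_mono)
    show "filterlim (\<lambda>n. real n - norm c) at_top sequentially"
      using filterlim_tendsto_add_at_top[OF tendsto_const[of "- norm c"] filterlim_real_sequentially] by simp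
    show "\<forall>\<^sub>F n in sequentially. real n - norm c \<le> norm (X n - c)"
      using norm_triangle_ineq2[of "X _" c] by (auto simp: nX intro!: always_eventually)
  qed
  have lim: "(\<lambda>n. norm (X n - c) powr q * u (X n)) \<longlonglongrightarrow> radius c powr q * u c" for c
  proof -
    have inv0: "(\<lambda>n. inversion (radius c) (X n - c)) \<longlonglongrightarrow> 0"
    proof (rule tendsto_norm_zero_cancel)
      show "(\<lambda>n. norm (inversion (radius c) (X n - c))) \<longlonglongrightarrow> 0"
        unfolding norm_inversion by (rule tendsto_divide_0[OF tendsto_const filterlim_at_top_imp_at_infinity[OF ntop]])
    qed
    have "(\<lambda>n. c + inversion (radius c) (X n - c)) \<longlonglongrightarrow> c"
      using tendsto_add[OF tendsto_const[of c] inv0] by simp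
    then have "(\<lambda>n. u (c + inversion (radius c) (X n - c))) \<longlonglongrightarrow> u c"
      by (rule isCont_tendsto_compose[OF continuous_u])
    then have "(\<lambda>n. radius c powr q * u (c + inversion (radius c) (X n - c))) \<longlonglongrightarrow> radius c powr q * u c"
      by (intro tendsto_intros)
    moreover have ev0: "eventually (\<lambda>n. 0 < norm (X n - c)) sequentially"
      using ntop[of c] unfolding filterlim_at_top_dense by blast
    have "eventually (\<lambda>n. radius c powr q * u (c + inversion (radius c) (X n - c)) = norm (X n - c) powr q * u (X n)) sequentially"
      using ev0
    proof eventually_elim
      case (elim n)
      then have "X n \<noteq> c" by auto
      then have "u (X n) = (radius c / norm (X n - c)) powr q * u (c + inversion (radius c) (X n - c))"
        using symmetric_radius[of c] unfolding symmetric_about_def by blast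
      moreover have "norm (X n - c) powr q * (radius c / norm (X n - c)) powr q = radius c powr q"
        using elim by (simp flip: powr_mult)
      ultimately show ?case by (simp flip: mult.assoc)
    qed
    ultimately show ?thesis by (rule Lim_transform_eventually)
  qed
  \<comment> \<open>The weights |X n - c|^q and |X n|^q are asymptotically equal, so the limits for
    the centres \<open>c\<close> and 0 coincide.\<close>
  have ratio: "(\<lambda>n. (norm (X n - c) / norm (X n)) powr q) \<longlonglongrightarrow> 1 powr q"
  proof -
    have "(\<lambda>n. norm (X n - c) / norm (X n)) \<longlonglongrightarrow> 1"
    proof (rule tendsto_sandwich)
      have "(\<lambda>n. norm c / real n) \<longlonglongrightarrow> 0" by (rule lim_const_over_n)
      from tendsto_diff[OF tendsto_const[of 1] this] tendsto_add[OF tendsto_const[of 1] this]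
      show "(\<lambda>n. 1 - norm c / real n) \<longlonglongrightarrow> 1" "(\<lambda>n. 1 + norm c / real n) \<longlonglongrightarrow> 1" by simp_all
      show "\<forall>\<^sub>F n in sequentially. 1 - norm c / real n \<le> norm (X n - c) / norm (X n)"
        using eventually_gt_at_top[of 0]
      proof eventually_elim
        case (elim n)
        have "real n - norm c \<le> norm (X n - c)" using norm_triangle_ineq2[of "X n" c] by (simp add: nX)
        then have "(real n - norm c) / real n \<le> norm (X n - c) / real n" by (rule divide_right_mono) simp
        then show ?case using elim by (simp add: nX diff_divide_distrib)
      qed
      show "\<forall>\<^sub>F n in sequentially. norm (X n - c) / norm (X n) \<le> 1 + norm c / real n"
        using eventually_gt_at_top[of 0]
      proof eventually_elim
        case (elim n)
        have "norm (X n - c) \<le> real n + norm c" using norm_triangle_ineq4[of "X n" c] by (simp add: nX)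
        then have "norm (X n - c) / real n \<le> (real n + norm c) / real n" by (rule divide_right_mono) simp
        then show ?case using elim by (simp add: nX add_divide_distrib)
      qed
    qed
    then show ?thesis by (intro tendsto_intros) auto
  qed
  have "(\<lambda>n. norm (X n - c) powr q * u (X n)) \<longlonglongrightarrow> 1 powr q * asym"
  proof (rule Lim_transform_eventually)
    show "(\<lambda>n. (norm (X n - c) / norm (X n)) powr q * (norm (X n - 0) powr q * u (X n))) \<longlonglongrightarrow> 1 powr q * asym"
      unfolding asym_def by (intro tendsto_mult ratio lim)
    show "\<forall>\<^sub>F n in sequentially. (norm (X n - c) / norm (X n)) powr q * (norm (X n - 0) powr q * u (X n)) = norm (X n - c) powr q * u (X n)"
      using eventually_gt_at_top[of 0]
    proof eventually_elim
      case (elim n)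
      have "(norm (X n - c) / norm (X n)) powr q * norm (X n) powr q = norm (X n - c) powr q"
        using elim by (simp add: nX flip: powr_mult)
      then show ?case by (simp flip: mult.assoc)
    qed
  qed
  then show ?thesis using LIMSEQ_unique[OF lim[of c]] by simp
qed

lemma u_eq_radius: "u x = asym * radius x powr - q"
proof -
  have "asym * radius x powr - q = u x * (radius x powr q * radius x powr - q)"
    by (simp add: radius_powr_u[of x, symmetric] mult_ac)
  also have "radius x powr q * radius x powr - q = 1"
    using radius_pos[of x] by (simp flip: powr_add)
  finally show ?thesis by simp
qed

lemma radius_eq_u: "radius x = (asym / u x) powr (1 / q)"
proof -
  have "radius x powr q = asym / u x" using radius_powr_u[of x] u_pos[of x] by (simp add: field_simps)
  then have "(radius x powr q) powr (1 / q) = (asym / u x) powr (1 / q)" by simp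
  then show ?thesis using q_pos radius_pos[of x] by (simp add: powr_powr)
qed

lemma continuous_radius: "isCont radius x"
proof -
  have "isCont (\<lambda>x. (asym / u x) powr (1 / q)) x"
    using asym_pos u_pos[of x] by (intro continuous_intros continuous_u) auto
  then show ?thesis using radius_eq_u by presburger
qed

text \<open>As u is a multiple of radius^(-q), the power q can be removed from the symmetry
  relation, leaving an identity between radii and distances only.\<close>

lemma radius_inversion:
  assumes "x \<noteq> c"
  shows "radius x * radius c = norm (x - c) * radius (c + inversion (radius c) (x - c))"
proof -
  let ?P = "c + inversion (radius c) (x - c)"
  have n: "norm (x - c) > 0" using assms by simp
  have "u x = (radius c / norm (x - c)) powr q * u ?P"
    using symmetric_radius[of c] assms unfolding symmetric_about_def by blast
  then have "radius x powr - q = (radius c / norm (x - c)) powr q * radius ?P powr - q"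
    using asym_pos by (simp add: u_eq_radius[of x] u_eq_radius[of ?P])
  also have "(radius c / norm (x - c)) powr q = (norm (x - c) / radius c) powr - q"
    by (simp add: powr_divide powr_minus_divide)
  also have "(norm (x - c) / radius c) powr - q * radius ?P powr - q = ((norm (x - c) / radius c) * radius ?P) powr - q"
    by (simp only: powr_mult)
  finally have "(radius x powr - q) powr (- 1 / q) = (((norm (x - c) / radius c) * radius ?P) powr - q) powr (- 1 / q)" by simp
  then have "radius x = (norm (x - c) / radius c) * radius ?P"
    using q_pos radius_pos[of x] radius_pos[of c] radius_pos[of ?P] n by (simp add: powr_powr)
  then show ?thesis using radius_pos[of c] by (simp add: field_simps)
qed

text \<open>The inversion about the origin shows at least linear growth at infinity, since the image
  of a far point lies near 0, where the radius is bounded below by continuity. Compactness does the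
  rest.\<close>

lemma radius_attains_min: "\<exists>x0. \<forall>x. radius x0 \<le> radius x"
proof -
  have "eventually (\<lambda>z. radius 0 / 2 < radius z) (at (0::real^'n))"
    using continuous_radius[of 0] radius_pos[of 0] unfolding isCont_def by (intro order_tendstoD) auto
  then obtain d where d: "d > 0" "\<And>z. z \<noteq> 0 \<Longrightarrow> dist z 0 < d \<Longrightarrow> radius 0 / 2 < radius z"
    unfolding eventually_at by blast
  \<comment> \<open>The first summand gives R/2 >= radius 0, the second puts the inverse point
    within distance \<open>d\<close> of the origin.\<close>
  define R where "R = 2 * radius 0 + 2 * (radius 0)\<^sup>2 / d"
  have R: "R > 0" "R \<ge> 2 * radius 0" "R > (radius 0)\<^sup>2 / d"
  proof -
    have "0 < (radius 0)\<^sup>2 / d" "0 < radius 0" using d radius_pos[of 0] by auto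
    then show "R > 0" "R \<ge> 2 * radius 0" "R > (radius 0)\<^sup>2 / d" unfolding R_def by linarith+
  qed
  have far: "radius 0 \<le> radius x" if x: "R \<le> norm x" for x
  proof -
    have x0: "x \<noteq> 0" using x R by auto
    let ?P = "inversion (radius 0) x"
    have "norm ?P < d"
    proof -
      have "(radius 0)\<^sup>2 / norm x \<le> (radius 0)\<^sup>2 / R"
        using x R x0 by (intro divide_left_mono mult_pos_pos) auto
      also have "\<dots> < d" using R d by (simp add: field_simps)
      finally show ?thesis by (simp add: norm_inversion)
    qed
    moreover have "?P \<noteq> 0" using x0 radius_pos[of 0] by simp
    ultimately have "radius 0 / 2 < radius ?P" using d by (simp add: dist_norm)
    then have "R * (radius 0 / 2) \<le> norm x * radius ?P"
      using x R radius_pos[of 0] by (intro mult_mono) auto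
    also have "\<dots> = radius x * radius 0" using radius_inversion[OF x0] by simp
    finally have "R / 2 \<le> radius x" using radius_pos[of 0] by simp
    then show ?thesis using R by linarith
  qed
  have "continuous_on (cball 0 R) radius"
    by (intro continuous_at_imp_continuous_on ballI continuous_radius)
  then obtain x0 where x0: "x0 \<in> cball 0 R" "\<And>y. y \<in> cball 0 R \<Longrightarrow> radius x0 \<le> radius y"
    using continuous_attains_inf[of "cball (0::real^'n) R" radius] R by auto
  have "radius x0 \<le> radius x" for x
  proof (cases "x \<in> cball 0 R")
    case False
    then have "radius 0 \<le> radius x" by (intro far) auto
    moreover have "radius x0 \<le> radius 0" using x0 R by auto
    ultimately show ?thesis by linarith
  qed (rule x0)
  then show ?thesis by blast
qed

theorem radius_squared: "\<exists>x0. \<forall>x. (radius x)\<^sup>2 = (radius x0)\<^sup>2 + (norm (x - x0))\<^sup>2"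
proof -
  obtain x0 where min: "\<And>x. radius x0 \<le> radius x" using radius_attains_min by blast
  \<comment> \<open>Inversion about \<open>x0\<close>, together with minimality at the image
    point.\<close>
  have ge: "norm (y - x0) \<le> radius y" for y
  proof (cases "y = x0")
    case False
    have "radius y * radius x0 = norm (y - x0) * radius (x0 + inversion (radius x0) (y - x0))"
      by (rule radius_inversion[OF False])
    also have "\<dots> \<ge> norm (y - x0) * radius x0" by (intro mult_left_mono min) auto
    finally show ?thesis using radius_pos[of x0] by simp
  qed (use radius_pos[of y] in auto)
  let ?h = "\<lambda>x. (radius x)\<^sup>2"
  \<comment> \<open>Inversion about \<open>x\<close> is applied to \<open>x'\<close>, and the radius
    at the image is bounded below by \<open>ge\<close>. In the expanded square the term n |x - x0|^2
    is discarded and a factor \<open>?h x\<close> is divided out.\<close>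
  have sub: "?h x + 2 * ((x - x0) \<bullet> (x' - x)) \<le> ?h x'" for x x'
  proof (cases "x' = x")
    case False
    let ?d = "x' - x"
    define n where "n = (norm ?d)\<^sup>2"
    have n: "n > 0" using False by (simp add: n_def)
    let ?y = "x + inversion (radius x) ?d"
    have "?h x' * ?h x = n * ?h ?y"
      unfolding n_def power_mult_distrib[symmetric] radius_inversion[OF False] ..
    also have "n * ?h ?y \<ge> n * (norm (?y - x0))\<^sup>2"
      using n ge[of ?y] by (intro mult_left_mono power_mono) auto
    finally have 1: "n * (norm (?y - x0))\<^sup>2 \<le> ?h x' * ?h x" .
    have "?y - x0 = (x - x0) + (?h x / n) *\<^sub>R ?d" by (simp add: inversion_def n_def)
    then have "(norm (?y - x0))\<^sup>2 = (norm (x - x0))\<^sup>2 + 2 * ((x - x0) \<bullet> ((?h x / n) *\<^sub>R ?d)) + (norm ((?h x / n) *\<^sub>R ?d))\<^sup>2"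
      by (simp only: power2_norm_eq_inner inner_add_left inner_add_right inner_commute mult_2 add_ac)
    also have "(norm ((?h x / n) *\<^sub>R ?d))\<^sup>2 = (?h x)\<^sup>2 / n"
    proof -
      have "(norm ((?h x / n) *\<^sub>R ?d))\<^sup>2 = (?h x / n)\<^sup>2 * n"
        by (simp only: norm_scaleR power_mult_distrib power2_abs n_def)
      then show ?thesis using n by (simp add: power_divide power2_eq_square[of n])
    qed
    finally have "n * (norm (?y - x0))\<^sup>2 = n * (norm (x - x0))\<^sup>2 + 2 * ?h x * ((x - x0) \<bullet> ?d) + (?h x)\<^sup>2"
      using n by (simp add: distrib_left)
    then have "2 * ?h x * ((x - x0) \<bullet> ?d) + (?h x)\<^sup>2 \<le> ?h x' * ?h x"
      using 1 n by (smt (verit) mult_nonneg_nonneg zero_le_power2)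
    then have "?h x * (?h x + 2 * ((x - x0) \<bullet> ?d)) \<le> ?h x * ?h x'"
      by (simp add: algebra_simps power2_eq_square)
    then show ?thesis using radius_pos[of x] by simp
  qed simp
  \<comment> \<open>The function |x - x0|^2 has the same slope 2 (x - x0), with remainder |x' -
    x|^2, so \<open>g\<close> satisfies a one-sided quadratic bound; exchanging the points makes it
    two-sided.\<close>
  define g where "g x = ?h x - (norm (x - x0))\<^sup>2" for x
  have exp: "(norm (x' - x0))\<^sup>2 = (norm (x - x0))\<^sup>2 + 2 * ((x - x0) \<bullet> (x' - x)) + (norm (x' - x))\<^sup>2" for x x'
  proof -
    have "x' - x0 = (x - x0) + (x' - x)" by simp
    then show ?thesis
      by (simp only: power2_norm_eq_inner inner_add_left inner_add_right inner_commute mult_2 add_ac)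
  qed
  have "\<bar>g x' - g x\<bar> \<le> (norm (x' - x))\<^sup>2" for x x'
  proof -
    have "- (norm (x' - x))\<^sup>2 \<le> g x' - g x" for x x'
      using sub[of x x'] exp[of x' x] by (simp add: g_def)
    from this[of x' x] this[of x x'] show ?thesis by (simp add: norm_minus_commute)
  qed
  then have const: "g x = g x0" for x by (rule quadratic_growth_imp_constant)
  have "?h x = ?h x0 + (norm (x - x0))\<^sup>2" for x using const[of x] by (simp add: g_def)
  then show ?thesis by blast
qed

theorem classification:
  "\<exists>x0 c t. c > 0 \<and> t > 0 \<and> (\<forall>x. u x = c * (t / (t\<^sup>2 + (norm (x - x0))\<^sup>2)) powr (q / 2)) \<and>
     radially_symmetric_about x0 u \<and> radially_symmetric_about x0 v"
proof -
  obtain x0 where h: "\<And>x. (radius x)\<^sup>2 = (radius x0)\<^sup>2 + (norm (x - x0))\<^sup>2"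
    using radius_squared by blast
  define t where "t = radius x0"
  have t: "t > 0" by (simp add: t_def radius_pos)
  \<comment> \<open>The power of \<open>t\<close> cancels the numerator t^(q/2) of the bubble,
    leaving u = \<open>asym\<close> times radius^(-q).\<close>
  define c where "c = asym * t powr - (q / 2)"
  have c: "c > 0" using asym_pos t by (simp add: c_def)
  have form: "u x = c * (t / (t\<^sup>2 + (norm (x - x0))\<^sup>2)) powr (q / 2)" for x
  proof -
    have "(t / (t\<^sup>2 + (norm (x - x0))\<^sup>2)) powr (q / 2) = t powr (q / 2) * ((radius x)\<^sup>2) powr - (q / 2)"
      using h[of x] by (simp add: t_def powr_divide powr_minus_divide)
    also have "((radius x)\<^sup>2) powr - (q / 2) = radius x powr - q"
      using radius_pos[of x] by (simp add: powr_powr flip: powr_numeral)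
    finally have "c * (t / (t\<^sup>2 + (norm (x - x0))\<^sup>2)) powr (q / 2) = asym * radius x powr - q * (t powr - (q / 2) * t powr (q / 2))"
      by (simp add: c_def mult_ac)
    also have "t powr - (q / 2) * t powr (q / 2) = 1" using t by (simp flip: powr_add)
    finally show ?thesis using u_eq_radius[of x] by simp
  qed
  have rad_u: "radially_symmetric_about x0 u"
    unfolding radially_symmetric_about_def using form by metis
  text \<open>The inversion about \<open>x0 - (t\<^sup>2 / \<bar>a - x0\<bar>\<^sup>2) (a - x0)\<close> maps \<open>a\<close> to \<open>x0\<close>.\<close>
  define k where "k r = sqrt (t\<^sup>2 + (t\<^sup>2 / r)\<^sup>2) / ((1 + t\<^sup>2 / r\<^sup>2) * r)" for r
  have v_val: "v a = k (norm (a - x0)) powr \<mu> * v x0" if a: "a \<noteq> x0" for a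
  proof -
    define r where "r = norm (a - x0)"
    have r: "r > 0" using a by (simp add: r_def)
    define s where "s = t\<^sup>2 / r\<^sup>2"
    have s: "s > 0" using t r by (simp add: s_def)
    define z where "z = x0 - s *\<^sub>R (a - x0)"
    have az: "a - z = (1 + s) *\<^sub>R (a - x0)" by (simp add: z_def algebra_simps)
    have naz: "norm (a - z) = (1 + s) * r" unfolding az using s by (simp add: r_def)
    have az0: "a \<noteq> z" using naz s r by auto
    have "norm (z - x0) = s * r" using s by (simp add: z_def r_def)
    then have hz: "(radius z)\<^sup>2 = t\<^sup>2 + (s * r)\<^sup>2" using h[of z] by (simp add: t_def)
    have sr: "s * r = t\<^sup>2 / r" using r by (simp add: s_def power2_eq_square)
    \<comment> \<open>This is the product of |z - x0| = s r and |a - z| = (1 + s) r, the condition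
      for \<open>a\<close> and \<open>x0\<close> to be inverse points about
      \<open>z\<close>.\<close>
    have "(radius z)\<^sup>2 = s * (1 + s) * r\<^sup>2"
    proof -
      have "t\<^sup>2 = s * r\<^sup>2" using r by (simp add: s_def)
      then show ?thesis unfolding hz by (simp add: algebra_simps power2_eq_square)
    qed
    then have "(radius z)\<^sup>2 / (norm (a - z))\<^sup>2 * (1 + s) = s"
      unfolding naz using s r by (simp add: power2_eq_square)
    moreover have "inversion (radius z) (a - z) = ((radius z)\<^sup>2 / (norm (a - z))\<^sup>2 * (1 + s)) *\<^sub>R (a - x0)"
      unfolding inversion_def by (subst (2) az) (simp only: scaleR_scaleR)
    ultimately have "z + inversion (radius z) (a - z) = x0" by (simp add: z_def)
    then have "v a = (radius z / norm (a - z)) powr \<mu> * v x0"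
      using symmetric_radius[of z] az0 unfolding symmetric_about_def by metis
    moreover have "radius z = sqrt (t\<^sup>2 + (t\<^sup>2 / r)\<^sup>2)"
      using hz radius_pos[of z] unfolding sr by (metis less_imp_le real_sqrt_unique)
    ultimately show ?thesis by (simp add: k_def naz s_def r_def)
  qed
  have "radially_symmetric_about x0 v"
    unfolding radially_symmetric_about_def
  proof (intro allI impI)
    fix a b assume ab: "norm (a - x0) = norm (b - x0)"
    show "v a = v b"
    proof (cases "a = x0")
      case True
      then show ?thesis using ab by simp
    next
      case False
      then have "b \<noteq> x0" using ab by auto
      then show ?thesis using v_val[OF False] v_val[of b] ab by simp
    qed
  qed
  with rad_u form c t show ?thesis by blast
qed

end

section \<open>From the stated hypotheses to the translated systems\<close>

lemma nn_integral_eq_has_bochner_integral: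
  fixes f :: "'a \<Rightarrow> real"
  assumes "has_bochner_integral M f x" "\<And>y. 0 \<le> f y"
  shows "(\<integral>\<^sup>+ y. ennreal (f y) \<partial>M) = ennreal x"
  using assms by (subst nn_integral_eq_integral) (auto simp: has_bochner_integral_iff)

lemma Lp_loc_integral_finite:
  fixes w :: "real^'n::finite \<Rightarrow> real"
  assumes "Lp_loc a w" "\<And>x. 0 < w x" and [measurable]: "w \<in> borel_measurable borel"
  shows "(\<integral>\<^sup>+ y. ennreal (w (c + y) powr a) * indicator (ball 0 R) y \<partial>lborel) < \<infinity>"
proof -
  have "integrable lebesgue (\<lambda>x. indicator (cball c R) x *\<^sub>R \<bar>w x\<bar> powr a)"
    using assms(1) by (auto simp: Lp_loc_def set_integrable_def)
  then have "(\<integral>\<^sup>+ x. ennreal (norm (indicator (cball c R) x *\<^sub>R \<bar>w x\<bar> powr a)) \<partial>lebesgue) < \<infinity>"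
    by (simp add: integrable_iff_bounded)
  moreover have "(\<integral>\<^sup>+ y. ennreal (w (c + y) powr a) * indicator (ball 0 R) y \<partial>lborel)
     \<le> (\<integral>\<^sup>+ y. (\<lambda>x. ennreal (indicator (cball c R) x *\<^sub>R \<bar>w x\<bar> powr a)) (c + y) \<partial>lborel)"
    using assms(2) by (intro nn_integral_mono) (auto simp: indicator_def dist_norm less_imp_le)
  moreover have "\<dots> = (\<integral>\<^sup>+ x. ennreal (norm (indicator (cball c R) x *\<^sub>R \<bar>w x\<bar> powr a)) \<partial>lebesgue)"
  proof (subst nn_integral_lborel_translate)
    have [measurable]: "cball c R \<in> sets borel" by simp
    show "(\<lambda>x. ennreal (indicator (cball c R) x *\<^sub>R \<bar>w x\<bar> powr a)) \<in> borel_measurable borel"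
      by measurable
  qed (simp add: nn_integral_completion)
  ultimately show ?thesis by simp
qed

theorem theorem1p3:
  fixes u v :: "real ^ 'n::finite \<Rightarrow> real" and \<mu> :: real
  assumes "CARD('n) \<ge> 3"
    and "0 < \<mu>"
    and "CARD('n) = 3 \<or> CARD('n) = 4 \<longrightarrow> \<mu> < real CARD('n)"
    and "CARD('n) \<ge> 5 \<longrightarrow> \<mu> \<le> 4"
    and "Lp_loc (two_star CARD('n)) u"
    and "Lp_loc (2 * real CARD('n) / \<mu>) v"
    and "positive_solution_pair \<mu> u v"
  shows "(\<exists>p. radially_symmetric_about p u \<and> radially_symmetric_about p v) \<and>
    (\<exists>x0 c t. c > 0 \<and> t > 0 \<and>
      (\<forall>x. u x = c * (t / (t\<^sup>2 + (norm (x - x0))\<^sup>2)) powr ((real CARD('n) - 2) / 2)))"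
proof -
  let ?N = "real CARD('n)"
  define p where "p = (?N + 2 - \<mu>) / (?N - 2)"
  define q where "q = ?N - 2"
  have N: "?N - 2 > 0" using assms(1) by simp
  have p1: "two_star_mu CARD('n) \<mu> = p + 1" using N by (simp add: two_star_mu_def p_def field_simps)
  \<comment> \<open>In dimensions 3 and 4 the bound \<mu> < N implies \<mu> <= 4; from dimension 5
    on, \<mu> <= 4 implies \<mu> < N.\<close>
  have mu: "\<mu> < ?N" "\<mu> \<le> 4"
  proof -
    have "CARD('n) = 3 \<or> CARD('n) = 4 \<or> CARD('n) \<ge> 5" using assms(1) by linarith
    then show "\<mu> < ?N" "\<mu> \<le> 4" using assms(3,4) by auto
  qed
  have pos: "\<And>x. 0 < u x" "\<And>x. 0 < v x"
    using assms(7) by (auto simp: positive_solution_pair_def)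
  have u_leb [measurable]: "u \<in> borel_measurable lebesgue" and v_leb [measurable]: "v \<in> borel_measurable lebesgue"
    using assms(5,6) by (auto simp: Lp_loc_def)
  have u_eq: "ennreal (u x) = (\<integral>\<^sup>+ y. ennreal ((v y * u y powr p) * norm (x - y) powr - q) \<partial>lebesgue)" for x
  proof -
    have "has_bochner_integral lebesgue (\<lambda>y. v y * u y powr p / norm (x - y) powr q) (u x)"
      using assms(7) by (auto simp: positive_solution_pair_def p1 q_def)
    from nn_integral_eq_has_bochner_integral[OF this] show ?thesis
      using pos by (simp add: powr_minus_divide less_imp_le)
  qed
  have v_eq: "ennreal (v x) = (\<integral>\<^sup>+ y. ennreal (u y powr (p + 1) * norm (x - y) powr - \<mu>) \<partial>lebesgue)" for x
  proof -
    have "has_bochner_integral lebesgue (\<lambda>y. u y powr (p + 1) / norm (x - y) powr \<mu>) (v x)"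
      using assms(7) by (auto simp: positive_solution_pair_def p1)
    from nn_integral_eq_has_bochner_integral[OF this] show ?thesis
      by (simp add: powr_minus_divide)
  qed
  \<comment> \<open>Semicontinuity yields Borel measurability, after which \<open>lebesgue\<close>
    can be replaced by \<open>lborel\<close> in both equations.\<close>
  have u_lsc: "open {x. a < u x}" for a
    by (rule lower_semicontinuous_riesz[OF _ _ u_eq]) (use pos in \<open>auto simp: less_imp_le\<close>)
  have v_lsc: "open {x. a < v x}" for a
    by (rule lower_semicontinuous_riesz[OF _ _ v_eq]) (use pos in \<open>auto simp: less_imp_le\<close>)
  have [measurable]: "u \<in> borel_measurable borel" "v \<in> borel_measurable borel"
    by (auto intro: lsc_measurable u_lsc v_lsc)
  have shift_open: "open {x. a < w (c + x)}" if "\<And>a. open {x. a < w x}" for w :: "real^'n \<Rightarrow> real" and a c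
  proof -
    have "open ((+) c -` {x. a < w x})"
      by (rule open_vimage[OF that]) (intro continuous_intros)
    then show ?thesis by (simp add: vimage_def)
  qed
  have sys: "hartree_system (\<lambda>x. u (c + x)) (\<lambda>x. v (c + x)) \<mu> p q (2 * ?N / q) (2 * ?N / \<mu>)" for c
  proof
    fix x
    have "ennreal (u (c + x)) = (\<integral>\<^sup>+ y. ennreal ((v y * u y powr p) * norm (c + x - y) powr - q) \<partial>lborel)"
      by (simp add: u_eq nn_integral_completion)
    also have "\<dots> = (\<integral>\<^sup>+ y. ennreal ((v (c + y) * u (c + y) powr p) * norm (c + x - (c + y)) powr - q) \<partial>lborel)"
      by (rule nn_integral_lborel_translate[symmetric]) measurable
    finally show "ennreal (u (c + x)) = (\<integral>\<^sup>+ y. ennreal ((v (c + y) * u (c + y) powr p) * norm (x - y) powr - q) \<partial>lborel)"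
      by simp
    have "ennreal (v (c + x)) = (\<integral>\<^sup>+ y. ennreal (u y powr (p + 1) * norm (c + x - y) powr - \<mu>) \<partial>lborel)"
      by (simp add: v_eq nn_integral_completion)
    also have "\<dots> = (\<integral>\<^sup>+ y. ennreal (u (c + y) powr (p + 1) * norm (c + x - (c + y)) powr - \<mu>) \<partial>lborel)"
      by (rule nn_integral_lborel_translate[symmetric]) measurable
    finally show "ennreal (v (c + x)) = (\<integral>\<^sup>+ y. ennreal (u (c + y) powr (p + 1) * norm (x - y) powr - \<mu>) \<partial>lborel)"
      by simp
  next
    fix R
    have "Lp_loc (2 * ?N / q) u" using assms(5) by (simp add: two_star_def q_def)
    then show "(\<integral>\<^sup>+ y. ennreal (u (c + y) powr (2 * ?N / q)) * indicator (ball 0 R) y \<partial>lborel) < \<infinity>"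
      using pos by (intro Lp_loc_integral_finite) auto
    show "(\<integral>\<^sup>+ y. ennreal (v (c + y) powr (2 * ?N / \<mu>)) * indicator (ball 0 R) y \<partial>lborel) < \<infinity>"
      using pos assms(6) by (intro Lp_loc_integral_finite) auto
  qed (use assms(1,2) mu pos in \<open>auto simp: p_def q_def intro!: shift_open u_lsc v_lsc\<close>)
  interpret hartree_translates u v \<mu> p q "2 * ?N / q" "2 * ?N / \<mu>"
    by (rule hartree_translates.intro) (rule sys)
  show ?thesis using classification unfolding q_def by blast
qed

end
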